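(* Let $\Gamma$ be any metric graph, of genus $g$, with a fixed model $G=(V,E)$ without self-loops, and let $K$ be its canonical divisor. Then there always exists a maximal cell $\sigma$ of $|K|$ of dimension $g-1$. Furthermore, for any $D$ in the relative interior of $\sigma$, one has $\mathrm{supp}(D)\cap V=\emptyset$.
   Context: Metric graph: a compact length space (infinite distances between different components are allowed) in which every point $x$ has a neighbourhood that is a star of finitely many ($=\mathrm{val}(x)$) half-open segments glued at $x$. A model $G=(V,E)$ is given by a finite $V\subset\Gamma$ with $\Gamma\setminus V$ a disjoint union of open intervals (the edges $e$, of lengths $l(e)$). The genus is the first Betti number of $\Gamma$. A divisor is a finite formal sum $D=\sum_x D(x)\,x$, $D(x)\in\mathbb Z$; $\mathrm{supp}(D)=\{x:D(x)\neq0\}$; $D\ge0$ (effective) if all $D(x)\ge0$. The canonical divisor is $K=\sum_x(\mathrm{val}(x)-2)\,x$. A rational function is a continuous piecewise linear $f:\Gamma\to\mathbb R$ with integer slopes; $\mathrm{ord}_x(f)$ is the sum of its outgoing slopes at $x$, $\mathrm{div}(f)=\sum_x\mathrm{ord}_x(f)\,x$. $D\sim D'$ iff $D-D'=\mathrm{div}(f)$ for some rational $f$; $|D|=\{D'\ge0:D'\sim D\}$. Cell structure of $|D_0|$ (here $D_0=K$): orient each edge $e$ and identify it with $[0,l(e)]$. For data $m_V:V\to\mathbb N$, $m_E:E\to\bigcup_{k\ge0}\mathbb N_{>0}^k$, $s:E\to\mathbb Z$, the associated open cell is the set of $D'=D_0+\mathrm{div}(f)\in|D_0|$ such that $D'(v)=m_V(v)$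 for all $v\in V$; on the interior of each edge $e$, $D'$ equals $\sum_i m_E(e)_i\,x_i$ with $0<x_1<\dots<x_k<l(e)$; and the slope of $f$ at the origin of $e$ along $e$ is $s(e)$. The cells are the closures of the nonempty open cells (the open cell being the relative interior); in the coordinates given by the positions $x_i$ of the chips along edges they are polyhedra, and the dimension of a cell is its dimension as a polyhedron. A cell is maximal if it is inclusion-maximal.
   Formalization: The metric graph is taken to be connected and of genus g ≥ 1: the claim fails for two disjoint circles (g = 2, K = 0, |K| = {0} has dimension 0) and for trees (g = 0, deg K = −2, |K| is empty, so there is no cell). *)

theory Defs
  imports "HOL-Analysis.Analysis" "HOL-Library.Function_Algebras"
begin

definition fscale :: "real \<Rightarrow> ('i \<Rightarrow> real) \<Rightarrow> ('i \<Rightarrow> real)" where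
  "fscale c x = (\<lambda>i. c * x i)"

interpretation fun_space: vector_space fscale
  by unfold_locales (auto simp: fscale_def algebra_simps)

text \<open>Dimension of the affine hull of a nonempty set, used as the dimension of a polyhedron.\<close>

definition affine_dim :: "('i \<Rightarrow> real) set \<Rightarrow> nat" where
  "affine_dim S = fun_space.dim {x - y | x y. x \<in> S \<and> y \<in> S}"

definition path_length :: "(real \<Rightarrow> 'a::metric_space) \<Rightarrow> ennreal" where
  "path_length p =
     (SUP (n, t) \<in> {(n :: nat, t :: nat \<Rightarrow> real). mono t \<and> range t \<subseteq> {0..1}}.
        \<Sum>i<n. ennreal (dist (p (t i)) (p (t (Suc i)))))"

text \<open>The infimum over the empty set is \<open>\<infinity>\<close>. As \<open>dist\<close> is real-valued, a length space in
  this sense is path-connected.\<close>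

definition length_space :: "'a::metric_space set \<Rightarrow> bool" where
  "length_space \<Gamma> \<longleftrightarrow> (\<forall>x\<in>\<Gamma>. \<forall>y\<in>\<Gamma>.
     ennreal (dist x y) =
       (INF p \<in> {p. path p \<and> path_image p \<subseteq> \<Gamma> \<and> pathstart p = x \<and> pathfinish p = y}.
          path_length p))"

text \<open>The ball of radius \<open>r\<close> around \<open>x\<close> is isometric, via \<open>\<phi>\<close>, to \<open>n\<close> half-open segments
  \<open>[0,r)\<close> glued at their origins.\<close>

definition star_chart ::
    "'a::metric_space set \<Rightarrow> 'a \<Rightarrow> nat \<Rightarrow> real \<Rightarrow> (nat \<Rightarrow> real \<Rightarrow> 'a) \<Rightarrow> bool" where
  "star_chart \<Gamma> x n r \<phi> \<longleftrightarrow>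
     0 < r \<and>
     (\<forall>i<n. \<phi> i 0 = x) \<and>
     (\<forall>i<n. \<forall>j<n. \<forall>s\<in>{0..<r}. \<forall>t\<in>{0..<r}.
        dist (\<phi> i s) (\<phi> j t) = (if i = j then \<bar>s - t\<bar> else s + t)) \<and>
     \<Gamma> \<inter> ball x r = {x} \<union> (\<Union>i<n. \<phi> i ` {0..<r})"

definition metric_graph :: "'a::metric_space set \<Rightarrow> bool" where
  "metric_graph \<Gamma> \<longleftrightarrow>
     compact \<Gamma> \<and> length_space \<Gamma> \<and> (\<forall>x\<in>\<Gamma>. \<exists>n r \<phi>. star_chart \<Gamma> x n r \<phi>)"

definition val :: "'a::metric_space set \<Rightarrow> 'a \<Rightarrow> nat" where
  "val \<Gamma> x = (THE n. \<exists>r \<phi>. star_chart \<Gamma> x n r \<phi>)"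

abbreviation edges :: "'a::metric_space set \<Rightarrow> 'a set \<Rightarrow> 'a set set" where
  "edges \<Gamma> V \<equiv> components (\<Gamma> - V)"

text \<open>An oriented arc-length parametrization of the open edge \<open>e\<close> by \<open>(0,L)\<close>, extended
  continuously to \<open>[0,L]\<close>. Distances are preserved only locally, since \<open>\<Gamma>\<close> may contain
  a shortcut between two points of \<open>e\<close>.\<close>

definition edge_param ::
    "'a::metric_space set \<Rightarrow> 'a set \<Rightarrow> real \<Rightarrow> (real \<Rightarrow> 'a) \<Rightarrow> bool" where
  "edge_param V e L c \<longleftrightarrow>
     0 < L \<and> continuous_on {0..L} c \<and> c 0 \<in> V \<and> c L \<in> V \<and>
     (\<exists>h. homeomorphism {0<..<L} e c h) \<and>
     (\<forall>t\<in>{0<..<L}. \<exists>\<delta>>0. \<forall>s\<in>{0<..<L}. \<forall>s'\<in>{0<..<L}.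
        \<bar>s - t\<bar> < \<delta> \<longrightarrow> \<bar>s' - t\<bar> < \<delta> \<longrightarrow> dist (c s) (c s') = \<bar>s - s'\<bar>)"

text \<open>A model with vertex set \<open>V\<close>; \<open>l e\<close> is the length of the edge \<open>e\<close>, and \<open>\<gamma> e\<close> orients \<open>e\<close>
  and identifies it with \<open>[0, l e]\<close>.\<close>

definition model ::
    "'a::metric_space set \<Rightarrow> 'a set \<Rightarrow> ('a set \<Rightarrow> real) \<Rightarrow> ('a set \<Rightarrow> real \<Rightarrow> 'a) \<Rightarrow> bool" where
  "model \<Gamma> V l \<gamma> \<longleftrightarrow>
     finite V \<and> V \<subseteq> \<Gamma> \<and> (\<forall>e\<in>edges \<Gamma> V. edge_param V e (l e) (\<gamma> e))"

definition loopless ::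
    "'a::metric_space set \<Rightarrow> 'a set \<Rightarrow> ('a set \<Rightarrow> real) \<Rightarrow> ('a set \<Rightarrow> real \<Rightarrow> 'a) \<Rightarrow> bool" where
  "loopless \<Gamma> V l \<gamma> \<longleftrightarrow> (\<forall>e\<in>edges \<Gamma> V. \<gamma> e 0 \<noteq> \<gamma> e (l e))"

text \<open>The first homology of the one-dimensional cell complex given by the model, with real
  coefficients: the kernel of the boundary map from edge chains to vertex chains.\<close>

definition cycle_space ::
    "'a::metric_space set \<Rightarrow> 'a set \<Rightarrow> ('a set \<Rightarrow> real) \<Rightarrow> ('a set \<Rightarrow> real \<Rightarrow> 'a)
      \<Rightarrow> ('a set \<Rightarrow> real) set" where
  "cycle_space \<Gamma> V l \<gamma> =
     {c. (\<forall>e. e \<notin> edges \<Gamma> V \<longrightarrow> c e = 0) \<and>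
         (\<forall>v\<in>V. (\<Sum>e\<in>edges \<Gamma> V. c e * (of_bool (\<gamma> e (l e) = v) - of_bool (\<gamma> e 0 = v))) = 0)}"

definition genus ::
    "'a::metric_space set \<Rightarrow> 'a set \<Rightarrow> ('a set \<Rightarrow> real) \<Rightarrow> ('a set \<Rightarrow> real \<Rightarrow> 'a) \<Rightarrow> nat" where
  "genus \<Gamma> V l \<gamma> = fun_space.dim (cycle_space \<Gamma> V l \<gamma>)"

definition supp :: "('a \<Rightarrow> int) \<Rightarrow> 'a set" where
  "supp D = {x. D x \<noteq> 0}"

definition divisor :: "'a set \<Rightarrow> ('a \<Rightarrow> int) \<Rightarrow> bool" where
  "divisor \<Gamma> D \<longleftrightarrow> finite (supp D) \<and> supp D \<subseteq> \<Gamma>"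

definition effective :: "('a \<Rightarrow> int) \<Rightarrow> bool" where
  "effective D \<longleftrightarrow> (\<forall>x. 0 \<le> D x)"

definition canonical :: "'a::metric_space set \<Rightarrow> 'a \<Rightarrow> int" where
  "canonical \<Gamma> = (\<lambda>x. if x \<in> \<Gamma> then int (val \<Gamma> x) - 2 else 0)"

definition outgoing_slopes ::
    "'a::metric_space set \<Rightarrow> ('a \<Rightarrow> real) \<Rightarrow> 'a \<Rightarrow> nat \<Rightarrow> (nat \<Rightarrow> int) \<Rightarrow> bool" where
  "outgoing_slopes \<Gamma> f x n m \<longleftrightarrow>
     (\<exists>r \<phi>. star_chart \<Gamma> x n r \<phi> \<and>
        (\<forall>i<n. \<forall>t\<in>{0..<r}. f (\<phi> i t) = f x + of_int (m i) * t))"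

text \<open>Since \<open>\<Gamma>\<close> is compact, being affine along the arms of a star around each point amounts
  to being piecewise linear with finitely many pieces.\<close>

definition rational_function :: "'a::metric_space set \<Rightarrow> ('a \<Rightarrow> real) \<Rightarrow> bool" where
  "rational_function \<Gamma> f \<longleftrightarrow>
     continuous_on \<Gamma> f \<and> (\<forall>x\<in>\<Gamma>. \<exists>n m. outgoing_slopes \<Gamma> f x n m)"

definition ord_at :: "'a::metric_space set \<Rightarrow> ('a \<Rightarrow> real) \<Rightarrow> 'a \<Rightarrow> int" where
  "ord_at \<Gamma> f x = (THE k. \<exists>n m. outgoing_slopes \<Gamma> f x n m \<and> k = (\<Sum>i<n. m i))"

definition div_of :: "'a::metric_space set \<Rightarrow> ('a \<Rightarrow> real) \<Rightarrow> 'a \<Rightarrow> int" where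
  "div_of \<Gamma> f = (\<lambda>x. if x \<in> \<Gamma> then ord_at \<Gamma> f x else 0)"

definition lin_equiv :: "'a::metric_space set \<Rightarrow> ('a \<Rightarrow> int) \<Rightarrow> ('a \<Rightarrow> int) \<Rightarrow> bool" where
  "lin_equiv \<Gamma> D D' \<longleftrightarrow> (\<exists>f. rational_function \<Gamma> f \<and> D - D' = div_of \<Gamma> f)"

definition lin_system :: "'a::metric_space set \<Rightarrow> ('a \<Rightarrow> int) \<Rightarrow> ('a \<Rightarrow> int) set" where
  "lin_system \<Gamma> D\<^sub>0 = {D. divisor \<Gamma> D \<and> effective D \<and> lin_equiv \<Gamma> D D\<^sub>0}"

text \<open>Vertices and edges outside the model are irrelevant for the cell data
  \<open>m\<^sub>V\<close>, \<open>m\<^sub>E\<close>, \<open>s\<close>.\<close>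

definition cell_data :: "'a::metric_space set \<Rightarrow> 'a set \<Rightarrow> ('a set \<Rightarrow> nat list) \<Rightarrow> bool" where
  "cell_data \<Gamma> V m\<^sub>E \<longleftrightarrow> (\<forall>e\<in>edges \<Gamma> V. \<forall>k\<in>set (m\<^sub>E e). 0 < k)"

text \<open>\<open>x (e, i)\<close> is the position in \<open>(0, l e)\<close> of the \<open>i\<close>-th chip (counted from \<open>0\<close>) of \<open>D\<close>
  on \<open>e\<close>; all unused coordinates are \<open>0\<close>.\<close>

definition chip_positions ::
    "'a::metric_space set \<Rightarrow> 'a set \<Rightarrow> ('a set \<Rightarrow> real) \<Rightarrow> ('a set \<Rightarrow> real \<Rightarrow> 'a)
      \<Rightarrow> ('a set \<Rightarrow> nat list) \<Rightarrow> ('a \<Rightarrow> int) \<Rightarrow> ('a set \<times> nat \<Rightarrow> real) \<Rightarrow> bool" where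
  "chip_positions \<Gamma> V l \<gamma> m\<^sub>E D x \<longleftrightarrow>
     (\<forall>e i. e \<notin> edges \<Gamma> V \<or> length (m\<^sub>E e) \<le> i \<longrightarrow> x (e, i) = 0) \<and>
     (\<forall>e\<in>edges \<Gamma> V.
        (\<forall>i<length (m\<^sub>E e). 0 < x (e, i) \<and> x (e, i) < l e) \<and>
        (\<forall>i j. i < j \<longrightarrow> j < length (m\<^sub>E e) \<longrightarrow> x (e, i) < x (e, j)) \<and>
        (\<forall>t\<in>{0<..<l e}.
           D (\<gamma> e t) = (\<Sum>i<length (m\<^sub>E e). if x (e, i) = t then int (m\<^sub>E e ! i) else 0)))"

definition open_cell ::
    "'a::metric_space set \<Rightarrow> 'a set \<Rightarrow> ('a set \<Rightarrow> real) \<Rightarrow> ('a set \<Rightarrow> real \<Rightarrow> 'a) \<Rightarrow> ('a \<Rightarrow> int)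
      \<Rightarrow> ('a \<Rightarrow> nat) \<Rightarrow> ('a set \<Rightarrow> nat list) \<Rightarrow> ('a set \<Rightarrow> int) \<Rightarrow> ('a \<Rightarrow> int) set" where
  "open_cell \<Gamma> V l \<gamma> D\<^sub>0 m\<^sub>V m\<^sub>E s =
     {D \<in> lin_system \<Gamma> D\<^sub>0. \<exists>f. rational_function \<Gamma> f \<and> D = D\<^sub>0 + div_of \<Gamma> f \<and>
        (\<forall>v\<in>V. D v = int (m\<^sub>V v)) \<and>
        (\<exists>x. chip_positions \<Gamma> V l \<gamma> m\<^sub>E D x) \<and>
        (\<forall>e\<in>edges \<Gamma> V. \<exists>\<delta>>0. \<forall>t\<in>{0..<\<delta>}. f (\<gamma> e t) = f (\<gamma> e 0) + of_int (s e) * t)}"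

definition cell_dim ::
    "'a::metric_space set \<Rightarrow> 'a set \<Rightarrow> ('a set \<Rightarrow> real) \<Rightarrow> ('a set \<Rightarrow> real \<Rightarrow> 'a) \<Rightarrow> ('a \<Rightarrow> int)
      \<Rightarrow> ('a \<Rightarrow> nat) \<Rightarrow> ('a set \<Rightarrow> nat list) \<Rightarrow> ('a set \<Rightarrow> int) \<Rightarrow> nat" where
  "cell_dim \<Gamma> V l \<gamma> D\<^sub>0 m\<^sub>V m\<^sub>E s =
     affine_dim {x. \<exists>D\<in>open_cell \<Gamma> V l \<gamma> D\<^sub>0 m\<^sub>V m\<^sub>E s. chip_positions \<Gamma> V l \<gamma> m\<^sub>E D x}"

definition chip_sum :: "nat \<Rightarrow> (nat \<Rightarrow> 'a) \<Rightarrow> 'a \<Rightarrow> int" where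
  "chip_sum d p = (\<lambda>x. int (card {i. i < d \<and> p i = x}))"

text \<open>Closure in the linear system, whose topology is the one induced from the symmetric powers
  of \<open>\<Gamma>\<close>: effective divisors are close if their chips can be matched to be pointwise close.\<close>

definition cell_closure ::
    "'a::metric_space set \<Rightarrow> ('a \<Rightarrow> int) \<Rightarrow> ('a \<Rightarrow> int) set \<Rightarrow> ('a \<Rightarrow> int) set" where
  "cell_closure \<Gamma> D\<^sub>0 U =
     {D \<in> lin_system \<Gamma> D\<^sub>0. \<forall>\<epsilon>>0. \<exists>D'\<in>U. \<exists>d p q.
        D = chip_sum d p \<and> D' = chip_sum d q \<and>
        (\<forall>i<d. p i \<in> \<Gamma> \<and> q i \<in> \<Gamma> \<and> dist (p i) (q i) < \<epsilon>)}"

definition cells ::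
    "'a::metric_space set \<Rightarrow> 'a set \<Rightarrow> ('a set \<Rightarrow> real) \<Rightarrow> ('a set \<Rightarrow> real \<Rightarrow> 'a) \<Rightarrow> ('a \<Rightarrow> int)
      \<Rightarrow> ('a \<Rightarrow> int) set set" where
  "cells \<Gamma> V l \<gamma> D\<^sub>0 =
     {cell_closure \<Gamma> D\<^sub>0 (open_cell \<Gamma> V l \<gamma> D\<^sub>0 m\<^sub>V m\<^sub>E s) | m\<^sub>V m\<^sub>E s.
        cell_data \<Gamma> V m\<^sub>E \<and> open_cell \<Gamma> V l \<gamma> D\<^sub>0 m\<^sub>V m\<^sub>E s \<noteq> {}}"

definition maximal_cell ::
    "'a::metric_space set \<Rightarrow> 'a set \<Rightarrow> ('a set \<Rightarrow> real) \<Rightarrow> ('a set \<Rightarrow> real \<Rightarrow> 'a) \<Rightarrow> ('a \<Rightarrow> int)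
      \<Rightarrow> ('a \<Rightarrow> int) set \<Rightarrow> bool" where
  "maximal_cell \<Gamma> V l \<gamma> D\<^sub>0 \<sigma> \<longleftrightarrow>
     \<sigma> \<in> cells \<Gamma> V l \<gamma> D\<^sub>0 \<and> (\<forall>\<tau>\<in>cells \<Gamma> V l \<gamma> D\<^sub>0. \<sigma> \<subseteq> \<tau> \<longrightarrow> \<tau> = \<sigma>)"

end

theory Submission
  imports Defs
begin

text \<open>Let \<open>\<rho>\<close> be the distance to a simple cycle \<open>C\<close> of \<open>\<Gamma>\<close>. Then \<open>K + div (-\<rho>)\<close> is effective: it vanishes on \<open>C\<close>,
  and elsewhere its value is \<open>2 (c - 1)\<close>, where \<open>c\<close> is the number of directions in which \<open>\<rho>\<close> decreases. So all
  chips lie where two shortest paths meet. Perturbing \<open>\<rho>\<close> at the vertices where this happens, and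
  splitting the remaining double chips, yields \<open>D = K + div f\<close> with \<open>2g - 2\<close> distinct simple chips inside
  the edges. Since \<open>\<Gamma> - supp D\<close> has one component containing a cycle (namely \<open>C\<close>) and otherwise only
  trees, an Euler characteristic count gives \<open>g\<close> components, hence a cell of dimension \<open>g - 1\<close>.

  The cell is maximal because simple chips inside edges can neither split nor reach a vertex under a
  small move, and then the slopes, being integers, cannot change either.\<close>

section \<open>Graphs\<close>

text \<open>Why two units of weight per vertex: each direction at \<open>v\<close> adds 1 to the
  valence, so \<open>K + div f\<close> has at \<open>v\<close> the value "sum of (1 + slope) over
  all directions, minus 2". It vanishes exactly if the numbers 1 + slope add up to 2. The
  perturbation cannot follow the computation of the distances, because lowering one vertex changes
  the distances beyond it. It is therefore built into Dijkstra's algorithm, with a shift so small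
  that the strict bounds of later steps survive. The Euler characteristic count is carried out as
  linear algebra: the admissible displacements of the chips form a vector space, and coordinates for
  it are read off a spanning tree that contains all chipless edges but one. That last edge closes
  \<open>C\<close> and imposes no further condition. Positive genus is what provides
  \<open>C\<close>; for genus 0 the degree 2g - 2 is negative and |K| is empty.\<close>

lemma sum_fun_apply: "(\<Sum>j\<in>J. g j) x = (\<Sum>j\<in>J. g j x)"
  for g :: "'j \<Rightarrow> 'i \<Rightarrow> 'b::comm_monoid_add"
  by (induction J rule: infinite_finite_induct) auto

text \<open>The vectors of \<open>W\<close> that restrict to unit vectors on \<open>J\<close> form a
  basis. Both dimension counts, for the cycle space and for the chip displacements, go through this
  criterion.\<close>

lemma dim_eq_card_coordinates:
  fixes W :: "('i \<Rightarrow> real) set" and J :: "'i set"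
  assumes W: "fun_space.subspace W" and J: "finite J"
    and inj: "\<And>y. y \<in> W \<Longrightarrow> (\<And>j. j \<in> J \<Longrightarrow> y j = 0) \<Longrightarrow> y = 0"
    and surj: "\<And>a. \<exists>y\<in>W. \<forall>j\<in>J. y j = a j"
  shows "fun_space.dim W = card J"
proof -
  have "\<forall>k. \<exists>y\<in>W. \<forall>j\<in>J. y j = of_bool (j = k)"
    by (intro allI surj)
  then obtain b where bW: "\<And>k. b k \<in> W" and b: "\<And>k j. j \<in> J \<Longrightarrow> b k j = of_bool (j = k)"
    by metis
  have inj_b: "inj_on b J"
  proof (rule inj_onI)
    fix i j assume "i \<in> J" "j \<in> J" "b i = b j"
    then show "i = j" using b[of i i] b[of i j] by (auto split: if_splits)
  qed
  have indep: "fun_space.independent (b ` J)"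
  proof (rule fun_space.independent_if_scalars_zero)
    fix f x assume z: "(\<Sum>x\<in>b ` J. fscale (f x) x) = 0" and "x \<in> b ` J"
    then obtain k where k: "k \<in> J" "x = b k" by auto
    have "0 = (\<Sum>x\<in>b ` J. fscale (f x) x) k" by (simp add: z)
    also have "\<dots> = (\<Sum>j\<in>J. f (b j) * of_bool (k = j))"
      by (simp add: sum_fun_apply sum.reindex[OF inj_b] fscale_def b k)
    also have "\<dots> = f (b k)"
      using k J by (simp add: of_bool_def if_distrib cong: if_cong)
    finally show "f x = 0" by (simp add: k)
  qed (use J in auto)
  have "y \<in> fun_space.span (b ` J)" if y: "y \<in> W" for y
  proof -
    have "y - (\<Sum>j\<in>J. fscale (y j) (b j)) = 0"
    proof (rule inj)
      show "y - (\<Sum>j\<in>J. fscale (y j) (b j)) \<in> W"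
        by (intro fun_space.subspace_diff[OF W y] fun_space.subspace_sum[OF W]
            fun_space.subspace_scale[OF W] bW)
      fix k assume k: "k \<in> J"
      have "(\<Sum>j\<in>J. y j * b j k) = (\<Sum>j\<in>J. y j * of_bool (k = j))"
        by (simp add: b k)
      then show "(y - (\<Sum>j\<in>J. fscale (y j) (b j))) k = 0"
        using k J by (simp add: sum_fun_apply fscale_def of_bool_def if_distrib cong: if_cong)
    qed
    then have "y = (\<Sum>j\<in>J. fscale (y j) (b j))" by simp
    also have "\<dots> \<in> fun_space.span (b ` J)"
      by (intro fun_space.span_sum fun_space.span_scale fun_space.span_base) auto
    finally show ?thesis .
  qed
  moreover have "fun_space.span (b ` J) \<subseteq> W"
    using bW by (intro fun_space.span_minimal W) auto
  ultimately have "fun_space.span (b ` J) = fun_space.span W"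
    using W by (metis fun_space.span_eq_iff subsetI subset_antisym)
  from fun_space.dim_eq_card[OF this indep] show ?thesis
    by (simp add: card_image inj_b)
qed

section \<open>Spanning trees and the cycle space of a multigraph\<close>

locale multigraph =
  fixes E :: "'e set" and V :: "'v set" and src tgt :: "'e \<Rightarrow> 'v"
  assumes finite_E: "finite E" and finite_V: "finite V"
    and src_in: "e \<in> E \<Longrightarrow> src e \<in> V" and tgt_in: "e \<in> E \<Longrightarrow> tgt e \<in> V"
    and src_neq_tgt: "e \<in> E \<Longrightarrow> src e \<noteq> tgt e"
begin

definition boundary :: "('e \<Rightarrow> real) \<Rightarrow> 'v \<Rightarrow> real" where
  "boundary c v = (\<Sum>e\<in>E. c e * (of_bool (tgt e = v) - of_bool (src e = v)))"

definition cycles :: "('e \<Rightarrow> real) set" where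
  "cycles = {c. (\<forall>e. e \<notin> E \<longrightarrow> c e = 0) \<and> (\<forall>v\<in>V. boundary c v = 0)}"

text \<open>A rooted tree on \<open>S\<close>, encoded by the parent edge \<open>p v\<close> of each
  non-root vertex. Building it by attaching leaves makes acyclicity implicit and gives induction
  over leaves. The value \<open>p r\<close> is unconstrained and can later hold the edge that closes
  the cycle.\<close>

inductive spanned :: "'v \<Rightarrow> ('v \<Rightarrow> 'e) \<Rightarrow> 'v set \<Rightarrow> bool" for r p where
  root: "r \<in> V \<Longrightarrow> spanned r p {r}"
| attach: "spanned r p S \<Longrightarrow> u \<in> S \<Longrightarrow> v \<in> V - S \<Longrightarrow> p v \<in> E \<Longrightarrow> {src (p v), tgt (p v)} = {u, v}
    \<Longrightarrow> spanned r p (insert v S)"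

text \<open>Summation by parts: the boundary map is adjoint to taking differences of a potential
  along the edges.\<close>

lemma sum_boundary:
  "(\<Sum>v\<in>V. F v * boundary c v) = (\<Sum>e\<in>E. c e * (F (tgt e) - F (src e)))"
proof -
  have pick: "(\<Sum>v\<in>V. F v * of_bool (w = v)) = F w" if "w \<in> V" for w
    using that finite_V by (simp add: of_bool_def if_distrib cong: if_cong)
  have "(\<Sum>v\<in>V. F v * boundary c v)
      = (\<Sum>e\<in>E. \<Sum>v\<in>V. F v * (c e * (of_bool (tgt e = v) - of_bool (src e = v))))"
    unfolding boundary_def sum_distrib_left by (rule sum.swap)
  also have "\<dots> = (\<Sum>e\<in>E. c e * ((\<Sum>v\<in>V. F v * of_bool (tgt e = v))
      - (\<Sum>v\<in>V. F v * of_bool (src e = v))))"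
    by (intro sum.cong refl)
      (simp add: sum_distrib_left sum_subtractf[symmetric] algebra_simps)
  also have "\<dots> = (\<Sum>e\<in>E. c e * (F (tgt e) - F (src e)))"
    by (intro sum.cong refl) (simp add: pick src_in tgt_in)
  finally show ?thesis .
qed

lemma subspace_cycles: "fun_space.subspace cycles"
proof -
  have add: "boundary (c + d) v = boundary c v + boundary d v" for c d v
    by (simp add: boundary_def sum.distrib[symmetric] algebra_simps)
  have scale: "boundary (fscale k c) v = k * boundary c v" for k c v
    by (simp add: boundary_def fscale_def sum_distrib_left algebra_simps)
  show ?thesis
    by (auto simp: fun_space.subspace_def cycles_def add scale)
      (auto simp: fscale_def boundary_def)
qed

lemma spanned_subset: "spanned r p S \<Longrightarrow> S \<subseteq> V \<and> r \<in> S"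
  by (induction rule: spanned.induct) auto

lemma spanned_parent:
  "spanned r p S \<Longrightarrow> v \<in> S - {r} \<Longrightarrow>
    p v \<in> E \<and> v \<in> {src (p v), tgt (p v)} \<and> src (p v) \<in> S \<and> tgt (p v) \<in> S"
  by (induction rule: spanned.induct) (auto simp: doubleton_eq_iff)

lemma spanned_inj: "spanned r p S \<Longrightarrow> inj_on p (S - {r})"
proof (induction rule: spanned.induct)
  case (attach S u v)
  have "insert v S - {r} = insert v (S - {r})"
    using attach spanned_subset by auto
  moreover have "p w \<noteq> p v" if "w \<in> S - {r}" for w
    using spanned_parent[OF attach.hyps(1) that] attach.hyps by (metis DiffD2 doubleton_eq_iff)
  ultimately show ?case using attach.IH by (force simp: inj_on_insert)
qed auto

lemma spanned_cong:
  assumes "spanned r p S" "\<And>v. v \<in> S \<Longrightarrow> q v = p v"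
  shows "spanned r q S"
  using assms
proof (induction rule: spanned.induct)
  case (attach S u v)
  then show ?case using spanned.attach[of r q S u v] by simp
qed (rule spanned.root)

lemma potential_exists:
  "spanned r p S \<Longrightarrow> \<exists>F. \<forall>v\<in>S-{r}. F (tgt (p v)) - F (src (p v)) = (w (p v) :: real)"
proof (induction rule: spanned.induct)
  case (attach S u v)
  then obtain F where F: "\<forall>v\<in>S-{r}. F (tgt (p v)) - F (src (p v)) = w (p v)" by blast
  define G where "G = F(v := if tgt (p v) = v then F u + w (p v) else F u - w (p v))"
  have "G (tgt (p x)) - G (src (p x)) = w (p x)" if "x \<in> insert v S - {r}" for x
  proof (cases "x = v")
    case True
    then show ?thesis using attach.hyps by (auto simp: G_def doubleton_eq_iff)
  next
    case False
    with that have "x \<in> S - {r}" by auto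
    with spanned_parent[OF attach.hyps(1) this] F attach.hyps show ?thesis
      by (metis DiffD2 G_def fun_upd_other)
  qed
  then show ?case by blast
qed auto

lemma potential_unique:
  fixes F :: "'v \<Rightarrow> real"
  shows "spanned r p S \<Longrightarrow> (\<And>v. v \<in> S - {r} \<Longrightarrow> F (tgt (p v)) = F (src (p v))) \<Longrightarrow> v \<in> S \<Longrightarrow> F v = F r"
proof (induction arbitrary: v rule: spanned.induct)
  case (attach S u v')
  have "F w = F r" if "w \<in> S" for w
    using attach.IH[OF _ that] attach.prems(1) by blast
  moreover have "F (tgt (p v')) = F (src (p v'))" if "v' \<noteq> r"
    using attach.prems(1)[of v'] that by blast
  moreover have "v' \<noteq> r" using spanned_subset attach.hyps by blast
  ultimately show ?case using attach.hyps attach.prems(2) by (auto simp: doubleton_eq_iff)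
qed auto

text \<open>A leaf has to receive its whole demand through its parent edge. Moving that demand to
  the other end of the edge keeps the total at zero and leaves a smaller tree.\<close>

lemma tree_flow_exists:
  "spanned r p S \<Longrightarrow> (\<And>v. v \<notin> S \<Longrightarrow> b v = (0::real)) \<Longrightarrow> (\<Sum>v\<in>V. b v) = 0 \<Longrightarrow>
    \<exists>c. (\<forall>e. e \<notin> p ` (S - {r}) \<longrightarrow> c e = 0) \<and> (\<forall>v\<in>V. boundary c v = b v)"
proof (induction arbitrary: b rule: spanned.induct)
  case root
  have "(\<Sum>v\<in>V. b v) = (\<Sum>v\<in>{r}. b v)"
    using root finite_V by (intro sum.mono_neutral_right) auto
  with root have "b v = 0" for v by (cases "v = r") auto
  then show ?case by (intro exI[of _ "\<lambda>_. 0"]) (auto simp: boundary_def)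
next
  case (attach S u v)
  have uv: "u \<noteq> v" "u \<in> V" "v \<in> V" using attach.hyps spanned_subset by blast+
  define b' where "b' = b(v := 0, u := b u + b v)"
  have "(\<Sum>x\<in>V. b' x) = (\<Sum>x\<in>V. b x + b v * of_bool (u = x) - b v * of_bool (v = x))"
    using uv by (intro sum.cong) (auto simp: b'_def)
  also have "\<dots> = (\<Sum>x\<in>V. b x) + (b v - b v)"
    using uv finite_V by (simp add: sum.distrib sum_subtractf sum_distrib_left[symmetric])
  finally have "(\<Sum>x\<in>V. b' x) = 0" using attach.prems by simp
  moreover have "\<And>w. w \<notin> S \<Longrightarrow> b' w = 0" using attach by (auto simp: b'_def)
  ultimately obtain c where c: "\<And>e. e \<notin> p ` (S - {r}) \<Longrightarrow> c e = 0" "\<And>w. w \<in> V \<Longrightarrow> boundary c w = b' w"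
    using attach.IH[of b'] by blast
  define x where "x = (if tgt (p v) = v then b v else - b v)"
  have new: "c (p v) = 0"
  proof (rule c)
    show "p v \<notin> p ` (S - {r})"
    proof
      assume "p v \<in> p ` (S - {r})"
      then obtain w where "w \<in> S - {r}" "p v = p w" by auto
      with spanned_parent[OF attach.hyps(1) this(1)] attach.hyps show False
        by (metis DiffD2 doubleton_eq_iff)
    qed
  qed
  have "boundary (c(p v := x)) w = b w" if "w \<in> V" for w
  proof -
    have "boundary (c(p v := x)) w
        = (\<Sum>e\<in>E. c e * (of_bool (tgt e = w) - of_bool (src e = w))
            + x * (of_bool (tgt (p v) = w) - of_bool (src (p v) = w)) * of_bool (p v = e))"
      unfolding boundary_def using new by (intro sum.cong) auto
    also have "\<dots> = boundary c w + x * (of_bool (tgt (p v) = w) - of_bool (src (p v) = w))"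
      using attach.hyps finite_E by (simp add: sum.distrib boundary_def sum_distrib_left[symmetric])
    also have "\<dots> = b w"
      using c(2)[OF that] attach.hyps uv by (auto simp: b'_def x_def doubleton_eq_iff)
    finally show ?thesis .
  qed
  moreover have "insert v S - {r} = insert v (S - {r})"
    using attach spanned_subset by auto
  moreover have "(c(p v := x)) e = 0" if "e \<notin> p ` insert v (S - {r})" for e
    using that c(1)[of e] by auto
  ultimately show ?case by metis
qed

text \<open>The edges outside the tree are coordinates of the cycle space: values there can be
  prescribed, and the tree then balances the boundary in exactly one way.\<close>

lemma dim_cycles:
  assumes sp: "spanned r p V"
  shows "fun_space.dim cycles + card V = card E + 1"
proof -
  define T where "T = p ` (V - {r})"
  have r: "r \<in> V" and T: "T \<subseteq> E" using spanned_subset[OF sp] spanned_parent[OF sp] by (auto simp: T_def)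
  have "fun_space.dim cycles = card (E - T)"
  proof (rule dim_eq_card_coordinates[OF subspace_cycles])
    fix c assume c: "c \<in> cycles" and z: "\<And>e. e \<in> E - T \<Longrightarrow> c e = 0"
    obtain F where F: "\<forall>v\<in>V-{r}. F (tgt (p v)) - F (src (p v)) = c (p v)"
      using potential_exists[OF sp] by blast
    \<comment> \<open>A cycle is orthogonal to all differences of potentials. The differences of
      \<open>F\<close> agree with \<open>c\<close> on the tree, and \<open>c\<close> vanishes
      elsewhere, so the pairing is the sum of the squares of \<open>c\<close>.\<close>
    have "(\<Sum>e\<in>E. c e * (F (tgt e) - F (src e))) = 0"
      unfolding sum_boundary[symmetric] using c by (simp add: cycles_def)
    also have "(\<Sum>e\<in>E. c e * (F (tgt e) - F (src e))) = (\<Sum>e\<in>E. c e * c e)"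
      using z F by (intro sum.cong) (auto simp: T_def)
    finally have "\<forall>e\<in>E. c e * c e = 0"
      using finite_E by (subst (asm) sum_nonneg_eq_0_iff) auto
    then show "c = 0" using c by (auto simp: cycles_def fun_eq_iff)
  next
    fix a :: "'e \<Rightarrow> real"
    define a' where "a' e = (if e \<in> E - T then a e else 0)" for e
    \<comment> \<open>The boundary left over by the prescribed values has total zero, hence a flow
      inside the tree cancels it.\<close>
    define b where "b v = (if v \<in> V then - boundary a' v else 0)" for v
    have "(\<Sum>v\<in>V. b v) = - (\<Sum>v\<in>V. 1 * boundary a' v)"
      by (simp add: b_def sum_negf)
    then have "(\<Sum>v\<in>V. b v) = 0" by (subst (asm) sum_boundary) simp
    then obtain c where c: "\<forall>e. e \<notin> T \<longrightarrow> c e = 0" "\<forall>v\<in>V. boundary c v = b v"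
      using tree_flow_exists[OF sp, of b] by (auto simp: b_def T_def)
    have "boundary (a' + c) v = boundary a' v + boundary c v" for v
      by (simp add: boundary_def sum.distrib[symmetric] algebra_simps)
    then have "a' + c \<in> cycles" using c T by (auto simp: cycles_def a'_def b_def)
    moreover have "\<forall>j\<in>E - T. (a' + c) j = a j" using c by (auto simp: a'_def)
    ultimately show "\<exists>y\<in>cycles. \<forall>j\<in>E - T. y j = a j" by blast
  qed (use finite_E in auto)
  moreover have "card T = card V - 1"
    using spanned_inj[OF sp] r finite_V by (simp add: T_def card_image)
  moreover have "card (E - T) = card E - card T" "card T \<le> card E"
    using T finite_E by (auto intro: card_mono card_Diff_subset finite_subset)
  moreover have "card V > 0" using r finite_V by (auto simp: card_gt_0_iff)
  ultimately show ?thesis by simp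
qed

end

section \<open>A simple cycle and the shortest-path layout grown from it\<close>

context multigraph
begin

text \<open>In the support of a nonzero cycle every vertex reached lies on a second edge, so a walk
  never has to turn back along the edge just used. By finiteness it revisits a vertex, and the first
  return cuts out a simple cycle, of length 2 in the case of parallel edges.\<close>

lemma cycle_exists:
  assumes c: "c \<in> cycles" and nz: "c \<noteq> 0"
  shows "\<exists>n v e. 2 \<le> n \<and> (\<forall>k<n. e k \<in> E \<and> {src (e k), tgt (e k)} = {v k, v (Suc k)})
    \<and> inj_on v {..<n} \<and> inj_on e {..<n} \<and> v n = v 0"
proof -
  define E0 where "E0 = {e \<in> E. c e \<noteq> 0}"
  \<comment> \<open>A state is an edge of the support together with the end at which the walk leaves
    it; \<open>Q\<close> forbids using the same edge twice in a row.\<close>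
  define P where "P x \<longleftrightarrow> fst x \<in> E0 \<and> snd x \<in> {src (fst x), tgt (fst x)}" for x :: "'e \<times> 'v"
  define Q where "Q x y \<longleftrightarrow> fst y \<noteq> fst x \<and> {src (fst y), tgt (fst y)} = {snd x, snd y}"
    for x y :: "'e \<times> 'v"
  obtain e0 where "c e0 \<noteq> 0" using nz by (auto simp: fun_eq_iff)
  then have "P (e0, src e0)" using c by (auto simp: P_def E0_def cycles_def)
  moreover have "\<exists>y. P y \<and> Q x y" if "P x" for x
  proof -
    obtain e w where x: "x = (e, w)" by (cases x)
    have e: "e \<in> E" "c e \<noteq> 0" "w \<in> {src e, tgt e}" using that by (auto simp: P_def E0_def x)
    then have w: "w \<in> V" using src_in tgt_in by auto
    \<comment> \<open>If \<open>e\<close> were the only support edge at \<open>w\<close>, the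
      boundary there would be \<open>c e\<close> up to sign, because \<open>e\<close> is not a
      loop.\<close>
    obtain e' where e': "e' \<in> E0" "e' \<noteq> e" "w \<in> {src e', tgt e'}"
    proof (rule ccontr)
      assume *: "\<not> thesis"
      have "c e' * (of_bool (tgt e' = w) - of_bool (src e' = w)) = 0" if "e' \<in> E - {e}" for e'
        using * that \<open>\<And>e'. \<lbrakk>e' \<in> E0; e' \<noteq> e; w \<in> {src e', tgt e'}\<rbrakk> \<Longrightarrow> thesis\<close>
        by (cases "c e' = 0") (auto simp: E0_def)
      then have "boundary c w = (\<Sum>e'\<in>{e}. c e' * (of_bool (tgt e' = w) - of_bool (src e' = w)))"
        unfolding boundary_def using e finite_E by (intro sum.mono_neutral_right) auto
      moreover have "boundary c w = 0" using c w by (auto simp: cycles_def)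
      ultimately show False using e src_neq_tgt[of e] by auto
    qed
    define w' where "w' = (if src e' = w then tgt e' else src e')"
    have "P (e', w') \<and> Q x (e', w')" using e' by (auto simp: P_def Q_def w'_def x)
    then show ?thesis by blast
  qed
  ultimately obtain st where st: "\<And>k. P (st k)" "\<And>k. Q (st k) (st (Suc k))"
    using dependent_nat_choice[of "\<lambda>_. P" "\<lambda>_. Q"] by metis
  define v where "v k = snd (st k)" for k
  define e where "e k = fst (st (Suc k))" for k
  have e: "e k \<in> E" "{src (e k), tgt (e k)} = {v k, v (Suc k)}" "e (Suc k) \<noteq> e k" for k
    using st(1)[of "Suc k"] st(2)[of k] st(2)[of "Suc k"] by (auto simp: e_def v_def P_def Q_def E0_def)
  have vV: "v k \<in> V" for k
  proof -
    have "v k \<in> {src (e k), tgt (e k)}" by (simp add: e(2))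
    then show ?thesis using src_in[OF e(1)] tgt_in[OF e(1)] by auto
  qed
  have "\<not> inj v" using vV finite_V by (metis finite_imageD finite_subset image_subsetI infinite_UNIV_nat)
  then have ex: "\<exists>j. \<exists>i<j. v i = v j"
    unfolding inj_def by (metis linorder_neqE_nat)
  \<comment> \<open>Taking the earliest repetition makes all vertices before it distinct.\<close>
  define j where "j = (LEAST j. \<exists>i<j. v i = v j)"
  obtain i where i: "i < j" "v i = v j" using LeastI_ex[OF ex] by (auto simp: j_def)
  have "v a \<noteq> v b" if "a < b" "b < j" for a b
    using not_less_Least[of b "\<lambda>j. \<exists>i<j. v i = v j"] that unfolding j_def by blast
  then have inj: "inj_on v {..<j}"
    by (intro linorder_inj_onI) auto
  define n where "n = j - i"
  have ne: "v k \<noteq> v (Suc k)" for k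
    using e(2)[of k] src_neq_tgt[OF e(1)[of k]] by (metis doubleton_eq_iff)
  have n2: "2 \<le> n"
  proof (rule ccontr)
    assume "\<not> 2 \<le> n"
    then have "j = Suc i" using i by (simp add: n_def)
    then show False using ne i by metis
  qed
  have injv: "inj_on (\<lambda>k. v (i + k)) {..<n}"
  proof (rule inj_onI)
    fix x y assume "x \<in> {..<n}" "y \<in> {..<n}" "v (i + x) = v (i + y)"
    then show "x = y" using inj_onD[OF inj, of "i + x" "i + y"] by (simp add: n_def)
  qed
  \<comment> \<open>An edge used twice would be traversed in both directions, since the starting
    vertices differ. Distinctness of the vertices then makes the two uses consecutive, which the
    walk excludes.\<close>
  have lt: "e (i + k) \<noteq> e (i + m)" if "k < m" "m < n" for k m
  proof
    assume eq: "e (i + k) = e (i + m)"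
    then have "{v (i + k), v (Suc (i + k))} = {v (i + m), v (Suc (i + m))}"
      using e(2) by metis
    moreover have "v (i + k) \<noteq> v (i + m)"
      using injv that by (metis inj_on_eq_iff lessThan_iff nat_neq_iff order_less_trans)
    ultimately have "v (i + Suc k) = v (i + m)" by (auto simp: doubleton_eq_iff)
    then have "Suc k = m" using inj_onD[OF injv, of "Suc k" m] that by auto
    then show False using eq e(3)[of "i + k"] by auto
  qed
  have inje: "inj_on (\<lambda>k. e (i + k)) {..<n}"
    using lt by (intro linorder_inj_onI) auto
  show ?thesis
    using n2 e(1,2) injv inje i
    by (intro exI[of _ n] exI[of _ "\<lambda>k. v (i + k)"] exI[of _ "\<lambda>k. e (i + k)"]) (simp add: n_def)
qed

definition joins :: "'e \<Rightarrow> 'v \<Rightarrow> 'v \<Rightarrow> bool" where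
  "joins e u w \<longleftrightarrow> e \<in> E \<and> {src e, tgt e} = {u, w}"

lemma joins_cases:
  assumes "joins e u w"
  obtains "e \<in> E" "src e = u" "tgt e = w" "u \<noteq> w" | "e \<in> E" "src e = w" "tgt e = u" "u \<noteq> w"
  using assms src_neq_tgt[of e] by (auto simp: joins_def doubleton_eq_iff)

text \<open>Every vertex \<open>v\<close> distributes two units of weight on the incident edges \<open>p v\<close> and \<open>q v\<close>, which may
  coincide. The function \<open>f = -\<rho>\<close> will leave \<open>v\<close> along \<open>e\<close> with slope \<open>weight p q e v - 1\<close>, so that
  \<open>K + div f\<close> vanishes at \<open>v\<close>.\<close>

definition weight :: "('v \<Rightarrow> 'e) \<Rightarrow> ('v \<Rightarrow> 'e) \<Rightarrow> 'e \<Rightarrow> 'v \<Rightarrow> int" where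
  "weight p q e v = of_bool (p v = e) + of_bool (q v = e)"

end

locale weighted_multigraph = multigraph E V src tgt
  for E :: "'e set" and V :: "'v set" and src tgt :: "'e \<Rightarrow> 'v" +
  fixes l :: "'e \<Rightarrow> real"
  assumes l_pos: "e \<in> E \<Longrightarrow> 0 < l e"
begin

text \<open>With \<open>a\<close> and \<open>b\<close> the weights of \<open>e\<close> at its ends, \<open>\<rho>\<close> changes slope along \<open>e\<close> at \<open>2 - a - b\<close> chips,
  from \<open>1 - a\<close> to \<open>-(1 - b)\<close>. The condition says that such chips at distinct inner points of \<open>e\<close>
  can realize the difference of \<open>\<rho>\<close> between the ends.\<close>

definition admissible :: "('v \<Rightarrow> 'e) \<Rightarrow> ('v \<Rightarrow> 'e) \<Rightarrow> ('v \<Rightarrow> real) \<Rightarrow> 'e \<Rightarrow> 'v \<Rightarrow> 'v \<Rightarrow> bool" where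
  "admissible p q \<rho> e u w \<longleftrightarrow>
    (weight p q e u + weight p q e w = 2 \<and> \<rho> w - \<rho> u = (1 - real_of_int (weight p q e u)) * l e) \<or>
    (weight p q e u + weight p q e w \<le> 1 \<and>
      - (1 - real_of_int (weight p q e w)) * l e < \<rho> w - \<rho> u \<and>
      \<rho> w - \<rho> u < (1 - real_of_int (weight p q e u)) * l e)"

lemma admissible_sym: "admissible p q \<rho> e u w \<Longrightarrow> admissible p q \<rho> e w u"
proof -
  assume a: "admissible p q \<rho> e u w"
  have "1 - real_of_int (weight p q e w) = - (1 - real_of_int (weight p q e u))"
    if "weight p q e u + weight p q e w = 2"
    using that by linarith
  with a show ?thesis unfolding admissible_def
    by (smt (verit, best) minus_mult_minus mult_minus_left)
qed

text \<open>The edges \<open>p v\<close> with \<open>v \<noteq> r\<close> form a spanning tree of \<open>S\<close>; \<open>p r\<close> closes the unique cycle without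
  chips. The fifth condition is the invariant of Dijkstra's algorithm, and the last one expresses that
  the ends of \<open>p r\<close> are connected by tree edges without chips.\<close>

definition layout :: "'v \<Rightarrow> ('v \<Rightarrow> 'e) \<Rightarrow> ('v \<Rightarrow> 'e) \<Rightarrow> ('v \<Rightarrow> real) \<Rightarrow> 'v set \<Rightarrow> bool" where
  "layout r p q \<rho> S \<longleftrightarrow>
    spanned r p S \<and> inj_on p S \<and>
    (\<forall>v\<in>S. (\<exists>u\<in>S. joins (p v) u v) \<and> (\<exists>u\<in>S. joins (q v) u v)) \<and>
    (\<forall>e. \<forall>u\<in>S. \<forall>w\<in>S. joins e u w \<longrightarrow>
      admissible p q \<rho> e u w \<and> (weight p q e u + weight p q e w = 2 \<longrightarrow> e \<in> p ` S)) \<and>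
    (\<forall>e. \<forall>u\<in>S. \<forall>w. w \<notin> S \<longrightarrow> joins e u w \<longrightarrow>
      weight p q e u = 0 \<and> (\<forall>u'\<in>S. \<rho> u' \<le> \<rho> u + l e)) \<and>
    weight p q (p r) (src (p r)) + weight p q (p r) (tgt (p r)) = 2 \<and>
    (\<forall>F::'v \<Rightarrow> real.
      (\<forall>v\<in>S-{r}. weight p q (p v) (src (p v)) + weight p q (p v) (tgt (p v)) = 2 \<longrightarrow>
        F (src (p v)) = F (tgt (p v))) \<longrightarrow>
      F (src (p r)) = F (tgt (p r)))"

text \<open>The start of the algorithm: \<open>\<rho>\<close> is 0 on the cycle, and every cycle
  vertex spends one unit on each of its two cycle edges. A cycle edge thus receives weight 1 from
  both ends and carries no chip, while a chord receives no weight and carries two.\<close>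

lemma layout_cycle:
  assumes n: "2 \<le> n" and e: "\<And>k. k < n \<Longrightarrow> joins (e k) (v k) (v (Suc k))"
    and injv: "inj_on v {..<n}" and inje: "inj_on e {..<n}" and vn: "v n = v 0"
  shows "\<exists>r p q \<rho> S. layout r p q \<rho> S"
proof -
  define ix where "ix = inv_into {..<n} v"
  have ix: "ix (v k) = k" if "k < n" for k
    using that injv by (simp add: ix_def)
  \<comment> \<open>The root \<open>v 0\<close> is given the closing edge \<open>e (n - 1)\<close>,
    which is not a tree edge; all other vertices get the edge from their predecessor.\<close>
  define p where "p x = (if ix x = 0 then e (n - 1) else e (ix x - 1))" for x
  define q where "q x = e (ix x)" for x
  define S where "S = v ` {..<n}"
  have p0: "p (v 0) = e (n - 1)" and pS: "\<And>k. Suc k < n \<Longrightarrow> p (v (Suc k)) = e k"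
    and q: "\<And>k. k < n \<Longrightarrow> q (v k) = e k"
    using n by (auto simp: p_def q_def ix)
  have pE: "p (v k) = e (if k = 0 then n - 1 else k - 1)" if "k < n" for k
    using that by (auto simp: p_def ix)
  have vV: "v k \<in> V" if "k < n" for k
    using e[OF that] src_in tgt_in by (metis joins_cases)
  have e_eq: "e i = e j \<longleftrightarrow> i = j" if "i < n" "j < n" for i j
    using inje that by (auto simp: inj_on_def)
  have v_eq: "v i = v j \<longleftrightarrow> i = j" if "i < n" "j < n" for i j
    using injv that by (auto simp: inj_on_def)
  have last: "joins (e (n - 1)) (v (n - 1)) (v 0)"
    using e[of "n - 1"] n vn by simp
  have prev: "joins (p (v k)) (v (if k = 0 then n - 1 else k - 1)) (v k)" if "k < n" for k
    using that last e[of "k - 1"] by (auto simp: pE)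
  have spanned: "spanned (v 0) p (v ` {..k})" if "k < n" for k
    using that
  proof (induction k)
    case 0
    then show ?case using spanned.root[OF vV[of 0], of p] by simp
  next
    case (Suc k)
    have "v (Suc k) \<notin> v ` {..k}" using Suc.prems by (auto simp: v_eq)
    then have "spanned (v 0) p (insert (v (Suc k)) (v ` {..k}))"
      using Suc e[of k] vV by (intro spanned.attach[where u = "v k"]) (auto simp: pS joins_def)
    then show ?case by (simp add: atMost_Suc)
  qed
  have "{..<n} = {..n - 1}" using n by auto
  then have S': "S = v ` {..n - 1}" by (simp add: S_def)
  have inc: "weight p q (e k) (v k) = 1" "weight p q (e k) (v (Suc k)) = 1" if k: "k < n" for k
  proof -
    have "p (v k) \<noteq> e k" using k n by (cases k) (simp_all add: pE e_eq)
    then show "weight p q (e k) (v k) = 1" using k by (simp add: weight_def q)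
    have "p (v (Suc k)) = e k \<and> q (v (Suc k)) \<noteq> e k"
    proof (cases "Suc k = n")
      case True
      then show ?thesis using n p0 q[of 0] vn e_eq[of 0 k] k by auto
    next
      case False
      then show ?thesis using k pS[of k] q[of "Suc k"] e_eq[of "Suc k" k] by auto
    qed
    then show "weight p q (e k) (v (Suc k)) = 1" by (simp add: weight_def)
  qed
  have wt0: "weight p q e' x = 0" if "x \<in> S" "e' \<notin> e ` {..<n}" for e' x
    using that n by (auto simp: weight_def S_def q pE split: if_splits)
  have wt1: "weight p q (e k) x = 1" if "k < n" "joins (e k) u w" "x \<in> {u, w}" for k u w x
  proof -
    have "x \<in> {v k, v (Suc k)}" using that e[OF that(1)] by (auto simp: joins_def)
    then show ?thesis using inc[OF that(1)] by auto
  qed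
  have "layout (v 0) p q (\<lambda>_. 0) S"
    unfolding layout_def
  proof (intro conjI ballI allI impI)
    show "spanned (v 0) p S" using spanned[of "n - 1"] n by (simp add: S')
    show "inj_on p S"
    proof (rule inj_onI)
      fix x y assume "x \<in> S" "y \<in> S" and eq: "p x = p y"
      then obtain i j where ij: "i < n" "j < n" "x = v i" "y = v j" by (auto simp: S_def)
      then have "(if i = 0 then n - 1 else i - 1) = (if j = 0 then n - 1 else j - 1)"
        using eq n by (subst e_eq[symmetric]) (auto simp: pE)
      then have "i = j" using ij by (auto split: if_splits)
      then show "x = y" using ij by simp
    qed
  next
    fix x assume "x \<in> S"
    then obtain k where k: "k < n" "x = v k" by (auto simp: S_def)
    show "\<exists>u\<in>S. joins (p x) u x"
      using prev[OF k(1)] k n by (intro bexI[of _ "v (if k = 0 then n - 1 else k - 1)"]) (auto simp: S_def)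
    have "v (Suc k) \<in> S" using k n vn by (cases "Suc k = n") (auto simp: S_def)
    moreover have "joins (q x) (v (Suc k)) x"
      using e[OF k(1)] q[OF k(1)] k(2) by (simp add: joins_def insert_commute)
    ultimately show "\<exists>u\<in>S. joins (q x) u x" by blast
  next
    fix e' u w assume uw: "u \<in> S" "w \<in> S" "joins e' u w"
    then have "e' \<in> E" by (simp add: joins_def)
    show "admissible p q (\<lambda>_. 0) e' u w"
      using uw wt0[of u e'] wt0[of w e'] wt1[of _ u w] l_pos[OF \<open>e' \<in> E\<close>]
      by (cases "e' \<in> e ` {..<n}") (auto simp: admissible_def)
    assume "weight p q e' u + weight p q e' w = 2"
    then have "e' \<in> e ` {..<n}" using uw wt0[of u e'] wt0[of w e'] by (intro ccontr[of "e' \<in> e ` {..<n}"]) simp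
    then obtain k where k: "k < n" "e' = e k" by auto
    show "e' \<in> p ` S"
    proof (cases "Suc k = n")
      case True
      then have "e' = p (v 0)" using k p0 by auto
      then show ?thesis using n by (auto simp: S_def)
    next
      case False
      then have "e' = p (v (Suc k))" using k pS by auto
      then show ?thesis using k False by (auto simp: S_def)
    qed
  next
    fix e' u w assume uw: "u \<in> S" "w \<notin> S" "joins e' u w"
    then have "0 < l e'" by (simp add: joins_def l_pos)
    then show "0 \<le> 0 + l e'" by simp
    have "e' \<noteq> e k" if k: "k < n" for k
    proof
      assume "e' = e k"
      then have "{u, w} = {v k, v (Suc k)}" using uw e[OF k] by (simp add: joins_def)
      moreover have "{v k, v (Suc k)} \<subseteq> S"
        using k n vn by (cases "Suc k = n") (auto simp: S_def)
      ultimately show False using uw by auto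
    qed
    then show "weight p q e' u = 0" using wt0 uw by force
  next
    have "src (e (n-1)) \<in> {v (n - 1), v 0}" "tgt (e (n-1)) \<in> {v (n - 1), v 0}"
      using last by (auto simp: joins_def)
    then show "weight p q (p (v 0)) (src (p (v 0))) + weight p q (p (v 0)) (tgt (p (v 0))) = 2"
      using wt1[OF _ last, of "src (e (n-1))"] wt1[OF _ last, of "tgt (e (n-1))"] n by (simp add: p0)
  next
    fix F :: "'v \<Rightarrow> real"
    assume F: "\<forall>x\<in>S-{v 0}. weight p q (p x) (src (p x)) + weight p q (p x) (tgt (p x)) = 2
      \<longrightarrow> F (src (p x)) = F (tgt (p x))"
    \<comment> \<open>The tree edges of the cycle are all chipless and lead from \<open>v 0\<close>
      to \<open>v (n - 1)\<close>, the two ends of the closing edge.\<close>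
    have "F (v k) = F (v 0)" if "k < n" for k
      using that
    proof (induction k)
      case (Suc k)
      have "v (Suc k) \<in> S - {v 0}" using Suc.prems v_eq[of "Suc k" 0] n by (auto simp: S_def)
      moreover have "src (e k) \<in> {v k, v (Suc k)}" "tgt (e k) \<in> {v k, v (Suc k)}"
        using e[of k] Suc.prems by (auto simp: joins_def)
      then have "weight p q (e k) (src (e k)) + weight p q (e k) (tgt (e k)) = 2"
        using wt1[of k "v k" "v (Suc k)"] e[of k] Suc.prems by simp
      ultimately have "F (src (e k)) = F (tgt (e k))" using F pS[OF Suc.prems] by metis
      then have "F (v k) = F (v (Suc k))"
        using e[of k] Suc.prems by (auto elim!: joins_cases)
      then show ?case using Suc by simp
    qed simp
    from this[of "n - 1"] have "F (v (n - 1)) = F (v 0)" using n by linarith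
    then show "F (src (p (v 0))) = F (tgt (p (v 0)))"
      using last by (auto elim!: joins_cases simp: p0)
  qed
  then show ?thesis by blast
qed

text \<open>A step of Dijkstra's algorithm. If two edges \<open>e\<^sub>1\<close>, \<open>e\<^sub>2\<close> tie for the shortest path to \<open>v\<close>, then \<open>\<rho> v\<close> is
  lowered by \<open>\<epsilon>\<close> and \<open>v\<close> spends one unit on each of them, which moves the chips off \<open>v\<close>.\<close>

lemma layout_extend:
  assumes lay: "layout r p q \<rho> S" and bd: "\<exists>e. \<exists>u\<in>S. \<exists>w\<in>V-S. joins e u w"
  shows "\<exists>p q \<rho> v. v \<in> V - S \<and> layout r p q \<rho> (insert v S)"
proof -
  define inn where "inn e = (if src e \<in> S then src e else tgt e)" for e
  define out where "out e = (if src e \<in> S then tgt e else src e)" for e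
  \<comment> \<open>The tentative distance of Dijkstra's algorithm.\<close>
  define h where "h e = \<rho> (inn e) + l e" for e
  define B where "B = {e. \<exists>u\<in>S. \<exists>w\<in>V-S. joins e u w}"
  have B: "joins e (inn e) (out e)" "inn e \<in> S" "out e \<in> V - S" "e \<in> E" if "e \<in> B" for e
    using that by (auto simp: B_def inn_def out_def joins_def doubleton_eq_iff)
  have io: "e \<in> B" "inn e = u" "out e = w" if "u \<in> S" "w \<in> V - S" "joins e u w" for e u w
    using that by (auto simp: B_def inn_def out_def joins_def doubleton_eq_iff)
  have joV: "w \<in> V" if "joins e u w" for e u w
    using that src_in tgt_in by (metis joins_cases)
  have finB: "finite B" "B \<noteq> {}"
    using bd B(4) finite_E by (auto simp: B_def intro: finite_subset)
  define e1 where "e1 = arg_min_on h B"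
  have e1: "e1 \<in> B" "\<And>e. e \<in> B \<Longrightarrow> h e1 \<le> h e"
    using arg_min_if_finite[OF finB, of h] by (auto simp: e1_def not_less)
  define v where "v = out e1"
  have v: "v \<in> V" "v \<notin> S" using B[OF e1(1)] by (auto simp: v_def)
  \<comment> \<open>Any positive number below all edge lengths serves: the chip on each chosen tied
    edge lands at distance \<open>\<epsilon>\<close> from \<open>v\<close>, hence inside the edge,
    and the values already assigned stay below \<open>\<rho>' v + l e\<close> for the edges
    \<open>e\<close> leaving \<open>v\<close>.\<close>
  define \<epsilon> where "\<epsilon> = Min (l ` E) / 2"
  have "E \<noteq> {}" using B[OF e1(1)] by auto
  then have "0 < Min (l ` E)" using finite_E l_pos by (subst Min_gr_iff) auto
  then have \<epsilon>: "0 < \<epsilon>" "\<And>e. e \<in> E \<Longrightarrow> \<epsilon> < l e"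
  proof -
    fix e assume "e \<in> E"
    then have "Min (l ` E) \<le> l e" "0 < l e" using finite_E l_pos by auto
    then show "\<epsilon> < l e" unfolding \<epsilon>_def by simp
  qed (simp add: \<epsilon>_def)
  \<comment> \<open>Two tied edges are enough: once \<open>v\<close> is lowered, any further tied
    edge satisfies the strict inequalities with weight 0 at both ends. Without a tie,
    \<open>e2 = e1\<close> spends both units on the unique shortest edge, and all competitors at
    \<open>v\<close> are strictly longer.\<close>
  obtain e2 R where e2: "e2 \<in> B" "out e2 = v" "h e2 = h e1" and
    R: "(e2 = e1 \<and> R = h e1 \<and> (\<forall>e\<in>B. out e = v \<longrightarrow> e \<noteq> e1 \<longrightarrow> h e1 < h e)) \<or> (e2 \<noteq> e1 \<and> R = h e1 - \<epsilon>)"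
  proof (cases "\<exists>e2\<in>B. e2 \<noteq> e1 \<and> out e2 = v \<and> h e2 = h e1")
    case True
    then show ?thesis using that by blast
  next
    case False
    then have "\<forall>e\<in>B. out e = v \<longrightarrow> e \<noteq> e1 \<longrightarrow> h e1 < h e"
      using e1(2) by (metis order_le_imp_less_or_eq)
    then show ?thesis using that[of e1 "h e1"] e1 by (auto simp: v_def)
  qed
  define p' where "p' = p(v := e1)"
  define q' where "q' = q(v := e2)"
  define \<rho>' where "\<rho>' = \<rho>(v := R)"
  have L: "spanned r p S" "inj_on p S" "\<And>x. x \<in> S \<Longrightarrow> \<exists>u\<in>S. joins (p x) u x"
    "\<And>x. x \<in> S \<Longrightarrow> \<exists>u\<in>S. joins (q x) u x"
    "\<And>e u w. u \<in> S \<Longrightarrow> w \<in> S \<Longrightarrow> joins e u w \<Longrightarrow> admissible p q \<rho> e u w"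
    "\<And>e u w. u \<in> S \<Longrightarrow> w \<in> S \<Longrightarrow> joins e u w \<Longrightarrow> weight p q e u + weight p q e w = 2 \<Longrightarrow> e \<in> p ` S"
    "\<And>e u w. u \<in> S \<Longrightarrow> w \<notin> S \<Longrightarrow> joins e u w \<Longrightarrow> weight p q e u = 0"
    "\<And>e u w u'. u \<in> S \<Longrightarrow> w \<notin> S \<Longrightarrow> joins e u w \<Longrightarrow> u' \<in> S \<Longrightarrow> \<rho> u' \<le> \<rho> u + l e"
    "weight p q (p r) (src (p r)) + weight p q (p r) (tgt (p r)) = 2"
    using lay unfolding layout_def by blast+
  have LF: "F (src (p r)) = F (tgt (p r))" if "\<And>v. v\<in>S-{r} \<Longrightarrow>
      weight p q (p v) (src (p v)) + weight p q (p v) (tgt (p v)) = 2 \<Longrightarrow> F (src (p v)) = F (tgt (p v))"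
    for F :: "'v \<Rightarrow> real"
    using lay that unfolding layout_def by blast
  have r: "r \<in> S" using spanned_subset[OF L(1)] by auto
  have old: "p' x = p x" "q' x = q x" "\<rho>' x = \<rho> x" "weight p' q' e x = weight p q e x" if "x \<in> S" for x e
    using that v by (auto simp: p'_def q'_def \<rho>'_def weight_def)
  have new: "p' v = e1" "q' v = e2" "\<rho>' v = R" by (auto simp: p'_def q'_def \<rho>'_def)
  have wv: "weight p' q' e v = of_bool (e1 = e) + of_bool (e2 = e)" for e
    by (simp add: weight_def new)
  have pe: "src (p x) \<in> S" "tgt (p x) \<in> S" if "x \<in> S" for x
    using L(3)[OF that] that by (auto elim!: joins_cases)
  have jsym: "joins e u w \<longleftrightarrow> joins e w u" for e u w by (auto simp: joins_def insert_commute)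
  have Rb: "R \<le> h e1" "h e1 \<le> R + \<epsilon>" using R \<epsilon> by auto
  \<comment> \<open>The lower bounds come from the Dijkstra invariant, which gives
    \<open>\<rho> u \<le> h e1\<close>, the upper bounds from the minimality of \<open>e1\<close>.
    Total weight 2 occurs only for \<open>e1\<close> in the absence of a tie, and \<open>e1\<close>
    is the new parent edge.\<close>
  have adm: "admissible p' q' \<rho>' e u v \<and> (weight p' q' e u + weight p' q' e v = 2 \<longrightarrow> e = e1)"
    if u: "u \<in> S" "joins e u v" for e u
  proof -
    have eB: "e \<in> B" "inn e = u" "out e = v" using io[OF u(1) _ u(2)] v by auto
    have eE: "e \<in> E" using B eB by auto
    have w0: "weight p' q' e u = 0" using L(7)[OF u(1) v(2) u(2)] old u by simp
    have 1: "h e1 \<le> \<rho> u + l e" using e1(2)[OF eB(1)] eB by (simp add: h_def)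
    have 2: "\<rho> u \<le> h e1"
      using L(8)[OF B(2)[OF e1(1)] _ B(1)[OF e1(1)] u(1)] B(3)[OF e1(1)] by (simp add: h_def)
    note le = l_pos[OF eE] \<epsilon>(2)[OF eE]
    have he: "h e = \<rho> u + l e" using eB by (simp add: h_def)
    show ?thesis
    proof (cases "e2 = e1")
      case True
      then have R': "R = h e1" "e \<noteq> e1 \<Longrightarrow> h e1 < h e" using R eB by auto
      show ?thesis
        using True w0 R' 2 le he old(3)[OF u(1)] by (cases "e = e1") (auto simp: admissible_def wv new)
    next
      case False
      then have R': "R = h e1 - \<epsilon>" using R by auto
      show ?thesis
        using False w0 R' 1 2 le \<epsilon>(1) he old(3)[OF u(1)] e2(3) by (auto simp: admissible_def wv new)
    qed
  qed
  have "layout r p' q' \<rho>' (insert v S)"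
    unfolding layout_def
  proof (intro conjI ballI allI impI)
    have "spanned r p' S" using spanned_cong[OF L(1)] old by blast
    then show "spanned r p' (insert v S)"
      using spanned.attach[of r p' S "inn e1" v] B[OF e1(1)] v new(1)
      by (simp add: joins_def v_def[symmetric])
    have "e1 \<noteq> p x" if "x \<in> S" for x
    proof -
      have "v \<in> {src e1, tgt e1}" using B(1)[OF e1(1)] by (simp add: joins_def v_def)
      then show ?thesis using pe[OF that] v by auto
    qed
    then have "p' v \<notin> p' ` S" using old(1) new(1) by auto
    moreover have "inj_on p' S" using L(2) old(1) by (simp add: inj_on_def)
    ultimately show "inj_on p' (insert v S)" using v by simp
  next
    fix x assume x: "x \<in> insert v S"
    show "\<exists>u\<in>insert v S. joins (p' x) u x"
    proof (cases "x = v")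
      case True
      then show ?thesis using B(1,2)[OF e1(1)] new(1) by (auto simp: v_def)
    next
      case False
      then show ?thesis using x L(3)[of x] old(1)[of x] by auto
    qed
    show "\<exists>u\<in>insert v S. joins (q' x) u x"
    proof (cases "x = v")
      case True
      then show ?thesis using B(1,2)[OF e2(1)] e2(2) new(2) by auto
    next
      case False
      then show ?thesis using x L(4)[of x] old(2)[of x] by auto
    qed
  next
    fix e u w assume uw: "u \<in> insert v S" "w \<in> insert v S" "joins e u w"
    have "u \<noteq> w" using uw by (auto elim!: joins_cases)
    then consider "u \<in> S" "w \<in> S" | "u \<in> S" "w = v" | "u = v" "w \<in> S" using uw by auto
    then have "admissible p' q' \<rho>' e u w \<and>
        (weight p' q' e u + weight p' q' e w = 2 \<longrightarrow> e \<in> p' ` insert v S)"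
    proof cases
      case 1
      then have "e \<in> p ` S" if "weight p' q' e u + weight p' q' e w = 2"
        using L(6)[OF 1 uw(3)] that old by simp
      moreover have "p ` S \<subseteq> p' ` insert v S" using old(1) by force
      moreover have "admissible p' q' \<rho>' e u w"
        using L(5)[OF 1 uw(3)] 1 by (simp add: admissible_def old)
      ultimately show ?thesis by blast
    next
      case 2
      then show ?thesis using adm[of u e] uw(3) new by auto
    next
      case 3
      then show ?thesis using adm[of w e] uw(3) new(1) jsym[of e u w] admissible_sym by (auto simp: add.commute)
    qed
    then show "admissible p' q' \<rho>' e u w"
      and "weight p' q' e u + weight p' q' e w = 2 \<Longrightarrow> e \<in> p' ` insert v S" by auto
  next
    fix e u w assume uw: "u \<in> insert v S" "w \<notin> insert v S" "joins e u w"
    have wV: "w \<in> V" using joV uw by blast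
    show "weight p' q' e u = 0"
    proof (cases "u = v")
      case True
      have "e' \<noteq> e" if "e' \<in> B" for e'
      proof -
        have "inn e' \<in> {src e', tgt e'}" "inn e' \<in> S" using B(1,2)[OF that] by (auto simp: joins_def)
        moreover have "{src e, tgt e} = {v, w}" using uw(3) True by (simp add: joins_def)
        ultimately show ?thesis using v(2) uw(2) by auto
      qed
      then have "e1 \<noteq> e" "e2 \<noteq> e" using e1(1) e2(1) by auto
      then show ?thesis using True by (simp add: wv)
    next
      case False
      then show ?thesis using uw L(7)[of u w e] old by auto
    qed
    fix u' assume u': "u' \<in> insert v S"
    have eE: "e \<in> E" using uw by (simp add: joins_def)
    have u'h: "\<rho>' u' \<le> h e1"
      using u' L(8)[OF B(2)[OF e1(1)] _ B(1)[OF e1(1)], of u'] B(3)[OF e1(1)] Rb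
      by (auto simp: new old h_def)
    show "\<rho>' u' \<le> \<rho>' u + l e"
    proof (cases "u = v")
      case True
      then show ?thesis using u'h Rb \<epsilon>(2)[OF eE] by (simp add: new)
    next
      case False
      then have "e \<in> B" "inn e = u" using uw io[of u w e] wV by auto
      then have "h e1 \<le> \<rho> u + l e" using e1(2) by (force simp: h_def)
      then show ?thesis using u'h False uw by (simp add: old)
    qed
  next
    show "weight p' q' (p' r) (src (p' r)) + weight p' q' (p' r) (tgt (p' r)) = 2"
      using L(9) r pe by (simp add: old)
  next
    fix F :: "'v \<Rightarrow> real"
    assume *: "\<forall>x\<in>insert v S-{r}. weight p' q' (p' x) (src (p' x)) + weight p' q' (p' x) (tgt (p' x)) = 2
      \<longrightarrow> F (src (p' x)) = F (tgt (p' x))"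
    have "F (src (p x)) = F (tgt (p x))"
      if "x \<in> S - {r}" "weight p q (p x) (src (p x)) + weight p q (p x) (tgt (p x)) = 2" for x
      using *[rule_format, of x] that pe[of x] by (simp add: old)
    then show "F (src (p' r)) = F (tgt (p' r))" using LF r by (simp add: old)
  qed
  then show ?thesis using v by blast
qed

text \<open>Connectedness supplies an edge leaving \<open>S\<close> as long as \<open>S\<close> is
  not all of \<open>V\<close>, so the layout of the cycle can be extended vertex by vertex.\<close>

lemma layout_exists:
  assumes conn: "\<And>S. S \<subseteq> V \<Longrightarrow> S \<noteq> {} \<Longrightarrow> S \<noteq> V \<Longrightarrow> \<exists>e. \<exists>u\<in>S. \<exists>w\<in>V-S. joins e u w"
    and c: "c \<in> cycles" "c \<noteq> 0"
  shows "\<exists>r p q \<rho>. layout r p q \<rho> V"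
proof -
  obtain r p q \<rho> S where "layout r p q \<rho> S"
    using cycle_exists[OF c] layout_cycle unfolding joins_def by blast
  then show ?thesis
  proof (induction "card V - card S" arbitrary: p q \<rho> S rule: less_induct)
    case less
    have S: "S \<subseteq> V" "r \<in> S" using less.prems spanned_subset by (auto simp: layout_def)
    show ?case
    proof (cases "S = V")
      case True
      then show ?thesis using less.prems by blast
    next
      case False
      then obtain p' q' \<rho>' v where v: "v \<in> V - S" "layout r p' q' \<rho>' (insert v S)"
        using layout_extend[OF less.prems] conn[OF S(1)] S(2) by blast
      have "card (insert v S) = Suc (card S)" "card (insert v S) \<le> card V"
        using v S finite_V finite_subset[OF S(1) finite_V] card_mono[of V "insert v S"] by auto
      then show ?thesis using less.hyps[OF _ v(2)] by simp
    qed
  qed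
qed

end

section \<open>Positions of the chips and their degrees of freedom\<close>

context weighted_multigraph
begin

text \<open>Directions in which the chips can move: \<open>F\<close> is the variation of the function at the vertices.\<close>

definition chip_space :: "('e \<Rightarrow> nat) \<Rightarrow> ('e \<times> nat \<Rightarrow> real) set" where
  "chip_space k = {y. (\<forall>e i. e \<notin> E \<or> k e \<le> i \<longrightarrow> y (e, i) = 0) \<and>
    (\<exists>F. \<forall>e\<in>E. F (tgt e) - F (src e) = - (\<Sum>i<k e. y (e, i)))}"

lemma subspace_chip_space: "fun_space.subspace (chip_space k)"
  unfolding fun_space.subspace_def
proof (intro conjI ballI allI)
  show "0 \<in> chip_space k" by (auto simp: chip_space_def intro!: exI[of _ "\<lambda>_. 0"])
next
  fix y z assume "y \<in> chip_space k" "z \<in> chip_space k"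
  then obtain F G where *: "\<forall>e i. e \<notin> E \<or> k e \<le> i \<longrightarrow> y (e, i) = 0" "\<forall>e i. e \<notin> E \<or> k e \<le> i \<longrightarrow> z (e, i) = 0"
    "\<forall>e\<in>E. F (tgt e) - F (src e) = - (\<Sum>i<k e. y (e, i))"
    "\<forall>e\<in>E. G (tgt e) - G (src e) = - (\<Sum>i<k e. z (e, i))"
    by (auto simp: chip_space_def)
  have "\<forall>e\<in>E. (F (tgt e) + G (tgt e)) - (F (src e) + G (src e)) = - (\<Sum>i<k e. (y + z) (e, i))"
    using *(3,4) by (auto simp: sum.distrib algebra_simps)
  then show "y + z \<in> chip_space k"
    using *(1,2) by (auto simp: chip_space_def intro!: exI[of _ "\<lambda>v. F v + G v"])
next
  fix c y assume "y \<in> chip_space k"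
  then obtain F where *: "\<forall>e i. e \<notin> E \<or> k e \<le> i \<longrightarrow> y (e, i) = 0"
    "\<forall>e\<in>E. F (tgt e) - F (src e) = - (\<Sum>i<k e. y (e, i))"
    by (auto simp: chip_space_def)
  have "\<forall>e\<in>E. c * F (tgt e) - c * F (src e) = - (\<Sum>i<k e. fscale c y (e, i))"
    using *(2) by (auto simp: fscale_def sum_distrib_left[symmetric] right_diff_distrib[symmetric])
  then show "fscale c y \<in> chip_space k"
    using *(1) by (auto simp: chip_space_def fscale_def intro!: exI[of _ "\<lambda>v. c * F v"])
qed

text \<open>Turns a layout into the data of a cell. The first conclusion will mean that
  \<open>K + div f\<close> vanishes at the vertices, the fifth that slopes and chips account for the
  differences of \<open>F\<close> along the edges. For the dimension, the variation of
  \<open>F\<close> can be prescribed on tree edges with a chip and must vanish along chipless edges.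
  These are tree edges or \<open>p r\<close>, where it vanishes by the last clause of
  \<open>layout\<close>.\<close>

lemma chip_pattern_exists:
  assumes conn: "\<And>S. S \<subseteq> V \<Longrightarrow> S \<noteq> {} \<Longrightarrow> S \<noteq> V \<Longrightarrow> \<exists>e. \<exists>u\<in>S. \<exists>w\<in>V-S. joins e u w"
    and c: "c \<in> cycles" "c \<noteq> 0"
  obtains k :: "'e \<Rightarrow> nat" and s :: "'e \<Rightarrow> int" and x :: "'e \<times> nat \<Rightarrow> real" and F :: "'v \<Rightarrow> real"
  where "\<And>v. v \<in> V \<Longrightarrow>
      (\<Sum>e\<in>E. of_bool (src e = v) * (1 + s e) + of_bool (tgt e = v) * (1 - s e - int (k e))) = 2"
    and "\<And>e i. e \<in> E \<Longrightarrow> i < k e \<Longrightarrow> 0 < x (e, i) \<and> x (e, i) < l e"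
    and "\<And>e i j. e \<in> E \<Longrightarrow> i < j \<Longrightarrow> j < k e \<Longrightarrow> x (e, i) < x (e, j)"
    and "\<And>e i. e \<notin> E \<or> k e \<le> i \<Longrightarrow> x (e, i) = 0"
    and "\<And>e. e \<in> E \<Longrightarrow> F (tgt e) - F (src e) = s e * l e + (\<Sum>i<k e. l e - x (e, i))"
    and "fun_space.dim (chip_space k) + 1 = fun_space.dim cycles"
proof -
  obtain r p q \<rho> where lay: "layout r p q \<rho> V" using layout_exists[OF conn c] by blast
  have L: "spanned r p V" "inj_on p V" "\<And>x. x \<in> V \<Longrightarrow> \<exists>u\<in>V. joins (p x) u x"
    "\<And>x. x \<in> V \<Longrightarrow> \<exists>u\<in>V. joins (q x) u x"
    "\<And>e u w. u \<in> V \<Longrightarrow> w \<in> V \<Longrightarrow> joins e u w \<Longrightarrow> admissible p q \<rho> e u w"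
    "\<And>e u w. u \<in> V \<Longrightarrow> w \<in> V \<Longrightarrow> joins e u w \<Longrightarrow> weight p q e u + weight p q e w = 2 \<Longrightarrow> e \<in> p ` V"
    "weight p q (p r) (src (p r)) + weight p q (p r) (tgt (p r)) = 2"
    using lay unfolding layout_def by blast+
  have LF: "F (src (p r)) = F (tgt (p r))" if "\<And>v. v\<in>V-{r} \<Longrightarrow>
      weight p q (p v) (src (p v)) + weight p q (p v) (tgt (p v)) = 2 \<Longrightarrow> F (src (p v)) = F (tgt (p v))"
    for F :: "'v \<Rightarrow> real"
    using lay that unfolding layout_def by blast
  have r: "r \<in> V" using spanned_subset[OF L(1)] by auto
  have jo: "joins e (src e) (tgt e)" if "e \<in> E" for e using that by (simp add: joins_def)
  define a where "a e = weight p q e (src e)" for e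
  define b where "b e = weight p q e (tgt e)" for e
  define k where "k e = nat (2 - a e - b e)" for e
  \<comment> \<open>The slope with which \<open>f\<close> leaves the source. After
    \<open>k e\<close> unit bends it has become \<open>1 - b e\<close>, so \<open>f\<close> leaves
    the target with slope \<open>b e - 1\<close>, again weight minus 1.\<close>
  define s where "s e = a e - 1" for e
  have nn: "0 \<le> a e" "0 \<le> b e" for e by (auto simp: a_def b_def weight_def)
  have adm: "(a e + b e = 2 \<and> \<rho> (tgt e) - \<rho> (src e) = (1 - real_of_int (a e)) * l e) \<or>
    (a e + b e \<le> 1 \<and> - (1 - real_of_int (b e)) * l e < \<rho> (tgt e) - \<rho> (src e) \<and>
      \<rho> (tgt e) - \<rho> (src e) < (1 - real_of_int (a e)) * l e)" if "e \<in> E" for e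
    using L(5)[OF src_in[OF that] tgt_in[OF that] jo[OF that]] by (simp add: admissible_def a_def b_def)
  have k: "int (k e) = 2 - a e - b e" if "e \<in> E" for e
    using adm[OF that] by (auto simp: k_def)
  have pE: "p v \<in> E" "v \<in> {src (p v), tgt (p v)}" if "v \<in> V" for v
    using L(3)[OF that] by (auto simp: joins_def)
  have qE: "q v \<in> E" "v \<in> {src (q v), tgt (q v)}" if "v \<in> V" for v
    using L(4)[OF that] by (auto simp: joins_def)
  have wt: "(\<Sum>e\<in>E. of_bool (src e = v) * a e + of_bool (tgt e = v) * b e) = 2" if v: "v \<in> V" for v
  proof -
    have "(\<Sum>e\<in>E. of_bool (src e = v) * a e + of_bool (tgt e = v) * b e)
      = (\<Sum>e\<in>E. of_bool (p v = e) + of_bool (q v = e) :: int)"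
    proof (intro sum.cong refl)
      fix e assume e: "e \<in> E"
      show "of_bool (src e = v) * a e + of_bool (tgt e = v) * b e = of_bool (p v = e) + of_bool (q v = e)"
        using src_neq_tgt[OF e] pE(2)[OF v] qE(2)[OF v] by (auto simp: a_def b_def weight_def)
    qed
    also have "\<dots> = 2" using pE[OF v] qE[OF v] finite_E by (simp add: sum.distrib)
    finally show ?thesis .
  qed
  have vert: "(\<Sum>e\<in>E. of_bool (src e = v) * (1 + s e) + of_bool (tgt e = v) * (1 - s e - int (k e))) = 2"
    if v: "v \<in> V" for v
    unfolding wt[OF v, symmetric] by (intro sum.cong refl) (simp add: s_def k)
  define n where "n i = card {e \<in> E. k e = i}" for i
  have k2: "k e = 0 \<or> k e = 1 \<or> k e = 2" if "e \<in> E" for e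
    using nn[of e] k[OF that] by linarith
  have kp: "k (p v) \<le> 1" if "v \<in> V" for v
  proof -
    have "a (p v) + b (p v) \<ge> 1"
      using pE(2)[OF that] nn[of "p v"] by (auto simp: a_def b_def weight_def)
    then show ?thesis using k[OF pE(1)[OF that]] by linarith
  qed
  have k0: "e \<in> p ` V" if "e \<in> E" "k e = 0" for e
    using L(6)[OF src_in[OF that(1)] tgt_in[OF that(1)] jo[OF that(1)]] k[OF that(1)] that(2)
    by (simp add: a_def b_def)
  have kr: "k (p r) = 0" using L(7) by (simp add: k_def a_def b_def)
  \<comment> \<open>On a tree edge with one chip, the chip measures the variation of
    \<open>F\<close>. On an edge with two chips, the first is free and the second follows from
    \<open>F\<close>. As \<open>p r\<close> is chipless, \<open>J2\<close> contains only tree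
    edges.\<close>
  define J2 where "J2 = {e \<in> p ` V. k e = 1}"
  define J1 where "J1 = {e \<in> E. k e = 2}"
  define J where "J = (\<lambda>e. (e, 0::nat)) ` (J1 \<union> J2)"
  have J12: "finite J1" "finite J2" "J1 \<inter> J2 = {}" using finite_E finite_V by (auto simp: J1_def J2_def)
  have cardJ: "card J = card J1 + card J2"
    unfolding J_def by (subst card_image) (auto simp: inj_on_def card_Un_disjoint J12)
  have split: "card A = card {e \<in> A. k e = 0} + card {e \<in> A. k e = 1} + card {e \<in> A. k e = 2}"
    if "A \<subseteq> E" for A
  proof -
    have fin: "finite A" using that finite_E finite_subset by auto
    have "({e \<in> A. k e = 0} \<union> {e \<in> A. k e = 1}) \<union> {e \<in> A. k e = 2} = A"
      using k2 that by auto
    moreover have "card (({e \<in> A. k e = 0} \<union> {e \<in> A. k e = 1}) \<union> {e \<in> A. k e = 2})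
      = card ({e \<in> A. k e = 0} \<union> {e \<in> A. k e = 1}) + card {e \<in> A. k e = 2}"
      using fin by (intro card_Un_disjoint) auto
    moreover have "card ({e \<in> A. k e = 0} \<union> {e \<in> A. k e = 1})
      = card {e \<in> A. k e = 0} + card {e \<in> A. k e = 1}"
      using fin by (intro card_Un_disjoint) auto
    ultimately show ?thesis by metis
  qed
  \<comment> \<open>Double counting of the weights: each vertex spends two units, and each edge
    receives two units less the number of its chips.\<close>
  have kE: "(\<Sum>e\<in>E. int (k e)) = 2 * int (card E) - 2 * int (card V)"
  proof -
    have "2 * int (card V) = (\<Sum>v\<in>V. \<Sum>e\<in>E. of_bool (src e = v) * a e + of_bool (tgt e = v) * b e)"
      by (simp add: wt)
    also have "\<dots> = (\<Sum>e\<in>E. \<Sum>v\<in>V. of_bool (src e = v) * a e + of_bool (tgt e = v) * b e)"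
      by (rule sum.swap)
    also have "\<dots> = (\<Sum>e\<in>E. 2 - int (k e))"
      using src_in tgt_in finite_V by (intro sum.cong refl) (simp add: k sum.distrib sum_distrib_right[symmetric])
    finally show ?thesis by (simp add: sum_subtractf)
  qed
  have ksum: "(\<Sum>e\<in>E. int (k e)) = int (card {e \<in> E. k e = 1}) + 2 * int (card J1)"
  proof -
    have "(\<Sum>e\<in>E. int (k e)) = (\<Sum>e\<in>E. of_bool (k e = 1) + 2 * of_bool (k e = 2))"
      using k2 by (intro sum.cong refl) force
    also have "\<dots> = (\<Sum>e\<in>E. of_bool (k e = 1)) + 2 * (\<Sum>e\<in>E. of_bool (k e = 2))"
      by (simp add: sum.distrib sum_distrib_left)
    also have "\<dots> = int (card {e \<in> E. k e = 1}) + 2 * int (card J1)"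
    proof -
      have "{e \<in> E. k e = i} = E \<inter> {e. k e = i}" for i by auto
      then show ?thesis using finite_E by (simp add: J1_def)
    qed
    finally show ?thesis .
  qed
  have pV: "p ` V \<subseteq> E" using pE by auto
  have "{e \<in> p ` V. k e = 2} = {}" using kp by fastforce
  then have "card {e \<in> p ` V. k e = 2} = 0" by (simp only: card.empty)
  moreover have "{e \<in> p ` V. k e = 0} = {e \<in> E. k e = 0}" using k0 pV by auto
  \<comment> \<open>\<open>p\<close> is a bijection from \<open>V\<close> onto the chipless edges
    together with \<open>J2\<close>.\<close>
  ultimately have cV: "card V = card {e \<in> E. k e = 0} + card J2"
    using split[OF pV] card_image[OF L(2)] by (simp add: J2_def)
  have dimW: "fun_space.dim (chip_space k) = card J"
  proof (rule dim_eq_card_coordinates[OF subspace_chip_space])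
    show "finite J" using J12 by (simp add: J_def)
  next
    fix y assume y: "y \<in> chip_space k" and z: "\<And>j. j \<in> J \<Longrightarrow> y j = 0"
    obtain F where F: "\<And>e. e \<in> E \<Longrightarrow> F (tgt e) - F (src e) = - (\<Sum>i<k e. y (e, i))"
      and y0: "\<And>e i. e \<notin> E \<or> k e \<le> i \<Longrightarrow> y (e, i) = 0"
      using y by (auto simp: chip_space_def)
    have "F (tgt (p v)) = F (src (p v))" if "v \<in> V - {r}" for v
    proof -
      have v: "v \<in> V" using that by simp
      consider "k (p v) = 0" | "k (p v) = 1" using kp[OF v] by linarith
      then show ?thesis
      proof cases
        case 1
        then show ?thesis using F[OF pE(1)[OF v]] by simp
      next
        case 2
        then have "(p v, 0) \<in> J" using v by (auto simp: J_def J2_def)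
        then show ?thesis using z 2 F[OF pE(1)[OF v]] by simp
      qed
    qed
    then have Fr: "F v = F r" if "v \<in> V" for v
      using potential_unique[OF L(1), of F v] that by blast
    have "y (e, i) = 0" for e i
    proof (cases "e \<in> E \<and> i < k e")
      case True
      then have e: "e \<in> E" "i < k e" by auto
      have "(\<Sum>i<k e. y (e, i)) = 0" using F[OF e(1)] Fr[OF src_in[OF e(1)]] Fr[OF tgt_in[OF e(1)]] by simp
      moreover have "k e = 2 \<Longrightarrow> y (e, 0) = 0" using z e by (auto simp: J_def J1_def)
      ultimately show ?thesis using k2[OF e(1)] e(2) by (auto simp: numeral_2_eq_2 less_Suc_eq)
    next
      case False
      then show ?thesis using y0[of e i] by auto
    qed
    then show "y = 0" by (auto simp: fun_eq_iff)
  next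
    fix \<alpha> :: "'e \<times> nat \<Rightarrow> real"
    obtain F where F: "\<forall>v\<in>V-{r}. F (tgt (p v)) - F (src (p v)) = (if k (p v) = 1 then - \<alpha> (p v, 0) else 0)"
      using potential_exists[OF L(1), of "\<lambda>e. if k e = 1 then - \<alpha> (e, 0) else 0"] by blast
    \<comment> \<open>\<open>F\<close> forces the displacement of a single chip, in agreement with
      \<open>\<alpha>\<close> on tree edges. On an edge with two chips the second one compensates
      for the prescribed first one.\<close>
    define y where "y = (\<lambda>(e, i). if e \<in> E \<and> i < k e then
        if k e = 1 then F (src e) - F (tgt e) else if i = 0 then \<alpha> (e, 0)
        else F (src e) - F (tgt e) - \<alpha> (e, 0) else 0)"
    \<comment> \<open>\<open>F\<close> was prescribed along tree edges only; \<open>p r\<close> is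
      the single chipless edge outside the tree, and its equation has to come for free.\<close>
    have pr: "F (src (p r)) = F (tgt (p r))"
    proof (rule LF)
      fix v assume v: "v \<in> V - {r}"
        "weight p q (p v) (src (p v)) + weight p q (p v) (tgt (p v)) = 2"
      then have "k (p v) = 0" by (simp add: k_def a_def b_def)
      then show "F (src (p v)) = F (tgt (p v))" using F v(1) by force
    qed
    have "F (tgt e) - F (src e) = - (\<Sum>i<k e. y (e, i))" if e: "e \<in> E" for e
    proof (cases "k e = 0")
      case True
      then obtain v where v: "v \<in> V" "e = p v" using k0[OF e] by auto
      have "F (tgt e) - F (src e) = 0"
        using F v True pr by (cases "v = r") auto
      then show ?thesis using True by simp
    next
      case False
      then show ?thesis using k2[OF e] e by (auto simp: y_def numeral_2_eq_2)
    qed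
    then have "y \<in> chip_space k" by (auto simp: chip_space_def y_def)
    moreover have "y j = \<alpha> j" if j: "j \<in> J" for j
    proof -
      obtain e where e: "j = (e, 0)" "e \<in> J1 \<or> e \<in> J2" using j unfolding J_def by blast
      show ?thesis
      proof (cases "e \<in> J1")
        case True
        then show ?thesis by (auto simp: y_def e J1_def)
      next
        case False
        then obtain v where v: "v \<in> V" "e = p v" "k e = 1" using e by (auto simp: J2_def)
        then have "v \<noteq> r" using kr by auto
        then have "F (tgt (p v)) - F (src (p v)) = - \<alpha> (p v, 0)" using F v by simp
        then show ?thesis using v pE(1)[OF v(1)] by (simp add: y_def e(1))
      qed
    qed
    ultimately show "\<exists>y\<in>chip_space k. \<forall>j\<in>J. y j = \<alpha> j" by blast
  qed
  \<comment> \<open>Writing \<open>n_i\<close> for the number of edges with \<open>i\<close> chips,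
    \<open>card J = n_2 + card V - n_0\<close>, \<open>n_1 + 2 n_2 = 2 (card E - card V)\<close> and
    \<open>card E = n_0 + n_1 + n_2\<close> combine to
    \<open>card J = card E - card V\<close>.\<close>
  have dim: "fun_space.dim (chip_space k) + 1 = fun_space.dim cycles"
    using dim_cycles[OF L(1)] kE ksum cV split[OF order_refl] dimW cardJ
    unfolding J1_def[symmetric] by linarith
  \<comment> \<open>The equation for \<open>F = -\<rho>\<close> forces the position of a single
    chip. Of two chips it forces only the sum of the positions, which is \<open>\<sigma>\<close>:
    they are moved apart symmetrically from \<open>\<sigma> / 2\<close>, by half the distance of
    that point from the nearer end of the edge.\<close>
  define x where "x = (\<lambda>(e, i). if e \<in> E \<and> i < k e then
     (if k e = 1 then a e * l e + (\<rho> (tgt e) - \<rho> (src e))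
      else let \<sigma> = l e + (\<rho> (tgt e) - \<rho> (src e)); \<eta> = min (\<sigma> / 2) (l e - \<sigma> / 2) / 2 in
        if i = 0 then \<sigma> / 2 - \<eta> else \<sigma> / 2 + \<eta>) else 0)"
  have pos: "(\<forall>i<k e. 0 < x (e, i) \<and> x (e, i) < l e) \<and> (k e = 2 \<longrightarrow> x (e, 0) < x (e, 1)) \<and>
     - \<rho> (tgt e) - (- \<rho> (src e)) = s e * l e + (\<Sum>i<k e. l e - x (e, i))" if e: "e \<in> E" for e
  proof -
    consider (0) "k e = 0" | (1) "k e = 1" | (2) "k e = 2" using k2[OF e] by argo
    then show ?thesis
    proof cases
      case 0
      then show ?thesis using adm[OF e] k[OF e] by (auto simp: s_def algebra_simps)
    next
      case 1
      then have ab: "a e + b e = 1" using k[OF e] by simp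
      then have "real_of_int (b e) = 1 - real_of_int (a e)" by linarith
      then have "l e * real_of_int (b e) = l e - l e * real_of_int (a e)"
        by (simp only: right_diff_distrib mult_1_right)
      then show ?thesis using adm[OF e] ab e 1 by (auto simp: x_def s_def algebra_simps)
    next
      case 2
      then have ab: "a e = 0" "b e = 0" using k[OF e] nn[of e] by auto
      define \<sigma> where "\<sigma> = l e + (\<rho> (tgt e) - \<rho> (src e))"
      define \<eta> where "\<eta> = min (\<sigma> / 2) (l e - \<sigma> / 2) / 2"
      have \<sigma>: "0 < \<sigma>" "\<sigma> < 2 * l e" using adm[OF e] ab by (auto simp: \<sigma>_def)
      then have \<eta>: "0 < \<eta>" "\<eta> < \<sigma> / 2" "\<eta> < l e - \<sigma> / 2" by (auto simp: \<eta>_def min_def)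
      have "x (e, 0) = \<sigma> / 2 - \<eta>" "x (e, 1) = \<sigma> / 2 + \<eta>"
        using e 2 by (simp_all add: x_def Let_def \<sigma>_def \<eta>_def)
      then show ?thesis using 2 \<sigma> \<eta> ab
        by (auto simp: numeral_2_eq_2 less_Suc_eq s_def) (auto simp: \<sigma>_def)
    qed
  qed
  show ?thesis
  proof (rule that[of s k x "\<lambda>v. - \<rho> v"])
    fix e i j assume "e \<in> E" "i < j" "j < k e"
    moreover from this have "k e = 2" "i = 0" "j = 1" using k2[of e] by auto
    ultimately show "x (e, i) < x (e, j)" using pos[of e] by simp
  next
    show "\<And>e i. e \<notin> E \<or> k e \<le> i \<Longrightarrow> x (e, i) = 0" by (auto simp: x_def)
  qed (use vert pos dim in auto)
qed

end

section \<open>Star charts and directions\<close>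

text \<open>Injectivity makes \<open>\<tau>\<close> strictly monotone, which fixes one sign for the
  whole interval. With this sign the local isometry says that \<open>\<tau> s - \<sigma> * s\<close>
  is locally constant.\<close>

lemma local_isometry_imp_affine:
  fixes \<tau> :: "real \<Rightarrow> real"
  assumes inj: "inj_on \<tau> {a<..<b}"
    and loc: "\<forall>t\<in>{a<..<b}. \<exists>\<delta>>0. \<forall>s\<in>{a<..<b}. \<forall>s'\<in>{a<..<b}.
      \<bar>s - t\<bar> < \<delta> \<longrightarrow> \<bar>s' - t\<bar> < \<delta> \<longrightarrow> \<bar>\<tau> s - \<tau> s'\<bar> = \<bar>s - s'\<bar>"
  obtains \<sigma> c where "\<sigma> = 1 \<or> \<sigma> = -1" "\<And>s. s \<in> {a<..<b} \<Longrightarrow> \<tau> s = c + \<sigma> * s"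
proof -
  have cont: "continuous_on {a<..<b} \<tau>"
    unfolding continuous_on_iff dist_real_def
  proof (intro ballI allI impI)
    fix t and \<epsilon> :: real assume t: "t \<in> {a<..<b}" and \<epsilon>: "0 < \<epsilon>"
    obtain \<delta> where \<delta>: "\<delta> > 0" "\<forall>s\<in>{a<..<b}. \<forall>s'\<in>{a<..<b}.
      \<bar>s - t\<bar> < \<delta> \<longrightarrow> \<bar>s' - t\<bar> < \<delta> \<longrightarrow> \<bar>\<tau> s - \<tau> s'\<bar> = \<bar>s - s'\<bar>" using loc t by blast
    then show "\<exists>d>0. \<forall>s\<in>{a<..<b}. \<bar>s - t\<bar> < d \<longrightarrow> \<bar>\<tau> s - \<tau> t\<bar> < \<epsilon>"
      using t \<epsilon> by (intro exI[of _ "min \<delta> \<epsilon>"]) auto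
  qed
  have "strict_mono_on {a<..<b} \<tau> \<or> strict_antimono_on {a<..<b} \<tau>"
    using injective_eq_monotone_map[OF is_interval_oo cont] inj by simp
  then obtain \<sigma> where \<sigma>: "\<sigma> = 1 \<or> \<sigma> = -1"
    and mono: "\<And>s s'. s \<in> {a<..<b} \<Longrightarrow> s' \<in> {a<..<b} \<Longrightarrow> s < s' \<Longrightarrow> \<sigma> * \<tau> s < \<sigma> * \<tau> s'"
  proof
    assume "strict_mono_on {a<..<b} \<tau>"
    then show thesis using that[of 1] by (auto simp: monotone_on_def)
  next
    assume "strict_antimono_on {a<..<b} \<tau>"
    then show thesis using that[of "-1"] by (auto simp: monotone_on_def)
  qed
  have const: "\<tau> s - \<sigma> * s = \<tau> t - \<sigma> * t" if "s \<in> {a<..<b}" "t \<in> {a<..<b}" for s t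
  proof (rule connected_local_const[of "{a<..<b}" _ _ "\<lambda>s. \<tau> s - \<sigma> * s"])
    show "\<forall>t\<in>{a<..<b}. eventually (\<lambda>s. \<tau> t - \<sigma> * t = \<tau> s - \<sigma> * s) (at t within {a<..<b})"
    proof
      fix t assume t: "t \<in> {a<..<b}"
      obtain \<delta> where \<delta>: "\<delta> > 0" "\<forall>s\<in>{a<..<b}. \<forall>s'\<in>{a<..<b}.
        \<bar>s - t\<bar> < \<delta> \<longrightarrow> \<bar>s' - t\<bar> < \<delta> \<longrightarrow> \<bar>\<tau> s - \<tau> s'\<bar> = \<bar>s - s'\<bar>" using loc t by blast
      have "\<tau> t - \<sigma> * t = \<tau> s - \<sigma> * s" if s: "s \<in> {a<..<b}" "\<bar>s - t\<bar> < \<delta>" for s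
      proof -
        have "\<bar>\<tau> s - \<tau> t\<bar> = \<bar>s - t\<bar>" using \<delta> s t by auto
        then show ?thesis using \<sigma> mono[OF s(1) t] mono[OF t s(1)] by (cases s t rule: linorder_cases) auto
      qed
      then show "eventually (\<lambda>s. \<tau> t - \<sigma> * t = \<tau> s - \<sigma> * s) (at t within {a<..<b})"
        using \<delta>(1) by (auto simp: eventually_at dist_real_def)
    qed
  qed (use that in auto)
  show thesis
  proof (rule that[OF \<sigma>])
    fix s assume "s \<in> {a<..<b}"
    then show "\<tau> s = (\<tau> ((a + b) / 2) - \<sigma> * ((a + b) / 2)) + \<sigma> * s"
      using const[of s "(a + b) / 2"] by simp
  qed
qed

lemma star_chart_shrink:
  assumes "star_chart \<Gamma> x n r \<phi>" "0 < r'" "r' \<le> r"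
  shows "star_chart \<Gamma> x n r' \<phi>"
proof -
  have d: "dist x (\<phi> i s) = s" if "i < n" "s \<in> {0..<r}" for i s
  proof -
    have "\<phi> i 0 = x" "dist (\<phi> i 0) (\<phi> i s) = \<bar>0 - s\<bar>"
      using assms(1) that unfolding star_chart_def by auto
    then show ?thesis using that by simp
  qed
  have "\<Gamma> \<inter> ball x r' = (\<Gamma> \<inter> ball x r) \<inter> ball x r'" using assms by auto
  also have "\<dots> = ({x} \<union> (\<Union>i<n. \<phi> i ` {0..<r})) \<inter> ball x r'"
    using assms(1) by (simp add: star_chart_def)
  also have "\<dots> = {x} \<union> (\<Union>i<n. \<phi> i ` {0..<r'})"
  proof (intro equalityI subsetI)
    fix y assume y: "y \<in> ({x} \<union> (\<Union>i<n. \<phi> i ` {0..<r})) \<inter> ball x r'"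
    show "y \<in> {x} \<union> (\<Union>i<n. \<phi> i ` {0..<r'})"
    proof (cases "y = x")
      case False
      then obtain i s where "i < n" "s \<in> {0..<r}" "y = \<phi> i s" using y by auto
      moreover from this have "s \<in> {0..<r'}" using d y by simp
      ultimately show ?thesis by blast
    qed simp
  next
    fix y assume y: "y \<in> {x} \<union> (\<Union>i<n. \<phi> i ` {0..<r'})"
    show "y \<in> ({x} \<union> (\<Union>i<n. \<phi> i ` {0..<r})) \<inter> ball x r'"
    proof (cases "y = x")
      case False
      then obtain i s where "i < n" "s \<in> {0..<r'}" "y = \<phi> i s" using y by auto
      moreover from this have "dist x y = s" "s \<in> {0..<r}" using d[of i s] assms(3) by auto
      moreover have "y \<in> (\<Union>i<n. \<phi> i ` {0..<r})" using calculation by blast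
      ultimately show ?thesis by simp
    qed (use assms in simp)
  qed
  finally show ?thesis using assms unfolding star_chart_def by auto
qed

context
  fixes \<Gamma> :: "'a::metric_space set" and x n r \<phi>
  assumes chart: "star_chart \<Gamma> x n r \<phi>"
begin

lemma star_chart_pos: "0 < r" and star_chart_origin: "i < n \<Longrightarrow> \<phi> i 0 = x"
  and star_chart_dist: "i < n \<Longrightarrow> j < n \<Longrightarrow> 0 \<le> s \<Longrightarrow> s < r \<Longrightarrow> 0 \<le> t \<Longrightarrow> t < r \<Longrightarrow>
    dist (\<phi> i s) (\<phi> j t) = (if i = j then \<bar>s - t\<bar> else s + t)"
  using chart by (auto simp: star_chart_def)

lemma star_chart_center_dist: "i < n \<Longrightarrow> 0 \<le> s \<Longrightarrow> s < r \<Longrightarrow> dist x (\<phi> i s) = s"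
  using star_chart_dist[of i i 0 s] star_chart_origin[of i] star_chart_pos by simp

lemma star_chart_ball: "\<Gamma> \<inter> ball x r = {x} \<union> (\<Union>i<n. \<phi> i ` {0..<r})"
  using chart unfolding star_chart_def by blast

lemma star_chart_in: "i < n \<Longrightarrow> 0 \<le> s \<Longrightarrow> s < r \<Longrightarrow> \<phi> i s \<in> \<Gamma>"
  using star_chart_ball by fastforce

lemma star_chart_arm:
  assumes "y \<in> \<Gamma>" "dist x y < r" "y \<noteq> x"
  shows "\<exists>i<n. y = \<phi> i (dist x y)"
proof -
  have "y \<in> {x} \<union> (\<Union>i<n. \<phi> i ` {0..<r})"
    using assms(1,2) unfolding star_chart_ball[symmetric] by simp
  then obtain i s where "i < n" "0 \<le> s" "s < r" "y = \<phi> i s" using assms(3) by auto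
  then show ?thesis using star_chart_center_dist by auto
qed

text \<open>A short step cannot change arms, since arms are joined only through the center; so the
  arm is locally constant along the curve. On one arm the distance to the center is an isometric
  coordinate, hence affine with slope 1 or -1, and being positive with limit 0 at the start it is
  the parameter itself.\<close>

lemma star_chart_arm_of_curve:
  assumes a: "0 < a" and cont: "continuous_on {0..<a} c" and c0: "c 0 = x"
    and img: "c ` {0..<a} \<subseteq> \<Gamma>" and inj: "inj_on c {0..<a}"
    and loc: "\<forall>t\<in>{0<..<a}. \<exists>\<delta>>0. \<forall>s\<in>{0<..<a}. \<forall>s'\<in>{0<..<a}.
      \<bar>s - t\<bar> < \<delta> \<longrightarrow> \<bar>s' - t\<bar> < \<delta> \<longrightarrow> dist (c s) (c s') = \<bar>s - s'\<bar>"
  obtains i \<delta> where "i < n" "0 < \<delta>" "\<delta> \<le> r" "\<delta> \<le> a" "\<And>s. 0 \<le> s \<Longrightarrow> s < \<delta> \<Longrightarrow> c s = \<phi> i s"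
proof -
  define \<tau> where "\<tau> s = dist x (c s)" for s
  have "\<exists>d>0. \<forall>s\<in>{0..<a}. dist s 0 < d \<longrightarrow> dist (c s) (c 0) < r"
    using cont[unfolded continuous_on_iff, rule_format, of 0 r] a star_chart_pos by auto
  then obtain d where d: "d > 0" "\<And>s. 0 \<le> s \<Longrightarrow> s < a \<Longrightarrow> s < d \<Longrightarrow> \<tau> s < r"
    by (auto simp: \<tau>_def dist_commute c0)
  define b where "b = min (min a d) r"
  have b: "0 < b" "b \<le> a" "b \<le> d" "b \<le> r" using a d star_chart_pos by (auto simp: b_def)
  have pos: "0 < \<tau> s" "\<tau> s < r" if "s \<in> {0<..<b}" for s
  proof -
    have "c s \<noteq> c 0" using inj_onD[OF inj, of s 0] that b by auto
    then show "0 < \<tau> s" by (simp add: \<tau>_def c0)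
    show "\<tau> s < r" using d that b by auto
  qed
  have "\<exists>i<n. c s = \<phi> i (\<tau> s)" if "s \<in> {0<..<b}" for s
    unfolding \<tau>_def using img that b pos[OF that] by (intro star_chart_arm) (auto simp: \<tau>_def)
  then obtain arm where arm: "\<And>s. s \<in> {0<..<b} \<Longrightarrow> arm s < n \<and> c s = \<phi> (arm s) (\<tau> s)" by metis
  define i where "i = arm (b / 2)"
  have arm_const: "arm s = arm t" if "s \<in> {0<..<b}" "t \<in> {0<..<b}" for s t
  proof (rule connected_local_const[of "{0<..<b}"])
    show "\<forall>t\<in>{0<..<b}. eventually (\<lambda>s. arm t = arm s) (at t within {0<..<b})"
    proof
      fix t assume t: "t \<in> {0<..<b}"
      then have "t \<in> {0<..<a}" using b by auto
      then obtain \<delta> where \<delta>: "\<delta> > 0" "\<forall>s\<in>{0<..<a}. \<forall>s'\<in>{0<..<a}.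
        \<bar>s - t\<bar> < \<delta> \<longrightarrow> \<bar>s' - t\<bar> < \<delta> \<longrightarrow> dist (c s) (c s') = \<bar>s - s'\<bar>" using loc by blast
      \<comment> \<open>Points on different arms have distance \<open>\<tau> t + \<tau> s\<close>,
        which exceeds the step size allowed here.\<close>
      have "arm t = arm s" if s: "s \<in> {0<..<b}" "\<bar>s - t\<bar> < min \<delta> (\<tau> t)" for s
      proof (rule ccontr)
        assume ne: "arm t \<noteq> arm s"
        have "dist (c t) (c s) = \<bar>t - s\<bar>" using \<delta> s t b by auto
        moreover have "dist (c t) (c s) = \<tau> t + \<tau> s"
          using arm[OF t] arm[OF s(1)] pos[OF t] pos[OF s(1)] star_chart_dist[of "arm t" "arm s" "\<tau> t" "\<tau> s"] ne
          by auto
        ultimately show False using s pos[OF s(1)] by auto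
      qed
      then show "eventually (\<lambda>s. arm t = arm s) (at t within {0<..<b})"
        using \<delta>(1) pos[OF t] unfolding eventually_at dist_real_def
        by (intro exI[of _ "min \<delta> (\<tau> t)"]) auto
    qed
  qed (use that in auto)
  have b2: "b / 2 \<in> {0<..<b}" using b by simp
  have i: "i < n" using arm[OF b2] by (simp add: i_def)
  have ic: "c s = \<phi> i (\<tau> s)" if "s \<in> {0<..<b}" for s
    using arm[OF that] arm_const[OF that b2] by (simp add: i_def)
  note i = i ic
  have iso: "dist (c s) (c s') = \<bar>\<tau> s - \<tau> s'\<bar>" if "s \<in> {0<..<b}" "s' \<in> {0<..<b}" for s s'
    using star_chart_dist[OF i(1) i(1), of "\<tau> s" "\<tau> s'"] pos[OF that(1)] pos[OF that(2)] i(2)[OF that(1)] i(2)[OF that(2)]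
    by auto
  have "inj_on \<tau> {0<..<b}"
  proof (rule inj_onI)
    fix s s' assume s: "s \<in> {0<..<b}" "s' \<in> {0<..<b}" "\<tau> s = \<tau> s'"
    then have "c s = c s'" using iso[of s s'] by simp
    then show "s = s'" using inj_onD[OF inj, of s s'] s b by auto
  qed
  moreover have "\<forall>t\<in>{0<..<b}. \<exists>\<delta>>0. \<forall>s\<in>{0<..<b}. \<forall>s'\<in>{0<..<b}.
      \<bar>s - t\<bar> < \<delta> \<longrightarrow> \<bar>s' - t\<bar> < \<delta> \<longrightarrow> \<bar>\<tau> s - \<tau> s'\<bar> = \<bar>s - s'\<bar>"
  proof
    fix t assume "t \<in> {0<..<b}"
    then have "t \<in> {0<..<a}" using b by auto
    then obtain \<delta> where \<delta>: "\<delta> > 0" "\<forall>s\<in>{0<..<a}. \<forall>s'\<in>{0<..<a}.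
      \<bar>s - t\<bar> < \<delta> \<longrightarrow> \<bar>s' - t\<bar> < \<delta> \<longrightarrow> dist (c s) (c s') = \<bar>s - s'\<bar>" using loc by blast
    show "\<exists>\<delta>>0. \<forall>s\<in>{0<..<b}. \<forall>s'\<in>{0<..<b}.
      \<bar>s - t\<bar> < \<delta> \<longrightarrow> \<bar>s' - t\<bar> < \<delta> \<longrightarrow> \<bar>\<tau> s - \<tau> s'\<bar> = \<bar>s - s'\<bar>"
    proof (intro exI[of _ \<delta>] conjI ballI impI \<delta>(1))
      fix s s' assume s: "s \<in> {0<..<b}" "s' \<in> {0<..<b}" "\<bar>s - t\<bar> < \<delta>" "\<bar>s' - t\<bar> < \<delta>"
      then have "s \<in> {0<..<a}" "s' \<in> {0<..<a}" using b by auto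
      then show "\<bar>\<tau> s - \<tau> s'\<bar> = \<bar>s - s'\<bar>" using iso[OF s(1,2)] \<delta>(2) s(3,4) by simp
    qed
  qed
  ultimately obtain \<sigma> c1 where \<sigma>: "\<sigma> = 1 \<or> \<sigma> = -1" "\<And>s. s \<in> {0<..<b} \<Longrightarrow> \<tau> s = c1 + \<sigma> * s"
    using local_isometry_imp_affine by blast
  \<comment> \<open>The isometry is known only away from the starting point, so the constant
    \<open>c1\<close> is identified by continuity there.\<close>
  have "((\<lambda>s. c1 + \<sigma> * s) \<longlongrightarrow> 0) (at_right 0)"
  proof (rule Lim_transform_eventually)
    have "(c \<longlongrightarrow> c 0) (at 0 within {0..<a})" using cont a by (auto simp: continuous_on_def)
    then have "(c \<longlongrightarrow> c 0) (at 0 within {0<..<b})"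
      by (rule tendsto_within_subset) (use b in auto)
    then have "(c \<longlongrightarrow> x) (at 0 within {0<..<b})" by (simp only: c0)
    then have "(\<tau> \<longlongrightarrow> dist x x) (at 0 within {0<..<b})"
      unfolding \<tau>_def by (intro tendsto_intros)
    moreover have "at 0 within {0<..<b} = at_right 0"
      using b by (rule_tac at_within_nhd[of _ "{..<b}"]) auto
    ultimately show "(\<tau> \<longlongrightarrow> 0) (at_right 0)" by simp
    show "\<forall>\<^sub>F s in at_right 0. \<tau> s = c1 + \<sigma> * s"
      using b \<sigma>(2) unfolding eventually_at_right_field by (intro exI[of _ b]) auto
  qed
  moreover have "((\<lambda>s. c1 + \<sigma> * s) \<longlongrightarrow> c1 + \<sigma> * 0) (at_right 0)"
    by (intro tendsto_intros)
  ultimately have "c1 = 0" using tendsto_unique[OF trivial_limit_at_right_real] by fastforce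
  then have "\<tau> s = s" if "s \<in> {0<..<b}" for s
    using \<sigma>(1) \<sigma>(2)[OF that] pos[OF that] that by auto
  then have "c s = \<phi> i s" if "0 \<le> s" "s < b" for s
    using i that c0 star_chart_origin[OF i(1)] by (cases "s = 0") auto
  then show thesis using that i(1) b by blast
qed

end

section \<open>Directions at the points of a metric graph with a model\<close>

locale metric_model =
  fixes \<Gamma> V :: "'a::metric_space set" and l :: "'a set \<Rightarrow> real" and \<gamma> :: "'a set \<Rightarrow> real \<Rightarrow> 'a"
  assumes graph: "metric_graph \<Gamma>" and model: "model \<Gamma> V l \<gamma>" and loopless: "loopless \<Gamma> V l \<gamma>"
begin

abbreviation "E \<equiv> edges \<Gamma> V"

lemma finite_V: "finite V" and V_subset: "V \<subseteq> \<Gamma>"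
  using model by (auto simp: model_def)

lemma edge_param: "e \<in> E \<Longrightarrow> edge_param V e (l e) (\<gamma> e)"
  using model by (auto simp: model_def)

lemma edge_length: "e \<in> E \<Longrightarrow> 0 < l e"
  and edge_continuous: "e \<in> E \<Longrightarrow> continuous_on {0..l e} (\<gamma> e)"
  and edge_ends: "e \<in> E \<Longrightarrow> \<gamma> e 0 \<in> V" "e \<in> E \<Longrightarrow> \<gamma> e (l e) \<in> V"
  and edge_homeomorphism: "e \<in> E \<Longrightarrow> \<exists>h. homeomorphism {0<..<l e} e (\<gamma> e) h"
  and edge_isometry: "e \<in> E \<Longrightarrow> \<forall>t\<in>{0<..<l e}. \<exists>\<delta>>0. \<forall>s\<in>{0<..<l e}. \<forall>s'\<in>{0<..<l e}.
        \<bar>s - t\<bar> < \<delta> \<longrightarrow> \<bar>s' - t\<bar> < \<delta> \<longrightarrow> dist (\<gamma> e s) (\<gamma> e s') = \<bar>s - s'\<bar>"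
  using edge_param[of e] unfolding edge_param_def by blast+

lemma edge_image: "e \<in> E \<Longrightarrow> \<gamma> e ` {0<..<l e} = e" and edge_inj: "e \<in> E \<Longrightarrow> inj_on (\<gamma> e) {0<..<l e}"
  using edge_homeomorphism[of e] unfolding homeomorphism_def
  by (auto intro: inj_on_inverseI)

lemma edge_subset: "e \<in> E \<Longrightarrow> e \<subseteq> \<Gamma> - V"
  by (rule in_components_subset)

lemma edge_point:
  assumes "e \<in> E" "0 < t" "t < l e"
  shows "\<gamma> e t \<in> e" "\<gamma> e t \<in> \<Gamma>" "\<gamma> e t \<notin> V"
  using edge_image[OF assms(1)] edge_subset[OF assms(1)] assms(2,3) by auto

lemma edge_in: "e \<in> E \<Longrightarrow> 0 \<le> t \<Longrightarrow> t \<le> l e \<Longrightarrow> \<gamma> e t \<in> \<Gamma>"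
  using edge_point(2)[of e t] edge_ends[of e] V_subset by (cases "t = 0 \<or> t = l e") auto

lemma edge_point_unique:
  assumes "e \<in> E" "e' \<in> E" "0 < t" "t < l e" "0 < t'" "t' < l e'" "\<gamma> e t = \<gamma> e' t'"
  shows "e = e'" "t = t'"
proof -
  show "e = e'"
    using edge_point(1)[OF assms(1,3,4)] edge_point(1)[OF assms(2,5,6)] assms(7)
      components_nonoverlap[OF assms(1,2)] by auto
  then show "t = t'" using inj_onD[OF edge_inj[OF assms(1)], of t t'] assms by auto
qed

lemma edge_inj_endpoint:
  assumes e: "e \<in> E" and t: "0 \<le> t" "t \<le> l e"
  shows "inj_on (\<gamma> e) (insert t {0<..<l e})"
proof (cases "t \<in> {0<..<l e}")
  case True
  then show ?thesis using edge_inj[OF e] by (simp add: insert_absorb)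
next
  case False
  then have "t = 0 \<or> t = l e" using t by auto
  then have "\<gamma> e t \<in> V" using edge_ends[OF e] by auto
  then have "\<gamma> e t \<notin> \<gamma> e ` {0<..<l e}" using edge_point(3)[OF e] by fastforce
  then show ?thesis using edge_inj[OF e] by auto
qed

lemma point_cases:
  assumes "x \<in> \<Gamma>"
  obtains "x \<in> V" | e t where "e \<in> E" "0 < t" "t < l e" "x = \<gamma> e t"
proof (cases "x \<in> V")
  case False
  then have "x \<in> \<Union>E" using assms by (simp add: Union_components[symmetric])
  then obtain e where e: "e \<in> E" "x \<in> e" by (rule UnionE)
  then have "x \<in> \<gamma> e ` {0<..<l e}" using edge_image[OF e(1)] by simp
  then show ?thesis using that(2)[OF e(1)] by auto
qed

text \<open>The direction \<open>(e, t, \<sigma>)\<close> points from \<open>\<gamma> e t\<close> along \<open>e\<close>, with (\<open>\<sigma> = 1\<close>) or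
  against (\<open>\<sigma> = -1\<close>) the orientation. Vertices and inner points of edges are treated alike.\<close>

definition dirs :: "'a \<Rightarrow> ('a set \<times> real \<times> real) set" where
  "dirs x = {(e, t, \<sigma>). e \<in> E \<and> \<gamma> e t = x \<and>
     (\<sigma> = 1 \<and> 0 \<le> t \<and> t < l e \<or> \<sigma> = -1 \<and> 0 < t \<and> t \<le> l e)}"

fun ray :: "'a set \<times> real \<times> real \<Rightarrow> real \<Rightarrow> 'a" where
  "ray (e, t, \<sigma>) s = \<gamma> e (t + \<sigma> * s)"

lemma arm_of_dir:
  assumes x: "star_chart \<Gamma> x n r \<phi>" and d: "d \<in> dirs x"
  obtains i \<delta> where "i < n" "0 < \<delta>" "\<And>s. 0 \<le> s \<Longrightarrow> s < \<delta> \<Longrightarrow> ray d s = \<phi> i s"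
proof -
  obtain e t \<sigma> where d': "d = (e, t, \<sigma>)" by (cases d)
  have e: "e \<in> E" and \<gamma>t: "\<gamma> e t = x" and t: "0 \<le> t" "t \<le> l e"
    and \<sigma>: "\<sigma> = 1 \<and> t < l e \<or> \<sigma> = -1 \<and> 0 < t"
    using d by (auto simp: dirs_def d')
  \<comment> \<open>The distance along \<open>e\<close> from the base point to the end that the
    direction faces.\<close>
  define a where "a = (if \<sigma> = 1 then l e - t else t)"
  have a: "0 < a" using \<sigma> by (auto simp: a_def)
  have mem: "t + \<sigma> * s \<in> {0<..<l e}" if "s \<in> {0<..<a}" for s
    using that \<sigma> t by (auto simp: a_def split: if_splits)
  have mem0: "t + \<sigma> * s \<in> {0..l e}" if "s \<in> {0..<a}" for s
    using that \<sigma> t by (auto simp: a_def split: if_splits)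
  have cont: "continuous_on {0..<a} (\<lambda>s. \<gamma> e (t + \<sigma> * s))"
    by (rule continuous_on_compose2[OF edge_continuous[OF e]]) (use mem0 in \<open>auto intro!: continuous_intros\<close>)
  have img: "(\<lambda>s. \<gamma> e (t + \<sigma> * s)) ` {0..<a} \<subseteq> \<Gamma>"
    using mem0 edge_in[OF e] by auto
  have inj: "inj_on (\<lambda>s. \<gamma> e (t + \<sigma> * s)) {0..<a}"
  proof (rule inj_onI)
    fix s s' assume s: "s \<in> {0..<a}" "s' \<in> {0..<a}" "\<gamma> e (t + \<sigma> * s) = \<gamma> e (t + \<sigma> * s')"
    have "t + \<sigma> * s \<in> insert t {0<..<l e}" if "s \<in> {0..<a}" for s
      using mem[of s] that by (cases "s = 0") auto
    then have "t + \<sigma> * s = t + \<sigma> * s'"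
      using inj_onD[OF edge_inj_endpoint[OF e t] s(3)] s by auto
    then show "s = s'" using \<sigma> by auto
  qed
  have loc: "\<forall>t'\<in>{0<..<a}. \<exists>\<delta>>0. \<forall>s\<in>{0<..<a}. \<forall>s'\<in>{0<..<a}.
      \<bar>s - t'\<bar> < \<delta> \<longrightarrow> \<bar>s' - t'\<bar> < \<delta> \<longrightarrow> dist (\<gamma> e (t + \<sigma> * s)) (\<gamma> e (t + \<sigma> * s')) = \<bar>s - s'\<bar>"
  proof
    fix t' assume t': "t' \<in> {0<..<a}"
    obtain \<delta> where \<delta>: "\<delta> > 0" "\<forall>s\<in>{0<..<l e}. \<forall>s'\<in>{0<..<l e}.
        \<bar>s - (t + \<sigma> * t')\<bar> < \<delta> \<longrightarrow> \<bar>s' - (t + \<sigma> * t')\<bar> < \<delta> \<longrightarrow> dist (\<gamma> e s) (\<gamma> e s') = \<bar>s - s'\<bar>"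
      using edge_isometry[OF e] mem[OF t'] by blast
    have \<sigma>': "\<bar>\<sigma> * u\<bar> = \<bar>u\<bar>" for u using \<sigma> by auto
    have diff: "(t + \<sigma> * u) - (t + \<sigma> * w) = \<sigma> * (u - w)" for u w by (simp add: algebra_simps)
    show "\<exists>\<delta>>0. \<forall>s\<in>{0<..<a}. \<forall>s'\<in>{0<..<a}.
      \<bar>s - t'\<bar> < \<delta> \<longrightarrow> \<bar>s' - t'\<bar> < \<delta> \<longrightarrow> dist (\<gamma> e (t + \<sigma> * s)) (\<gamma> e (t + \<sigma> * s')) = \<bar>s - s'\<bar>"
    proof (intro exI[of _ \<delta>] conjI ballI impI \<delta>(1))
      fix s s' assume s: "s \<in> {0<..<a}" "s' \<in> {0<..<a}" "\<bar>s - t'\<bar> < \<delta>" "\<bar>s' - t'\<bar> < \<delta>"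
      have abs: "\<bar>(t + \<sigma> * u) - (t + \<sigma> * w)\<bar> = \<bar>u - w\<bar>" for u w by (simp only: diff \<sigma>')
      show "dist (\<gamma> e (t + \<sigma> * s)) (\<gamma> e (t + \<sigma> * s')) = \<bar>s - s'\<bar>"
        using \<delta>(2)[rule_format, OF mem[OF s(1)] mem[OF s(2)]] s(3,4) unfolding abs by blast
    qed
  qed
  have orig: "\<gamma> e (t + \<sigma> * 0) = x" using \<gamma>t by simp
  show thesis
  proof (rule star_chart_arm_of_curve[OF x a cont orig img inj loc])
    fix i \<delta> assume "i < n" "0 < \<delta>" "\<And>s. 0 \<le> s \<Longrightarrow> s < \<delta> \<Longrightarrow> \<gamma> e (t + \<sigma> * s) = \<phi> i s"
    then show thesis using that by (simp add: d')
  qed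
qed

text \<open>Close to \<open>x\<close> an arm meets no vertex other than \<open>x\<close>, so its
  punctured part, being connected, stays inside one edge. In the coordinate of that edge it is
  affine, and the limit \<open>c\<close> of the coordinate is the position of \<open>x\<close>,
  possibly an end of the edge.\<close>

lemma dir_of_arm:
  assumes x: "star_chart \<Gamma> x n r \<phi>" and i: "i < n"
  obtains d \<delta> where "d \<in> dirs x" "0 < \<delta>" "\<And>s. 0 \<le> s \<Longrightarrow> s < \<delta> \<Longrightarrow> \<phi> i s = ray d s"
proof -
  note r = star_chart_pos[OF x] and d0 = star_chart_center_dist[OF x i]
  obtain d where d: "0 < d" "\<forall>v\<in>V. v \<noteq> x \<longrightarrow> d \<le> dist x v"
    using finite_set_avoid[OF finite_V] by blast
  define b where "b = min r d"
  have b: "0 < b" "b \<le> r" "b \<le> d" using r d by (auto simp: b_def)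
  have iso: "dist (\<phi> i s) (\<phi> i s') = \<bar>s - s'\<bar>" if "s \<in> {0<..<b}" "s' \<in> {0<..<b}" for s s'
    using star_chart_dist[OF x i i, of s s'] that b by auto
  have cont: "continuous_on {0<..<b} (\<phi> i)"
    unfolding continuous_on_iff using iso by (auto simp: dist_real_def)
  have sub: "\<phi> i ` {0<..<b} \<subseteq> \<Gamma> - V"
  proof
    fix y assume "y \<in> \<phi> i ` {0<..<b}"
    then obtain s where s: "s \<in> {0<..<b}" "y = \<phi> i s" by auto
    then have "dist x y = s" using d0[of s] b by auto
    then have "y \<notin> V" using d s b by force
    then show "y \<in> \<Gamma> - V" using star_chart_in[OF x i, of s] s b by auto
  qed
  have b2: "b / 2 \<in> {0<..<b}" using b by auto
  then have "\<phi> i (b / 2) \<in> \<Union>E" using sub by (simp add: Union_components[symmetric] image_subset_iff)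
  then obtain e where e: "e \<in> E" "\<phi> i (b / 2) \<in> e" by (rule UnionE)
  have "connected (\<phi> i ` {0<..<b})" by (intro connected_continuous_image cont) auto
  then have sub_e: "\<phi> i ` {0<..<b} \<subseteq> e"
    using components_maximal[OF e(1) _ sub] e(2) b2 by blast
  obtain h where h: "homeomorphism {0<..<l e} e (\<gamma> e) h" using edge_homeomorphism[OF e(1)] by blast
  define \<tau> where "\<tau> s = h (\<phi> i s)" for s
  have \<tau>: "\<tau> s \<in> {0<..<l e}" "\<gamma> e (\<tau> s) = \<phi> i s" if "s \<in> {0<..<b}" for s
  proof -
    have "\<phi> i s \<in> e" using sub_e that by blast
    then show "\<tau> s \<in> {0<..<l e}" "\<gamma> e (\<tau> s) = \<phi> i s"
      using h by (auto simp: homeomorphism_def \<tau>_def)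
  qed
  have \<tau>_cont: "continuous_on {0<..<b} \<tau>"
    unfolding \<tau>_def
    by (rule continuous_on_compose2[OF _ cont sub_e]) (use h in \<open>simp add: homeomorphism_def\<close>)
  have "inj_on \<tau> {0<..<b}"
  proof (rule inj_onI)
    fix s s' assume s: "s \<in> {0<..<b}" "s' \<in> {0<..<b}" "\<tau> s = \<tau> s'"
    then have "\<phi> i s = \<phi> i s'" using \<tau>(2) by metis
    then show "s = s'" using iso[OF s(1,2)] by simp
  qed
  moreover have "\<forall>t\<in>{0<..<b}. \<exists>\<delta>>0. \<forall>s\<in>{0<..<b}. \<forall>s'\<in>{0<..<b}.
      \<bar>s - t\<bar> < \<delta> \<longrightarrow> \<bar>s' - t\<bar> < \<delta> \<longrightarrow> \<bar>\<tau> s - \<tau> s'\<bar> = \<bar>s - s'\<bar>"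
  proof
    fix t assume t: "t \<in> {0<..<b}"
    obtain \<delta> where \<delta>: "\<delta> > 0" "\<forall>s\<in>{0<..<l e}. \<forall>s'\<in>{0<..<l e}.
      \<bar>s - \<tau> t\<bar> < \<delta> \<longrightarrow> \<bar>s' - \<tau> t\<bar> < \<delta> \<longrightarrow> dist (\<gamma> e s) (\<gamma> e s') = \<bar>s - s'\<bar>"
      using edge_isometry[OF e(1)] \<tau>(1)[OF t] by blast
    obtain \<epsilon> where \<epsilon>: "\<epsilon> > 0" "\<And>s. s \<in> {0<..<b} \<Longrightarrow> \<bar>s - t\<bar> < \<epsilon> \<Longrightarrow> \<bar>\<tau> s - \<tau> t\<bar> < \<delta>"
      using \<tau>_cont[unfolded continuous_on_iff dist_real_def, rule_format, OF t \<delta>(1)] by blast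
    show "\<exists>\<delta>>0. \<forall>s\<in>{0<..<b}. \<forall>s'\<in>{0<..<b}.
      \<bar>s - t\<bar> < \<delta> \<longrightarrow> \<bar>s' - t\<bar> < \<delta> \<longrightarrow> \<bar>\<tau> s - \<tau> s'\<bar> = \<bar>s - s'\<bar>"
    proof (intro exI[of _ \<epsilon>] conjI ballI impI \<epsilon>(1))
      fix s s' assume s: "s \<in> {0<..<b}" "s' \<in> {0<..<b}" "\<bar>s - t\<bar> < \<epsilon>" "\<bar>s' - t\<bar> < \<epsilon>"
      have "dist (\<gamma> e (\<tau> s)) (\<gamma> e (\<tau> s')) = \<bar>\<tau> s - \<tau> s'\<bar>"
        using \<delta>(2) \<tau>(1)[OF s(1)] \<tau>(1)[OF s(2)] \<epsilon>(2)[OF s(1,3)] \<epsilon>(2)[OF s(2,4)] by blast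
      then show "\<bar>\<tau> s - \<tau> s'\<bar> = \<bar>s - s'\<bar>" using iso[OF s(1,2)] \<tau>(2)[OF s(1)] \<tau>(2)[OF s(2)] by simp
    qed
  qed
  ultimately obtain \<sigma> c where \<sigma>: "\<sigma> = 1 \<or> \<sigma> = -1" and c: "\<And>s. s \<in> {0<..<b} \<Longrightarrow> \<tau> s = c + \<sigma> * s"
    using local_isometry_imp_affine by blast
  have in_int: "c + \<sigma> * s \<in> {0<..<l e}" if "s \<in> {0<..<b}" for s
    using \<tau>(1)[OF that] c[OF that] by simp
  have c_ge: "0 \<le> c"
  proof (rule ccontr)
    assume "\<not> 0 \<le> c"
    define s where "s = min (b / 2) (- c)"
    have s: "s \<in> {0<..<b}" "s \<le> - c" using b \<open>\<not> 0 \<le> c\<close> by (auto simp: s_def)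
    then show False using in_int[OF s(1)] \<sigma> by auto
  qed
  have c_le: "c \<le> l e"
  proof (rule ccontr)
    assume "\<not> c \<le> l e"
    define s where "s = min (b / 2) (c - l e)"
    have s: "s \<in> {0<..<b}" "s \<le> c - l e" using b \<open>\<not> c \<le> l e\<close> by (auto simp: s_def)
    then show False using in_int[OF s(1)] \<sigma> by auto
  qed
  \<comment> \<open>The inverse \<open>h\<close> lives on the open edge only, so the starting point
    is compared through the continuity of \<open>\<gamma> e\<close> on the closed interval.\<close>
  have "\<gamma> e c = x"
  proof (rule ccontr)
    assume "\<gamma> e c \<noteq> x"
    define \<epsilon> where "\<epsilon> = dist (\<gamma> e c) x / 2"
    have \<epsilon>: "0 < \<epsilon>" using \<open>\<gamma> e c \<noteq> x\<close> by (simp add: \<epsilon>_def)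
    obtain d where d: "d > 0" "\<And>t. t \<in> {0..l e} \<Longrightarrow> \<bar>t - c\<bar> < d \<Longrightarrow> dist (\<gamma> e t) (\<gamma> e c) < \<epsilon>"
      using edge_continuous[OF e(1), unfolded continuous_on_iff dist_real_def, rule_format, of c \<epsilon>] \<epsilon> c_ge c_le
      by auto
    define s where "s = min (min b d) \<epsilon> / 2"
    have s: "s \<in> {0<..<b}" "s < d" "s < \<epsilon>" using b \<open>d > 0\<close> \<epsilon> by (auto simp: s_def)
    have "dist (\<gamma> e (c + \<sigma> * s)) (\<gamma> e c) < \<epsilon>"
      using in_int[OF s(1)] s \<sigma> by (intro d) auto
    moreover have "dist (\<gamma> e (c + \<sigma> * s)) x < \<epsilon>"
      using \<tau>(2)[OF s(1)] c[OF s(1)] d0[of s] s b by (simp add: dist_commute)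
    ultimately show False
      using dist_triangle[of "\<gamma> e c" x "\<gamma> e (c + \<sigma> * s)"] by (simp add: \<epsilon>_def dist_commute)
  qed
  have "(e, c, \<sigma>) \<in> dirs x"
    using e(1) \<open>\<gamma> e c = x\<close> c_ge c_le \<sigma> in_int[OF b2] b by (auto simp: dirs_def)
  moreover have "\<phi> i s = ray (e, c, \<sigma>) s" if "0 \<le> s" "s < b" for s
  proof (cases "s = 0")
    case True
    then show ?thesis using star_chart_origin[OF x i] \<open>\<gamma> e c = x\<close> by simp
  next
    case False
    then have "s \<in> {0<..<b}" using that by auto
    then show ?thesis using \<tau>(2)[of s] c[of s] by simp
  qed
  ultimately show thesis using that b(1) by blast
qed

text \<open>For small positive parameters both rays run inside edges, where coordinates are unique;
  two parameters then determine base point and sign.\<close>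

lemma dir_unique:
  assumes d: "d \<in> dirs x" and d': "d' \<in> dirs x'"
    and \<delta>: "0 < \<delta>" and eq: "\<And>s. 0 \<le> s \<Longrightarrow> s < \<delta> \<Longrightarrow> ray d s = ray d' s"
  shows "d = d'"
proof -
  obtain e t \<sigma> e' t' \<sigma>' where dd: "d = (e, t, \<sigma>)" "d' = (e', t', \<sigma>')" by (cases d, cases d')
  have e: "e \<in> E" "\<sigma> = 1 \<and> 0 \<le> t \<and> t < l e \<or> \<sigma> = -1 \<and> 0 < t \<and> t \<le> l e"
    and e': "e' \<in> E" "\<sigma>' = 1 \<and> 0 \<le> t' \<and> t' < l e' \<or> \<sigma>' = -1 \<and> 0 < t' \<and> t' \<le> l e'"
    using d d' by (auto simp: dirs_def dd)
  define a where "a = (if \<sigma> = 1 then l e - t else t)"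
  define a' where "a' = (if \<sigma>' = 1 then l e' - t' else t')"
  define b where "b = min \<delta> (min a a')"
  have b: "0 < b" "b \<le> \<delta>" using e e' \<delta> by (auto simp: b_def a_def a'_def)
  have "e = e' \<and> t + \<sigma> * s = t' + \<sigma>' * s" if s: "0 < s" "s < b" for s
  proof -
    have "0 < t + \<sigma> * s" "t + \<sigma> * s < l e" "0 < t' + \<sigma>' * s" "t' + \<sigma>' * s < l e'"
      using s e e' by (auto simp: b_def a_def a'_def split: if_splits)
    moreover have "\<gamma> e (t + \<sigma> * s) = \<gamma> e' (t' + \<sigma>' * s)" using eq[of s] s b by (simp add: dd)
    ultimately show ?thesis using edge_point_unique[OF e(1) e'(1)] by blast
  qed
  from this[of "b / 2"] this[of "b / 3"] b
  have *: "e = e'" "t + \<sigma> * (b / 2) = t' + \<sigma>' * (b / 2)" "t + \<sigma> * (b / 3) = t' + \<sigma>' * (b / 3)" by auto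
  then have "\<sigma> = \<sigma>'" using b e(2) e'(2) by auto
  then show ?thesis using * by (simp add: dd)
qed

text \<open>The arms of every chart at \<open>x\<close> are indexed by the same set
  \<open>dirs x\<close>, which depends only on the model. This makes the \<open>THE\<close> in
  \<open>val\<close> and \<open>ord_at\<close> well defined and both quantities computable edge by
  edge.\<close>

lemma chart_dirs:
  assumes x: "star_chart \<Gamma> x n r \<phi>"
  obtains \<beta> where "bij_betw \<beta> {..<n} (dirs x)"
    "\<And>i. i < n \<Longrightarrow> \<exists>\<delta>>0. \<forall>s. 0 \<le> s \<longrightarrow> s < \<delta> \<longrightarrow> \<phi> i s = ray (\<beta> i) s"
proof -
  have "\<forall>i. \<exists>d. i < n \<longrightarrow> d \<in> dirs x \<and> (\<exists>\<delta>>0. \<forall>s. 0 \<le> s \<longrightarrow> s < \<delta> \<longrightarrow> \<phi> i s = ray d s)"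
    using dir_of_arm[OF x] by metis
  then obtain \<beta> where \<beta>: "\<And>i. i < n \<Longrightarrow> \<beta> i \<in> dirs x"
    "\<And>i. i < n \<Longrightarrow> \<exists>\<delta>>0. \<forall>s. 0 \<le> s \<longrightarrow> s < \<delta> \<longrightarrow> \<phi> i s = ray (\<beta> i) s" by metis
  have "inj_on \<beta> {..<n}"
  proof (rule inj_onI, rule ccontr)
    fix i j assume ij: "i \<in> {..<n}" "j \<in> {..<n}" "\<beta> i = \<beta> j" "i \<noteq> j"
    obtain \<delta> \<delta>' where \<delta>: "\<delta> > 0" "\<forall>s. 0 \<le> s \<longrightarrow> s < \<delta> \<longrightarrow> \<phi> i s = ray (\<beta> i) s"
      "\<delta>' > 0" "\<forall>s. 0 \<le> s \<longrightarrow> s < \<delta>' \<longrightarrow> \<phi> j s = ray (\<beta> j) s" using \<beta>(2) ij by (metis lessThan_iff)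
    define s where "s = min r (min \<delta> \<delta>') / 2"
    have s: "0 < s" "s < r" "s < \<delta>" "s < \<delta>'" using \<delta> star_chart_pos[OF x] by (auto simp: s_def)
    have "\<phi> i s = \<phi> j s" using \<delta> s ij by simp
    moreover have "dist (\<phi> i s) (\<phi> j s) = s + s" using star_chart_dist[OF x, of i j s s] ij s by simp
    ultimately show False using s by simp
  qed
  moreover have "d \<in> \<beta> ` {..<n}" if d: "d \<in> dirs x" for d
  proof -
    obtain i \<delta> where i: "i < n" "0 < \<delta>" "\<And>s. 0 \<le> s \<Longrightarrow> s < \<delta> \<Longrightarrow> ray d s = \<phi> i s"
      using arm_of_dir[OF x d] by blast
    obtain \<delta>' where \<delta>': "\<delta>' > 0" "\<forall>s. 0 \<le> s \<longrightarrow> s < \<delta>' \<longrightarrow> \<phi> i s = ray (\<beta> i) s" using \<beta>(2)[OF i(1)] by blast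
    have "d = \<beta> i"
      by (rule dir_unique[OF d \<beta>(1)[OF i(1)], of "min \<delta> \<delta>'"]) (use i \<delta>' in auto)
    then show ?thesis using i by auto
  qed
  ultimately have "bij_betw \<beta> {..<n} (dirs x)" using \<beta>(1) by (auto simp: bij_betw_def)
  then show thesis using that \<beta>(2) by blast
qed

lemma chart_exists: "x \<in> \<Gamma> \<Longrightarrow> \<exists>n r \<phi>. star_chart \<Gamma> x n r \<phi>"
  using graph by (auto simp: metric_graph_def)

lemma finite_dirs: "x \<in> \<Gamma> \<Longrightarrow> finite (dirs x)"
  using chart_exists chart_dirs by (metis bij_betw_finite finite_lessThan)

lemma chart_arms: "star_chart \<Gamma> x n r \<phi> \<Longrightarrow> n = card (dirs x)"
  using chart_dirs by (metis bij_betw_same_card card_lessThan)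

lemma val_eq: "x \<in> \<Gamma> \<Longrightarrow> val \<Gamma> x = card (dirs x)"
  unfolding val_def using chart_exists chart_arms by (intro the_equality) metis+

section \<open>Slopes along directions and the order of a function\<close>

definition slope :: "('a \<Rightarrow> real) \<Rightarrow> 'a set \<times> real \<times> real \<Rightarrow> real \<Rightarrow> bool" where
  "slope f d q \<longleftrightarrow> (\<exists>\<delta>>0. \<forall>s. 0 \<le> s \<longrightarrow> s < \<delta> \<longrightarrow> f (ray d s) = f (ray d 0) + q * s)"

lemma slope_unique:
  assumes "slope f d q" "slope f d q'"
  shows "q = q'"
proof -
  obtain \<delta> \<delta>' where \<delta>: "\<delta> > 0" "\<forall>s. 0 \<le> s \<longrightarrow> s < \<delta> \<longrightarrow> f (ray d s) = f (ray d 0) + q * s"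
    "\<delta>' > 0" "\<forall>s. 0 \<le> s \<longrightarrow> s < \<delta>' \<longrightarrow> f (ray d s) = f (ray d 0) + q' * s"
    using assms unfolding slope_def by blast
  define s where "s = min \<delta> \<delta>' / 2"
  have "0 < s" "s < \<delta>" "s < \<delta>'" using \<delta>(1,3) by (auto simp: s_def)
  then have "q * s = q' * s" using \<delta>(2)[rule_format, of s] \<delta>(4)[rule_format, of s] by simp
  then show ?thesis using \<open>0 < s\<close> by simp
qed

lemma ray_0: "d \<in> dirs x \<Longrightarrow> ray d 0 = x"
  by (auto simp: dirs_def)

lemma slopes_of_outgoing:
  assumes "outgoing_slopes \<Gamma> f x n m"
  obtains \<beta> where "bij_betw \<beta> {..<n} (dirs x)" "\<And>i. i < n \<Longrightarrow> slope f (\<beta> i) (of_int (m i))"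
proof -
  obtain r \<phi> where x: "star_chart \<Gamma> x n r \<phi>"
    and f: "\<forall>i<n. \<forall>t\<in>{0..<r}. f (\<phi> i t) = f x + of_int (m i) * t"
    using assms by (auto simp: outgoing_slopes_def)
  obtain \<beta> where \<beta>: "bij_betw \<beta> {..<n} (dirs x)"
    "\<And>i. i < n \<Longrightarrow> \<exists>\<delta>>0. \<forall>s. 0 \<le> s \<longrightarrow> s < \<delta> \<longrightarrow> \<phi> i s = ray (\<beta> i) s"
    using chart_dirs[OF x] by blast
  have "slope f (\<beta> i) (of_int (m i))" if i: "i < n" for i
  proof -
    obtain \<delta> where \<delta>: "\<delta> > 0" "\<forall>s. 0 \<le> s \<longrightarrow> s < \<delta> \<longrightarrow> \<phi> i s = ray (\<beta> i) s" using \<beta>(2)[OF i] by blast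
    have "\<beta> i \<in> dirs x" using \<beta>(1) i by (auto simp: bij_betw_def)
    note a0 = ray_0[OF this]
    have "f (ray (\<beta> i) s) = f (ray (\<beta> i) 0) + of_int (m i) * s" if "0 \<le> s" "s < min \<delta> r" for s
      using f i that \<delta>(2) a0 by (metis atLeastLessThan_iff min_less_iff_conj)
    moreover have "0 < min \<delta> r" using \<delta> star_chart_pos[OF x] by simp
    ultimately show ?thesis unfolding slope_def by blast
  qed
  then show thesis using that \<beta>(1) by blast
qed

lemma outgoing_of_slopes:
  assumes x: "x \<in> \<Gamma>" and q: "\<And>d. d \<in> dirs x \<Longrightarrow> slope f d (of_int (q d))"
  shows "\<exists>n m. outgoing_slopes \<Gamma> f x n m"
proof -
  obtain n r \<phi> where ch: "star_chart \<Gamma> x n r \<phi>" using chart_exists[OF x] by blast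
  obtain \<beta> where \<beta>: "bij_betw \<beta> {..<n} (dirs x)"
    "\<And>i. i < n \<Longrightarrow> \<exists>\<delta>>0. \<forall>s. 0 \<le> s \<longrightarrow> s < \<delta> \<longrightarrow> \<phi> i s = ray (\<beta> i) s"
    using chart_dirs[OF ch] by blast
  have "\<exists>\<delta>>0. \<forall>s. 0 \<le> s \<longrightarrow> s < \<delta> \<longrightarrow> f (\<phi> i s) = f x + of_int (q (\<beta> i)) * s" if i: "i < n" for i
  proof -
    have d: "\<beta> i \<in> dirs x" using \<beta>(1) i by (auto simp: bij_betw_def)
    obtain \<delta> where \<delta>: "\<delta> > 0" "\<forall>s. 0 \<le> s \<longrightarrow> s < \<delta> \<longrightarrow> \<phi> i s = ray (\<beta> i) s" using \<beta>(2)[OF i] by blast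
    obtain \<delta>' where \<delta>': "\<delta>' > 0" "\<forall>s. 0 \<le> s \<longrightarrow> s < \<delta>' \<longrightarrow> f (ray (\<beta> i) s) = f (ray (\<beta> i) 0) + of_int (q (\<beta> i)) * s"
      using q[OF d] by (auto simp: slope_def)
    have "f (\<phi> i s) = f x + of_int (q (\<beta> i)) * s" if "0 \<le> s" "s < min \<delta> \<delta>'" for s
      using \<delta>(2)[rule_format, of s] \<delta>'(2)[rule_format, of s] that unfolding ray_0[OF d] by simp
    moreover have "0 < min \<delta> \<delta>'" using \<delta>(1) \<delta>'(1) by simp
    ultimately show ?thesis by blast
  qed
  then obtain \<delta> where \<delta>: "\<And>i. i < n \<Longrightarrow> 0 < \<delta> i"
    "\<And>i s. i < n \<Longrightarrow> 0 \<le> s \<Longrightarrow> s < \<delta> i \<Longrightarrow> f (\<phi> i s) = f x + of_int (q (\<beta> i)) * s" by metis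
  \<comment> \<open>\<open>outgoing_slopes\<close> asks for a single radius that serves all
    arms.\<close>
  define r' where "r' = Min (insert r (\<delta> ` {..<n}))"
  have r': "0 < r'" "r' \<le> r" "\<And>i. i < n \<Longrightarrow> r' \<le> \<delta> i"
    using \<delta>(1) star_chart_pos[OF ch] by (auto simp: r'_def)
  have "outgoing_slopes \<Gamma> f x n (\<lambda>i. q (\<beta> i))"
    unfolding outgoing_slopes_def
    using star_chart_shrink[OF ch r'(1,2)] \<delta>(2) r'(3)
    by (intro exI[of _ r'] exI[of _ \<phi>]) fastforce
  then show ?thesis by blast
qed

lemma rational_function_slope:
  assumes f: "rational_function \<Gamma> f" and d: "d \<in> dirs x"
  shows "\<exists>q::int. slope f d (of_int q)"
proof -
  have "x \<in> \<Gamma>" using d edge_in by (auto simp: dirs_def)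
  then obtain n m where "outgoing_slopes \<Gamma> f x n m" using f by (auto simp: rational_function_def)
  then obtain \<beta> where \<beta>: "bij_betw \<beta> {..<n} (dirs x)" "\<And>i. i < n \<Longrightarrow> slope f (\<beta> i) (of_int (m i))"
    using slopes_of_outgoing by blast
  then obtain i where "i < n" "d = \<beta> i" using d by (auto simp: bij_betw_def image_iff)
  then show ?thesis using \<beta>(2) by blast
qed

lemma ord_at_eq:
  assumes x: "x \<in> \<Gamma>" and q: "\<And>d. d \<in> dirs x \<Longrightarrow> slope f d (of_int (q d))"
  shows "ord_at \<Gamma> f x = (\<Sum>d\<in>dirs x. q d)"
proof -
  have eq: "(\<Sum>i<n. m i) = (\<Sum>d\<in>dirs x. q d)" if nm: "outgoing_slopes \<Gamma> f x n m" for n m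
  proof -
    obtain \<beta> where \<beta>: "bij_betw \<beta> {..<n} (dirs x)" "\<And>i. i < n \<Longrightarrow> slope f (\<beta> i) (of_int (m i))"
      using slopes_of_outgoing[OF nm] by blast
    have "m i = q (\<beta> i)" if "i < n" for i
    proof -
      have "\<beta> i \<in> dirs x" using \<beta>(1) that by (auto simp: bij_betw_def)
      then show ?thesis using slope_unique[OF \<beta>(2)[OF that] q] by simp
    qed
    then show ?thesis using sum.reindex_bij_betw[OF \<beta>(1), of q] by simp
  qed
  obtain n m where "outgoing_slopes \<Gamma> f x n m" using outgoing_of_slopes[OF x q] by blast
  then show ?thesis
    unfolding ord_at_def using eq by (intro the_equality) metis+
qed

text \<open>Each edge starts in a direction of its own at one of the finitely many vertices, and a
  star chart has finitely many arms.\<close>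

lemma finite_E: "finite E"
proof -
  have "(\<lambda>e. (e, 0, 1)) ` E \<subseteq> (\<Union>v\<in>V. dirs v)"
    using edge_ends edge_length by (auto simp: dirs_def)
  moreover have "finite (\<Union>v\<in>V. dirs v)" using finite_V finite_dirs V_subset by auto
  ultimately have "finite ((\<lambda>e. (e, 0::real, 1::real)) ` E)" by (rule finite_subset)
  then show ?thesis by (rule finite_imageD) (auto simp: inj_on_def)
qed

lemma dirs_vertex:
  assumes v: "v \<in> V"
  shows "dirs v = (\<lambda>e. (e, 0, 1)) ` {e \<in> E. \<gamma> e 0 = v} \<union> (\<lambda>e. (e, l e, -1)) ` {e \<in> E. \<gamma> e (l e) = v}"
proof -
  have ends: "t = 0 \<or> t = l e" if "e \<in> E" "\<gamma> e t = v" "0 \<le> t" "t \<le> l e" for e t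
  proof (rule ccontr)
    assume "\<not> (t = 0 \<or> t = l e)"
    then have "0 < t" "t < l e" using that by auto
    then show False using edge_point(3)[OF that(1)] that(2) v by blast
  qed
  have "(e, t, \<sigma>) \<in> dirs v \<longleftrightarrow> e \<in> E \<and> (\<gamma> e 0 = v \<and> t = 0 \<and> \<sigma> = 1 \<or> \<gamma> e (l e) = v \<and> t = l e \<and> \<sigma> = -1)"
    for e t \<sigma>
    using ends[of e t] edge_length[of e] unfolding dirs_def by auto
  then show ?thesis by auto
qed

lemma sum_dirs_vertex:
  assumes v: "v \<in> V"
  shows "(\<Sum>d\<in>dirs v. q d :: int)
    = (\<Sum>e\<in>E. of_bool (\<gamma> e 0 = v) * q (e, 0, 1) + of_bool (\<gamma> e (l e) = v) * q (e, l e, -1))"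
proof -
  have "(\<Sum>d\<in>dirs v. q d) = (\<Sum>e\<in>{e \<in> E. \<gamma> e 0 = v}. q (e, 0, 1)) + (\<Sum>e\<in>{e \<in> E. \<gamma> e (l e) = v}. q (e, l e, -1))"
    unfolding dirs_vertex[OF v] using finite_E
    by (subst sum.union_disjoint) (auto simp: sum.reindex inj_on_def)
  also have "\<dots> = (\<Sum>e\<in>E. of_bool (\<gamma> e 0 = v) * q (e, 0, 1)) + (\<Sum>e\<in>E. of_bool (\<gamma> e (l e) = v) * q (e, l e, -1))"
    using finite_E by (intro arg_cong2[where f = "(+)"] sum.mono_neutral_cong_left) auto
  finally show ?thesis by (simp add: sum.distrib)
qed

lemma dirs_inner:
  assumes "e \<in> E" "0 < t" "t < l e"
  shows "dirs (\<gamma> e t) = {(e, t, 1), (e, t, -1)}"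
proof -
  have uniq: "e' = e \<and> t' = t" if "e' \<in> E" "0 \<le> t'" "t' \<le> l e'" "\<gamma> e' t' = \<gamma> e t" for e' t'
  proof -
    have "t' \<noteq> 0" "t' \<noteq> l e'" using edge_point(3)[OF assms] edge_ends[OF that(1)] that(4) by auto
    then have "0 < t'" "t' < l e'" using that by auto
    then show ?thesis using edge_point_unique[OF that(1) assms(1)] assms that(4) by blast
  qed
  have "d \<in> {(e, t, 1), (e, t, -1)}" if "d \<in> dirs (\<gamma> e t)" for d
  proof -
    obtain e' t' \<sigma> where d: "d = (e', t', \<sigma>)" by (cases d)
    have d': "e' \<in> E" "0 \<le> t'" "t' \<le> l e'" "\<gamma> e' t' = \<gamma> e t" "\<sigma> = 1 \<or> \<sigma> = -1"
      using that by (auto simp: dirs_def d)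
    then show ?thesis using uniq[OF d'(1-4)] by (auto simp: d)
  qed
  moreover have "{(e, t, 1), (e, t, -1)} \<subseteq> dirs (\<gamma> e t)"
    using assms by (simp add: dirs_def)
  ultimately show ?thesis by blast
qed

end

section \<open>Rational functions\<close>

text \<open>Since \<open>g\<close> is affine across every inner point, the set of points near which
  it has its initial value is open and closed in the interval.\<close>

lemma locally_affine_imp_constant:
  fixes g :: "real \<Rightarrow> real"
  assumes L: "0 < L" and cont: "continuous_on {0..L} g"
    and aff: "\<And>t. 0 < t \<Longrightarrow> t < L \<Longrightarrow> \<exists>c. \<exists>\<delta>>0. \<forall>u. \<bar>u\<bar> < \<delta> \<longrightarrow> g (t + u) = g t + c * u"
    and start: "0 < \<delta>" "\<And>t. 0 \<le> t \<Longrightarrow> t < \<delta> \<Longrightarrow> g t = g 0"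
    and t: "0 \<le> t" "t \<le> L"
  shows "g t = g 0"
proof -
  define P where "P t \<longleftrightarrow> (\<exists>\<delta>>0. \<forall>u. \<bar>u\<bar> < \<delta> \<longrightarrow> g (t + u) = g 0)" for t
  have "P t = P t'" if "t \<in> {0<..<L}" "t' \<in> {0<..<L}" for t t'
  proof (rule connected_local_const[of "{0<..<L}"])
    show "\<forall>t\<in>{0<..<L}. eventually (\<lambda>t'. P t = P t') (at t within {0<..<L})"
    proof
      fix t assume t: "t \<in> {0<..<L}"
      obtain c \<delta> where \<delta>: "\<delta> > 0" "\<And>u. \<bar>u\<bar> < \<delta> \<Longrightarrow> g (t + u) = g t + c * u"
        using aff[of t] t by auto
      \<comment> \<open>On an interval where \<open>g\<close> is affine, being constant near one
        point with the right value is the same as being so throughout.\<close>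
      have P_iff: "P (t + v) \<longleftrightarrow> c = 0 \<and> g t = g 0" if v: "\<bar>v\<bar> < \<delta>" for v
      proof
        assume "P (t + v)"
        then obtain \<eta> where \<eta>: "\<eta> > 0" "\<And>u. \<bar>u\<bar> < \<eta> \<Longrightarrow> g (t + v + u) = g 0"
          unfolding P_def by blast
        define u where "u = min \<eta> (\<delta> - \<bar>v\<bar>) / 2"
        have u: "0 < u" "u < \<eta>" "u < \<delta> - \<bar>v\<bar>" using \<eta>(1) v by (auto simp: u_def)
        have "g t + c * (v + u) = g 0"
          using \<delta>(2)[of "v + u"] \<eta>(2)[of u] u by (simp add: add.assoc)
        moreover have "g t + c * v = g 0" using \<delta>(2)[of v] \<eta>(2)[of 0] v \<eta>(1) by simp
        moreover have "c * (v + u) = c * v + c * u" by (rule distrib_left)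
        ultimately have "c * u = 0" by linarith
        then have "c = 0" using u by simp
        then show "c = 0 \<and> g t = g 0" using \<open>g t + c * v = g 0\<close> by simp
      next
        assume c: "c = 0 \<and> g t = g 0"
        have "g (t + v + u) = g 0" if "\<bar>u\<bar> < \<delta> - \<bar>v\<bar>" for u
          using \<delta>(2)[of "v + u"] that c by (simp add: add.assoc)
        then show "P (t + v)" unfolding P_def using v by (intro exI[of _ "\<delta> - \<bar>v\<bar>"]) auto
      qed
      have "P t = P t'" if "\<bar>t' - t\<bar> < \<delta>" for t'
        using P_iff[of 0] P_iff[of "t' - t"] that \<delta>(1) by simp
      then show "eventually (\<lambda>t'. P t = P t') (at t within {0<..<L})"
        using \<delta>(1) by (auto simp: eventually_at dist_real_def)
    qed
  qed (use that in auto)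
  moreover have "P (min \<delta> L / 2)"
    unfolding P_def
  proof (intro exI[of _ "min \<delta> L / 2"] conjI allI impI)
    fix u assume "\<bar>u\<bar> < min \<delta> L / 2"
    then show "g (min \<delta> L / 2 + u) = g 0" by (intro start(2)) auto
  qed (use start(1) L in auto)
  moreover have "min \<delta> L / 2 \<in> {0<..<L}" using start(1) L by auto
  ultimately have "P t" if "t \<in> {0<..<L}" for t using that by blast
  then have "g t = g 0" if "t \<in> {0<..<L}" for t
    using that unfolding P_def by (metis abs_zero add.right_neutral)
  moreover have "closure {0<..<L} = {0..L}" using L by simp
  ultimately show ?thesis
    using continuous_constant_on_closure[of "{0<..<L}" g "g 0" t] cont t by auto
qed

text \<open>The piecewise linear function of the position along an edge that is zero to the left of
  all \<open>x i\<close> and whose slope rises by \<open>m i\<close> at \<open>x i\<close>.\<close>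

definition hinges :: "nat \<Rightarrow> (nat \<Rightarrow> int) \<Rightarrow> (nat \<Rightarrow> real) \<Rightarrow> real \<Rightarrow> real" where
  "hinges k m x t = (\<Sum>i<k. real_of_int (m i) * max 0 (t - x i))"

lemma hinges_right:
  "\<exists>\<delta>>0. \<forall>s. 0 \<le> s \<longrightarrow> s < \<delta> \<longrightarrow>
    hinges k m x (t + s) = hinges k m x t + real_of_int (\<Sum>i<k. m i * of_bool (x i \<le> t)) * s"
proof -
  have ev: "\<forall>\<^sub>F s in at_right 0. s < c" if "0 < c" for c :: real
    using that unfolding eventually_at_right_field by blast
  have "\<forall>\<^sub>F s in at_right 0. \<forall>i\<in>{..<k}. s < (if x i \<le> t then 1 else x i - t)"
    by (intro eventually_ball_finite ballI ev) auto
  then obtain \<delta> where \<delta>: "\<delta> > 0" "\<And>s i. 0 < s \<Longrightarrow> s < \<delta> \<Longrightarrow> i < k \<Longrightarrow> s < (if x i \<le> t then 1 else x i - t)"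
    unfolding eventually_at_right_field by auto
  have "hinges k m x (t + s) = hinges k m x t + real_of_int (\<Sum>i<k. m i * of_bool (x i \<le> t)) * s"
    if s: "0 \<le> s" "s < \<delta>" for s
  proof -
    have "real_of_int (m i) * max 0 (t + s - x i)
        = real_of_int (m i) * max 0 (t - x i) + real_of_int (m i * of_bool (x i \<le> t)) * s" if "i < k" for i
      using \<delta>(2)[of s i] s that by (cases "s = 0"; cases "x i \<le> t") (auto simp: max_def algebra_simps)
    then have "hinges k m x (t + s)
        = (\<Sum>i<k. real_of_int (m i) * max 0 (t - x i) + real_of_int (m i * of_bool (x i \<le> t)) * s)"
      unfolding hinges_def by (intro sum.cong) auto
    then show ?thesis by (simp only: hinges_def sum.distrib sum_distrib_right of_int_sum)
  qed
  then show ?thesis using \<delta>(1) by blast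
qed

lemma hinges_left:
  "\<exists>\<delta>>0. \<forall>s. 0 \<le> s \<longrightarrow> s < \<delta> \<longrightarrow>
    hinges k m x (t - s) = hinges k m x t - real_of_int (\<Sum>i<k. m i * of_bool (x i < t)) * s"
proof -
  have ev: "\<forall>\<^sub>F s in at_right 0. s < c" if "0 < c" for c :: real
    using that unfolding eventually_at_right_field by blast
  have "\<forall>\<^sub>F s in at_right 0. \<forall>i\<in>{..<k}. s < (if x i < t then t - x i else 1)"
    by (intro eventually_ball_finite ballI ev) auto
  then obtain \<delta> where \<delta>: "\<delta> > 0" "\<And>s i. 0 < s \<Longrightarrow> s < \<delta> \<Longrightarrow> i < k \<Longrightarrow> s < (if x i < t then t - x i else 1)"
    unfolding eventually_at_right_field by auto
  have "hinges k m x (t - s) = hinges k m x t - real_of_int (\<Sum>i<k. m i * of_bool (x i < t)) * s"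
    if s: "0 \<le> s" "s < \<delta>" for s
  proof -
    have "real_of_int (m i) * max 0 (t - s - x i)
        = real_of_int (m i) * max 0 (t - x i) - real_of_int (m i * of_bool (x i < t)) * s" if "i < k" for i
      using \<delta>(2)[of s i] s that by (cases "s = 0"; cases "x i < t") (auto simp: max_def algebra_simps)
    then have "hinges k m x (t - s)
        = (\<Sum>i<k. real_of_int (m i) * max 0 (t - x i) - real_of_int (m i * of_bool (x i < t)) * s)"
      unfolding hinges_def by (intro sum.cong) auto
    then show ?thesis by (simp only: hinges_def sum_subtractf sum_distrib_right of_int_sum)
  qed
  then show ?thesis using \<delta>(1) by blast
qed

lemma continuous_on_hinges: "continuous_on A (hinges k m x)"
  unfolding hinges_def by (intro continuous_intros)

lemma hinges_0: "(\<And>i. i < k \<Longrightarrow> 0 < x i) \<Longrightarrow> hinges k m x 0 = 0"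
  unfolding hinges_def by (intro sum.neutral) auto

lemma hinges_end: "(\<And>i. i < k \<Longrightarrow> x i < L) \<Longrightarrow> hinges k m x L = (\<Sum>i<k. real_of_int (m i) * (L - x i))"
  unfolding hinges_def by (intro sum.cong) (auto simp: max_def dest: less_imp_le)

text \<open>Near \<open>x\<close> the change of \<open>f\<close> is at most the distance from
  \<open>x\<close> times the sum of the absolute slopes. Hence integral slopes in all directions
  suffice to recognize a rational function.\<close>

lemma outgoing_slopes_continuous:
  assumes "outgoing_slopes \<Gamma> f x n m"
  shows "continuous (at x within \<Gamma>) f"
proof -
  obtain r \<phi> where ch: "star_chart \<Gamma> x n r \<phi>"
    and f: "\<forall>i<n. \<forall>t\<in>{0..<r}. f (\<phi> i t) = f x + of_int (m i) * t"
    using assms by (auto simp: outgoing_slopes_def)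
  define M where "M = (\<Sum>i<n. \<bar>real_of_int (m i)\<bar>)"
  have M: "0 \<le> M" "\<And>i. i < n \<Longrightarrow> \<bar>real_of_int (m i)\<bar> \<le> M"
    unfolding M_def by (auto intro: sum_nonneg member_le_sum)
  have bound: "\<bar>f y - f x\<bar> \<le> M * dist x y" if y: "y \<in> \<Gamma>" "dist x y < r" for y
  proof (cases "y = x")
    case False
    then obtain i where i: "i < n" "y = \<phi> i (dist x y)" using star_chart_arm[OF ch y] by blast
    have "f (\<phi> i (dist x y)) = f x + of_int (m i) * dist x y"
      using f[rule_format, OF i(1), of "dist x y"] y(2) by simp
    then have "f y = f x + of_int (m i) * dist x y" using i(2) by metis
    then show ?thesis using M(2)[OF i(1)] by (simp add: abs_mult mult_right_mono)
  qed (use M in simp)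
  show ?thesis
    unfolding continuous_within_eps_delta
  proof (intro allI impI)
    fix \<epsilon> :: real assume \<epsilon>: "\<epsilon> > 0"
    have "dist (f y) (f x) < \<epsilon>" if y: "y \<in> \<Gamma>" "dist y x < min r (\<epsilon> / (M + 1))" for y
    proof -
      have "M * dist x y \<le> (M + 1) * dist x y" by (simp add: mult_right_mono)
      also have "\<dots> < \<epsilon>" using y(2) M(1) by (simp add: dist_commute field_simps)
      finally show ?thesis using bound[of y] y by (simp add: dist_real_def dist_commute)
    qed
    then show "\<exists>d>0. \<forall>y\<in>\<Gamma>. dist y x < d \<longrightarrow> dist (f y) (f x) < \<epsilon>"
      using \<epsilon> M(1) star_chart_pos[OF ch] by (intro exI[of _ "min r (\<epsilon> / (M + 1))"]) auto
  qed
qed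

section \<open>Rational functions in terms of a model\<close>

context metric_model
begin

sublocale weighted_multigraph "edges \<Gamma> V" V "\<lambda>e. \<gamma> e 0" "\<lambda>e. \<gamma> e (l e)" l
  using finite_E finite_V edge_ends edge_length loopless
  by unfold_locales (auto simp: loopless_def)

lemma genus_eq: "genus \<Gamma> V l \<gamma> = fun_space.dim cycles"
  unfolding genus_def cycle_space_def cycles_def boundary_def ..

text \<open>Distances are finite, so the infimum of path lengths is not taken over the empty
  set.\<close>

lemma path_connected: "path_connected \<Gamma>"
  unfolding path_connected_def
proof (intro ballI)
  fix x y assume xy: "x \<in> \<Gamma>" "y \<in> \<Gamma>"
  let ?P = "{p. path p \<and> path_image p \<subseteq> \<Gamma> \<and> pathstart p = x \<and> pathfinish p = y}"
  have "ennreal (dist x y) = (INF p\<in>?P. path_length p)"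
    using graph xy unfolding metric_graph_def length_space_def by blast
  then have "?P \<noteq> {}" by (metis Inf_empty ennreal_neq_top image_empty top_ennreal.abs_eq)
  then show "\<exists>p. path p \<and> path_image p \<subseteq> \<Gamma> \<and> pathstart p = x \<and> pathfinish p = y" by blast
qed

text \<open>Otherwise \<open>S\<close> and \<open>V - S\<close>, each together with its adjacent
  closed edges, would be disjoint nonempty closed sets covering the connected space
  \<open>\<Gamma>\<close>.\<close>

lemma edge_across:
  assumes S: "S \<subseteq> V" "S \<noteq> {}" "S \<noteq> V"
  shows "\<exists>e. \<exists>u\<in>S. \<exists>w\<in>V-S. joins e u w"
proof (rule ccontr)
  assume no: "\<not> ?thesis"
  have same: "\<gamma> e 0 \<in> S \<longleftrightarrow> \<gamma> e (l e) \<in> S" if "e \<in> E" for e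
    using no edge_ends[OF that] that unfolding joins_def by (metis DiffI insert_commute)
  define A where "A T = T \<union> (\<Union>e\<in>{e \<in> E. \<gamma> e 0 \<in> T}. \<gamma> e ` {0..l e})" for T
  have closed: "closed (A T)" if "T \<subseteq> V" for T
  proof -
    have "compact (\<gamma> e ` {0..l e})" if "e \<in> E" for e
      using edge_continuous[OF that] by (intro compact_continuous_image) auto
    then show ?thesis
      unfolding A_def using finite_E finite_subset[OF that finite_V]
      by (intro closed_Un closed_UN finite_imp_closed) (auto intro: compact_imp_closed)
  qed
  have end_T: "\<gamma> e (l e) \<in> T" if "T = S \<or> T = V - S" "e \<in> E" "\<gamma> e 0 \<in> T" for e T
    using that same edge_ends by auto
  have inV: "x \<in> T" if T: "T = S \<or> T = V - S" and x: "x \<in> A T" "x \<in> V" for x T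
  proof (cases "x \<in> T")
    case False
    then obtain e t where e: "e \<in> E" "\<gamma> e 0 \<in> T" "0 \<le> t" "t \<le> l e" "x = \<gamma> e t"
      using x(1) by (auto simp: A_def)
    then have "t = 0 \<or> t = l e" using edge_point(3)[of e t] x(2) by force
    then show ?thesis using e end_T[OF T] by auto
  qed
  have inE: "\<gamma> e 0 \<in> T" if T: "T = S \<or> T = V - S" and e: "e \<in> E" "0 < t" "t < l e" and x: "\<gamma> e t \<in> A T" for e t T
  proof -
    have "\<gamma> e t \<notin> T" using edge_point(3)[OF e] T S by auto
    then obtain e' t' where e': "e' \<in> E" "\<gamma> e' 0 \<in> T" "0 \<le> t'" "t' \<le> l e'" "\<gamma> e t = \<gamma> e' t'"
      using x by (auto simp: A_def)
    then have "t' \<noteq> 0" "t' \<noteq> l e'" using edge_point(3)[OF e] edge_ends[OF e'(1)] by auto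
    then have "0 < t'" "t' < l e'" using e' by auto
    then show ?thesis using edge_point_unique(1)[OF e(1) e'(1) e(2,3)] e'(2,5) by blast
  qed
  have "\<Gamma> \<subseteq> A S \<union> A (V - S)"
  proof
    fix x assume "x \<in> \<Gamma>"
    then show "x \<in> A S \<union> A (V - S)"
    proof (cases rule: point_cases)
      case (2 e t)
      then have "\<gamma> e 0 \<in> S \<or> \<gamma> e 0 \<in> V - S" "x \<in> \<gamma> e ` {0..l e}" using edge_ends by auto
      then show ?thesis using 2(1) unfolding A_def by blast
    qed (auto simp: A_def)
  qed
  moreover have "A S \<inter> A (V - S) \<inter> \<Gamma> = {}"
  proof -
    have False if "x \<in> A S" "x \<in> A (V - S)" "x \<in> \<Gamma>" for x
      using \<open>x \<in> \<Gamma>\<close>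
    proof (cases rule: point_cases)
      case 1
      then show ?thesis using inV[of S x] inV[of "V - S" x] that by auto
    next
      case (2 e t)
      then show ?thesis using inE[of S e t] inE[of "V - S" e t] that by auto
    qed
    then show ?thesis by blast
  qed
  moreover have "A S \<inter> \<Gamma> \<noteq> {}" "A (V - S) \<inter> \<Gamma> \<noteq> {}" using S V_subset by (auto simp: A_def)
  moreover have "closed (A S)" "closed (A (V - S))" using closed S by auto
  ultimately show False
    using path_connected_imp_connected[OF path_connected] unfolding connected_closed by blast
qed

lemma slopeI:
  assumes "e \<in> E" "(e, t, \<sigma>) \<in> dirs x"
    and G: "\<And>t. 0 \<le> t \<Longrightarrow> t \<le> l e \<Longrightarrow> f (\<gamma> e t) = G t"
    and \<delta>: "0 < \<delta>" "\<And>s. 0 \<le> s \<Longrightarrow> s < \<delta> \<Longrightarrow> G (t + \<sigma> * s) = G t + q * s"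
  shows "slope f (e, t, \<sigma>) q"
proof -
  have t: "\<sigma> = 1 \<and> 0 \<le> t \<and> t < l e \<or> \<sigma> = -1 \<and> 0 < t \<and> t \<le> l e" using assms(2) by (auto simp: dirs_def)
  define a where "a = min \<delta> (if \<sigma> = 1 then l e - t else t)"
  have "f (ray (e, t, \<sigma>) s) = f (ray (e, t, \<sigma>) 0) + q * s" if s: "0 \<le> s" "s < a" for s
  proof -
    have "0 \<le> t + \<sigma> * s" "t + \<sigma> * s \<le> l e" "0 \<le> t" "t \<le> l e" "s < \<delta>"
      using t s by (auto simp: a_def split: if_splits)
    then show ?thesis using G \<delta>(2)[OF s(1)] by simp
  qed
  moreover have "0 < a" using t \<delta>(1) by (auto simp: a_def)
  ultimately show ?thesis unfolding slope_def by blast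
qed

lemma rational_function_of_slopes:
  assumes "\<And>x d. x \<in> \<Gamma> \<Longrightarrow> d \<in> dirs x \<Longrightarrow> slope f d (of_int (q d))"
  shows "rational_function \<Gamma> f"
  unfolding rational_function_def continuous_on_eq_continuous_within
  using outgoing_of_slopes[of _ f q] outgoing_slopes_continuous assms by blast

text \<open>The valence contributes 1 for each direction, so every outgoing slope appears increased
  by 1. These increased slopes are the weights of the combinatorial part.\<close>

lemma div_at_vertex:
  assumes v: "v \<in> V"
    and a: "\<And>e. e \<in> E \<Longrightarrow> slope f (e, 0, 1) (of_int (a e))"
    and b: "\<And>e. e \<in> E \<Longrightarrow> slope f (e, l e, -1) (of_int (b e))"
  shows "(canonical \<Gamma> + div_of \<Gamma> f) v
    = (\<Sum>e\<in>E. of_bool (\<gamma> e 0 = v) * (1 + a e) + of_bool (\<gamma> e (l e) = v) * (1 + b e)) - 2"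
proof -
  have v\<Gamma>: "v \<in> \<Gamma>" using v V_subset by auto
  define q where "q = (\<lambda>(e, t::real, \<sigma>::real). if \<sigma> = 1 then a e else b e)"
  have "slope f d (of_int (q d))" if "d \<in> dirs v" for d
    using that a b by (auto simp: dirs_vertex[OF v] q_def)
  then have "ord_at \<Gamma> f v = (\<Sum>d\<in>dirs v. q d)" by (rule ord_at_eq[OF v\<Gamma>])
  also have "\<dots> = (\<Sum>e\<in>E. of_bool (\<gamma> e 0 = v) * a e + of_bool (\<gamma> e (l e) = v) * b e)"
    by (simp add: sum_dirs_vertex[OF v] q_def)
  finally have ord: "ord_at \<Gamma> f v = \<dots>" .
  have "int (val \<Gamma> v) = (\<Sum>d\<in>dirs v. 1)" by (simp add: val_eq[OF v\<Gamma>])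
  also have "\<dots> = (\<Sum>e\<in>E. of_bool (\<gamma> e 0 = v) * 1 + of_bool (\<gamma> e (l e) = v) * 1)"
    by (rule sum_dirs_vertex[OF v])
  finally have "int (val \<Gamma> v) = \<dots>" .
  then show ?thesis
    using v\<Gamma> by (simp add: canonical_def div_of_def ord algebra_simps sum.distrib)
qed

lemma div_at_inner:
  assumes e: "e \<in> E" "0 < t" "t < l e"
    and "slope f (e, t, 1) (of_int a)" "slope f (e, t, -1) (of_int b)"
  shows "(canonical \<Gamma> + div_of \<Gamma> f) (\<gamma> e t) = a + b"
proof -
  have \<Gamma>: "\<gamma> e t \<in> \<Gamma>" by (rule edge_point(2)[OF e])
  define q where "q = (\<lambda>(e :: 'a set, t :: real, \<sigma>::real). if \<sigma> = 1 then a else b)"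
  have "slope f d (of_int (q d))" if "d \<in> dirs (\<gamma> e t)" for d
    using that assms by (auto simp: dirs_inner[OF e] q_def)
  then have "ord_at \<Gamma> f (\<gamma> e t) = (\<Sum>d\<in>dirs (\<gamma> e t). q d)" by (rule ord_at_eq[OF \<Gamma>])
  also have "\<dots> = a + b" by (simp add: dirs_inner[OF e] q_def)
  finally show ?thesis using \<Gamma> by (simp add: canonical_def div_of_def val_eq dirs_inner[OF e])
qed

text \<open>The divisor prescribes every bend of \<open>f\<close> inside the edge, and the hinges
  have the same bends. The difference is affine across each inner point, and the initial slope makes
  it constant.\<close>

lemma rational_function_on_edge:
  assumes f: "rational_function \<Gamma> f" and e: "e \<in> E"
    and s: "slope f (e, 0, 1) (of_int s)"
    and x: "\<And>i. i < k \<Longrightarrow> 0 < x i \<and> x i < l e"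
    and D: "\<And>t. 0 < t \<Longrightarrow> t < l e \<Longrightarrow>
      (canonical \<Gamma> + div_of \<Gamma> f) (\<gamma> e t) = (\<Sum>i<k. if x i = t then m i else 0)"
    and t: "0 \<le> t" "t \<le> l e"
  shows "f (\<gamma> e t) = f (\<gamma> e 0) + of_int s * t + hinges k m x t"
proof -
  define g where "g t = f (\<gamma> e t) - of_int s * t - hinges k m x t" for t
  have h0: "hinges k m x 0 = 0" using x by (intro hinges_0) auto
  obtain \<eta> where \<eta>: "0 < \<eta>" "\<And>u. 0 \<le> u \<Longrightarrow> u < \<eta> \<Longrightarrow> g u = g 0"
  proof -
    obtain \<delta>1 where \<delta>1: "\<delta>1 > 0" "\<And>u. 0 \<le> u \<Longrightarrow> u < \<delta>1 \<Longrightarrow> f (\<gamma> e u) = f (\<gamma> e 0) + of_int s * u"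
      using s unfolding slope_def by auto
    obtain \<delta>3 where \<delta>3: "\<delta>3 > 0" "\<And>u. 0 \<le> u \<Longrightarrow> u < \<delta>3 \<Longrightarrow>
        hinges k m x (0 + u) = hinges k m x 0 + of_int (\<Sum>i<k. m i * of_bool (x i \<le> 0)) * u"
      using hinges_right[of k m x 0] by blast
    have "(\<Sum>i<k. m i * of_bool (x i \<le> 0)) = 0"
      using x by (intro sum.neutral) (auto simp: not_le)
    then have "hinges k m x u = 0" if "0 \<le> u" "u < \<delta>3" for u using \<delta>3(2)[OF that] h0 by simp
    then have "g u = g 0" if "0 \<le> u" "u < min \<delta>1 \<delta>3" for u
      using \<delta>1(2)[of u] that h0 by (simp add: g_def)
    moreover have "0 < min \<delta>1 \<delta>3" using \<delta>1 \<delta>3 by simp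
    ultimately show ?thesis using that by blast
  qed
  have "g t = g 0"
  proof (rule locally_affine_imp_constant[where g = g, OF edge_length[OF e] _ _ \<eta> t])
    have "continuous_on {0..l e} (\<lambda>t. f (\<gamma> e t))"
      using f edge_in[OF e] by (intro continuous_on_compose2[OF _ edge_continuous[OF e], of \<Gamma>])
        (auto simp: rational_function_def)
    then show "continuous_on {0..l e} g"
      unfolding g_def by (intro continuous_intros continuous_on_hinges)
  next
    fix t assume t: "0 < t" "t < l e"
    have dirs: "(e, t, 1) \<in> dirs (\<gamma> e t)" "(e, t, -1) \<in> dirs (\<gamma> e t)" using e t by (auto simp: dirs_def)
    obtain a b :: int where ab: "slope f (e, t, 1) (of_int a)" "slope f (e, t, -1) (of_int b)"
      using rational_function_slope[OF f dirs(1)] rational_function_slope[OF f dirs(2)] by blast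
    obtain \<delta>1 where \<delta>1: "\<delta>1 > 0" "\<And>s. 0 \<le> s \<Longrightarrow> s < \<delta>1 \<Longrightarrow> f (\<gamma> e (t + s)) = f (\<gamma> e t) + of_int a * s"
      using ab(1) unfolding slope_def by auto
    obtain \<delta>2 where \<delta>2: "\<delta>2 > 0" "\<And>s. 0 \<le> s \<Longrightarrow> s < \<delta>2 \<Longrightarrow> f (\<gamma> e (t - s)) = f (\<gamma> e t) + of_int b * s"
      using ab(2) unfolding slope_def by auto
    define a' where "a' = (\<Sum>i<k. m i * of_bool (x i \<le> t))"
    define b' where "b' = (\<Sum>i<k. m i * of_bool (x i < t))"
    obtain \<delta>3 where \<delta>3: "\<delta>3 > 0" "\<And>s. 0 \<le> s \<Longrightarrow> s < \<delta>3 \<Longrightarrow> hinges k m x (t + s) = hinges k m x t + of_int a' * s"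
      using hinges_right[of k m x t] unfolding a'_def by blast
    obtain \<delta>4 where \<delta>4: "\<delta>4 > 0" "\<And>s. 0 \<le> s \<Longrightarrow> s < \<delta>4 \<Longrightarrow> hinges k m x (t - s) = hinges k m x t - of_int b' * s"
      using hinges_left[of k m x t] unfolding b'_def by blast
    have "a + b = (\<Sum>i<k. if x i = t then m i else 0)"
      using D[OF t] div_at_inner[OF e t ab] by simp
    also have "\<dots> = (\<Sum>i<k. m i * of_bool (x i \<le> t) - m i * of_bool (x i < t))"
      by (intro sum.cong) auto
    also have "\<dots> = a' - b'" by (simp add: a'_def b'_def sum_subtractf)
    finally have sum: "a + b = a' - b'" .
    \<comment> \<open>The difference has the same slope on both sides of \<open>t\<close>: the bends
      of \<open>f\<close> and of the hinges cancel.\<close>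
    have bal: "real_of_int b + of_int s + of_int b' = - (of_int a - of_int s - of_int a')"
      using sum by linarith
    show "\<exists>c. \<exists>\<delta>>0. \<forall>u. \<bar>u\<bar> < \<delta> \<longrightarrow> g (t + u) = g t + c * u"
    proof (rule exI[of _ "real_of_int (a - s - a')"], rule exI[of _ "min (min \<delta>1 \<delta>2) (min \<delta>3 \<delta>4)"],
        intro conjI allI impI)
      fix u assume u: "\<bar>u\<bar> < min (min \<delta>1 \<delta>2) (min \<delta>3 \<delta>4)"
      show "g (t + u) = g t + real_of_int (a - s - a') * u"
      proof (cases "0 \<le> u")
        case True
        then show ?thesis using u \<delta>1(2)[of u] \<delta>3(2)[of u] by (simp add: g_def algebra_simps)
      next
        case False
        then have "g (t - - u) = g t + (of_int b + of_int s + of_int b') * (- u)"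
          using u \<delta>2(2)[of "- u"] \<delta>4(2)[of "- u"] by (simp add: g_def algebra_simps)
        then show ?thesis unfolding bal by (simp add: algebra_simps)
      qed
    qed (use \<delta>1 \<delta>2 \<delta>3 \<delta>4 in auto)
  qed auto
  then show ?thesis by (simp add: g_def h0)
qed

lemma slope_at_end:
  fixes k :: nat
  assumes f: "rational_function \<Gamma> f" and e: "e \<in> E"
    and s: "slope f (e, 0, 1) (of_int s)"
    and x: "\<And>i. i < k \<Longrightarrow> 0 < x i \<and> x i < l e"
    and D: "\<And>t. 0 < t \<Longrightarrow> t < l e \<Longrightarrow>
      (canonical \<Gamma> + div_of \<Gamma> f) (\<gamma> e t) = (\<Sum>i<k. if x i = t then m i else 0)"
  shows "slope f (e, l e, -1) (of_int (- s - (\<Sum>i<k. m i)))"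
proof -
  obtain \<delta> where \<delta>: "\<delta> > 0" "\<And>s. 0 \<le> s \<Longrightarrow> s < \<delta> \<Longrightarrow>
      hinges k m x (l e - s) = hinges k m x (l e) - of_int (\<Sum>i<k. m i * of_bool (x i < l e)) * s"
    using hinges_left[of k m x "l e"] by blast
  have "(\<Sum>i<k. m i * of_bool (x i < l e)) = (\<Sum>i<k. m i)"
    using x by (intro sum.cong) auto
  then show ?thesis
    using \<delta> e edge_length[OF e]
    by (intro slopeI[where G = "\<lambda>t. f (\<gamma> e 0) + of_int s * t + hinges k m x t" and x = "\<gamma> e (l e)"]
        rational_function_on_edge[OF f e s x D])
      (auto simp: dirs_def algebra_simps)
qed

end

section \<open>Cells\<close>

context metric_model
begin

text \<open>The condition on \<open>F\<close> says that on each edge the explicit piecewise linear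
  function that starts with the value of \<open>F\<close> and slope \<open>s e\<close> also ends
  with the value of \<open>F\<close>. So the pieces fit together at the vertices.\<close>

lemma rational_function_glue:
  fixes k :: "'a set \<Rightarrow> nat" and s :: "'a set \<Rightarrow> int" and x :: "'a set \<times> nat \<Rightarrow> real" and F :: "'a \<Rightarrow> real"
  assumes vc: "\<And>v. v \<in> V \<Longrightarrow> (\<Sum>e\<in>E. of_bool (\<gamma> e 0 = v) * (1 + s e)
      + of_bool (\<gamma> e (l e) = v) * (1 - s e - int (k e))) = 2"
    and x: "\<And>e i. e \<in> E \<Longrightarrow> i < k e \<Longrightarrow> 0 < x (e, i) \<and> x (e, i) < l e"
    and F: "\<And>e. e \<in> E \<Longrightarrow> F (\<gamma> e (l e)) - F (\<gamma> e 0) = s e * l e + (\<Sum>i<k e. l e - x (e, i))"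
  obtains f where "rational_function \<Gamma> f" "\<And>e. e \<in> E \<Longrightarrow> slope f (e, 0, 1) (of_int (s e))"
    "\<And>v. v \<in> V \<Longrightarrow> (canonical \<Gamma> + div_of \<Gamma> f) v = 0"
    "\<And>e t. e \<in> E \<Longrightarrow> 0 < t \<Longrightarrow> t < l e \<Longrightarrow>
      (canonical \<Gamma> + div_of \<Gamma> f) (\<gamma> e t) = (\<Sum>i<k e. if x (e, i) = t then 1 else 0)"
proof -
  define G where "G e t = F (\<gamma> e 0) + of_int (s e) * t + hinges (k e) (\<lambda>_. 1) (\<lambda>i. x (e, i)) t" for e t
  have G0: "G e 0 = F (\<gamma> e 0)" if "e \<in> E" for e
    unfolding G_def using x[OF that] by (subst hinges_0) auto
  have Gl: "G e (l e) = F (\<gamma> e (l e))" if "e \<in> E" for e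
    unfolding G_def using x[OF that] F[OF that] by (subst hinges_end) auto
  \<comment> \<open>The choice is harmless, because a point outside \<open>V\<close> has a unique
    edge and coordinate.\<close>
  define f where "f y = (if y \<in> V then F y else
    case (SOME (e, t). e \<in> E \<and> 0 < t \<and> t < l e \<and> y = \<gamma> e t) of (e, t) \<Rightarrow> G e t)" for y
  have f_inner: "f (\<gamma> e t) = G e t" if e: "e \<in> E" "0 < t" "t < l e" for e t
  proof -
    have "(\<lambda>(e', t'). e' \<in> E \<and> 0 < t' \<and> t' < l e' \<and> \<gamma> e t = \<gamma> e' t') = (\<lambda>p. p = (e, t))"
      using edge_point_unique[OF e(1) _ e(2,3)] e by (intro ext) (auto split: prod.split)
    then have "(SOME (e', t'). e' \<in> E \<and> 0 < t' \<and> t' < l e' \<and> \<gamma> e t = \<gamma> e' t') = (e, t)"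
      by (simp only: some_eq_trivial)
    then show ?thesis using edge_point(3)[OF e] unfolding f_def by simp
  qed
  have f: "f (\<gamma> e t) = G e t" if e: "e \<in> E" "0 \<le> t" "t \<le> l e" for e t
  proof -
    consider "t = 0" | "t = l e" | "0 < t" "t < l e" using e by linarith
    then show ?thesis
    proof cases
      case 1
      then show ?thesis using G0[OF e(1)] edge_ends(1)[OF e(1)] unfolding f_def by simp
    next
      case 2
      then show ?thesis using Gl[OF e(1)] edge_ends(2)[OF e(1)] unfolding f_def by simp
    qed (rule f_inner[OF e(1)])
  qed
  \<comment> \<open>\<open>n1\<close> includes the chips at \<open>t\<close> itself and
    \<open>n2\<close> does not; they give the slopes to the right and to the left, so that their
    difference counts the chips at \<open>t\<close>.\<close>
  define n1 where "n1 e t = (\<Sum>i<k e. 1 * of_bool (x (e, i) \<le> t) :: int)" for e t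
  define n2 where "n2 e t = (\<Sum>i<k e. 1 * of_bool (x (e, i) < t) :: int)" for e t
  define q where "q = (\<lambda>(e, t, \<sigma>::real). if \<sigma> = 1 then s e + n1 e t else - (s e + n2 e t))"
  have slope1: "slope f (e, t, 1) (of_int (s e + n1 e t))" if e: "e \<in> E" "0 \<le> t" "t < l e" for e t
  proof -
    obtain \<delta> where \<delta>: "\<delta> > 0" "\<And>u. 0 \<le> u \<Longrightarrow> u < \<delta> \<Longrightarrow> hinges (k e) (\<lambda>_. 1) (\<lambda>i. x (e, i)) (t + u)
        = hinges (k e) (\<lambda>_. 1) (\<lambda>i. x (e, i)) t + of_int (n1 e t) * u"
      using hinges_right[of "k e" "\<lambda>_. 1" "\<lambda>i. x (e, i)" t] unfolding n1_def by blast
    show ?thesis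
    proof (rule slopeI[where f = f and G = "G e" and x = "\<gamma> e t", OF e(1) _ f[OF e(1)] \<delta>(1)])
      show "(e, t, 1) \<in> dirs (\<gamma> e t)" using e by (simp add: dirs_def)
      show "G e (t + 1 * u) = G e t + of_int (s e + n1 e t) * u" if "0 \<le> u" "u < \<delta>" for u
        using \<delta>(2)[OF that] by (simp add: G_def algebra_simps)
    qed
  qed
  have slope2: "slope f (e, t, -1) (of_int (- (s e + n2 e t)))" if e: "e \<in> E" "0 < t" "t \<le> l e" for e t
  proof -
    obtain \<delta> where \<delta>: "\<delta> > 0" "\<And>u. 0 \<le> u \<Longrightarrow> u < \<delta> \<Longrightarrow> hinges (k e) (\<lambda>_. 1) (\<lambda>i. x (e, i)) (t - u)
        = hinges (k e) (\<lambda>_. 1) (\<lambda>i. x (e, i)) t - of_int (n2 e t) * u"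
      using hinges_left[of "k e" "\<lambda>_. 1" "\<lambda>i. x (e, i)" t] unfolding n2_def by blast
    show ?thesis
    proof (rule slopeI[where f = f and G = "G e" and x = "\<gamma> e t", OF e(1) _ f[OF e(1)] \<delta>(1)])
      show "(e, t, -1) \<in> dirs (\<gamma> e t)" using e by (simp add: dirs_def)
      show "G e (t + -1 * u) = G e t + of_int (- (s e + n2 e t)) * u" if "0 \<le> u" "u < \<delta>" for u
        using \<delta>(2)[OF that] by (simp add: G_def algebra_simps)
    qed
  qed
  have rat: "rational_function \<Gamma> f"
  proof (rule rational_function_of_slopes)
    fix y d assume "d \<in> dirs y"
    then show "slope f d (of_int (q d))"
      using slope1 slope2 by (auto simp: dirs_def q_def simp del: of_int_add of_int_minus)
  qed
  have n1_0: "n1 e 0 = 0" if "e \<in> E" for e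
    unfolding n1_def using x[OF that] by (intro sum.neutral) (auto simp: not_le)
  have n2_l: "n2 e (l e) = int (k e)" if "e \<in> E" for e
    unfolding n2_def using x[OF that] by simp
  have s0: "slope f (e, 0, 1) (of_int (s e))" if "e \<in> E" for e
    using slope1[OF that, of 0] edge_length[OF that] n1_0[OF that] by simp
  have "slope f (e, l e, -1) (of_int (- s e - int (k e)))" if "e \<in> E" for e
    using slope2[OF that, of "l e"] edge_length[OF that] n2_l[OF that] by (simp add: algebra_simps)
  then have "(canonical \<Gamma> + div_of \<Gamma> f) v = 0" if "v \<in> V" for v
    using div_at_vertex[OF that s0, of "\<lambda>e. - s e - int (k e)"] vc[OF that] by (simp add: algebra_simps)
  moreover have "(canonical \<Gamma> + div_of \<Gamma> f) (\<gamma> e t) = (\<Sum>i<k e. if x (e, i) = t then 1 else 0)"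
    if e: "e \<in> E" "0 < t" "t < l e" for e t
  proof -
    have "(canonical \<Gamma> + div_of \<Gamma> f) (\<gamma> e t) = n1 e t - n2 e t"
      using div_at_inner[OF e slope1[OF e(1)] slope2[OF e(1)]] e by simp
    also have "\<dots> = (\<Sum>i<k e. if x (e, i) = t then 1 else 0)"
      unfolding n1_def n2_def sum_subtractf[symmetric] by (intro sum.cong) auto
    finally show ?thesis .
  qed
  ultimately show thesis using that rat s0 by blast
qed

abbreviation "chip_cell k s \<equiv> open_cell \<Gamma> V l \<gamma> (canonical \<Gamma>) (\<lambda>_. 0) (\<lambda>e. replicate (k e) 1) s"
abbreviation "chip_cell_positions k \<equiv> chip_positions \<Gamma> V l \<gamma> (\<lambda>e. replicate (k e) 1)"

lemma open_cellE:
  assumes "D \<in> open_cell \<Gamma> V l \<gamma> (canonical \<Gamma>) m\<^sub>V m\<^sub>E s"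
  obtains f x where "rational_function \<Gamma> f" "D = canonical \<Gamma> + div_of \<Gamma> f"
    "\<And>v. v \<in> V \<Longrightarrow> D v = int (m\<^sub>V v)" "chip_positions \<Gamma> V l \<gamma> m\<^sub>E D x"
    "\<And>e. e \<in> E \<Longrightarrow> slope f (e, 0, 1) (of_int (s e))" "D \<in> lin_system \<Gamma> (canonical \<Gamma>)"
proof -
  obtain f x where f: "rational_function \<Gamma> f" "D = canonical \<Gamma> + div_of \<Gamma> f"
    "\<forall>v\<in>V. D v = int (m\<^sub>V v)" "chip_positions \<Gamma> V l \<gamma> m\<^sub>E D x"
    "\<forall>e\<in>E. \<exists>\<delta>>0. \<forall>t\<in>{0..<\<delta>}. f (\<gamma> e t) = f (\<gamma> e 0) + of_int (s e) * t"
    and D: "D \<in> lin_system \<Gamma> (canonical \<Gamma>)"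
    using assms unfolding open_cell_def by blast
  have "slope f (e, 0, 1) (of_int (s e))" if "e \<in> E" for e
  proof -
    obtain \<delta> where "\<delta> > 0" "\<forall>t\<in>{0..<\<delta>}. f (\<gamma> e t) = f (\<gamma> e 0) + of_int (s e) * t"
      using f(5) \<open>e \<in> E\<close> by blast
    then have "\<forall>t. 0 \<le> t \<longrightarrow> t < \<delta> \<longrightarrow> f (ray (e, 0, 1) t) = f (ray (e, 0, 1) 0) + of_int (s e) * t"
      by (metis add_0 atLeastLessThan_iff mult_1 mult_zero_right ray.simps)
    then show ?thesis unfolding slope_def using \<open>\<delta> > 0\<close> by blast
  qed
  then show thesis using that f(1-4) D by blast
qed

lemma chip_positions_bounds:
  assumes "chip_positions \<Gamma> V l \<gamma> m\<^sub>E D x" "e \<in> E"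
  shows "i < length (m\<^sub>E e) \<Longrightarrow> 0 < x (e, i) \<and> x (e, i) < l e"
    and "i < j \<Longrightarrow> j < length (m\<^sub>E e) \<Longrightarrow> x (e, i) < x (e, j)"
    and "0 < t \<Longrightarrow> t < l e \<Longrightarrow>
      D (\<gamma> e t) = (\<Sum>i<length (m\<^sub>E e). if x (e, i) = t then int (m\<^sub>E e ! i) else 0)"
  using assms unfolding chip_positions_def by auto

text \<open>Evaluating the explicit form of \<open>f\<close> at the far end of the edge gives the
  linear equations for the chip positions; \<open>chip_cellI\<close> provides the converse for
  simple chips.\<close>

lemma cell_equation:
  assumes f: "rational_function \<Gamma> f" and x: "chip_positions \<Gamma> V l \<gamma> m\<^sub>E (canonical \<Gamma> + div_of \<Gamma> f) x"
    and e: "e \<in> E" and s: "slope f (e, 0, 1) (of_int s)"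
  shows "f (\<gamma> e (l e)) - f (\<gamma> e 0) = s * l e + (\<Sum>i<length (m\<^sub>E e). real (m\<^sub>E e ! i) * (l e - x (e, i)))"
    and "slope f (e, l e, -1) (of_int (- s - (\<Sum>i<length (m\<^sub>E e). int (m\<^sub>E e ! i))))"
proof -
  note b = chip_positions_bounds[OF x e]
  have "hinges (length (m\<^sub>E e)) (\<lambda>i. int (m\<^sub>E e ! i)) (\<lambda>i. x (e, i)) (l e)
    = (\<Sum>i<length (m\<^sub>E e). real (m\<^sub>E e ! i) * (l e - x (e, i)))"
    using b(1) by (subst hinges_end) auto
  then show "f (\<gamma> e (l e)) - f (\<gamma> e 0)
      = s * l e + (\<Sum>i<length (m\<^sub>E e). real (m\<^sub>E e ! i) * (l e - x (e, i)))"
    using rational_function_on_edge[OF f e s b(1) b(3), of "l e"] edge_length[OF e] by simp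
  show "slope f (e, l e, -1) (of_int (- s - (\<Sum>i<length (m\<^sub>E e). int (m\<^sub>E e ! i))))"
    by (rule slope_at_end[OF f e s b(1) b(3)])
qed

lemma chip_cellI:
  fixes k :: "'a set \<Rightarrow> nat" and s :: "'a set \<Rightarrow> int" and x :: "'a set \<times> nat \<Rightarrow> real" and F :: "'a \<Rightarrow> real"
  assumes vc: "\<And>v. v \<in> V \<Longrightarrow> (\<Sum>e\<in>E. of_bool (\<gamma> e 0 = v) * (1 + s e)
      + of_bool (\<gamma> e (l e) = v) * (1 - s e - int (k e))) = 2"
    and x: "\<And>e i. e \<in> E \<Longrightarrow> i < k e \<Longrightarrow> 0 < x (e, i) \<and> x (e, i) < l e"
    and x_mono: "\<And>e i j. e \<in> E \<Longrightarrow> i < j \<Longrightarrow> j < k e \<Longrightarrow> x (e, i) < x (e, j)"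
    and x0: "\<And>e i. e \<notin> E \<or> k e \<le> i \<Longrightarrow> x (e, i) = 0"
    and F: "\<And>e. e \<in> E \<Longrightarrow> F (\<gamma> e (l e)) - F (\<gamma> e 0) = s e * l e + (\<Sum>i<k e. l e - x (e, i))"
  shows "\<exists>D\<in>chip_cell k s. chip_cell_positions k D x"
proof -
  obtain f where f: "rational_function \<Gamma> f" "\<And>e. e \<in> E \<Longrightarrow> slope f (e, 0, 1) (of_int (s e))"
    "\<And>v. v \<in> V \<Longrightarrow> (canonical \<Gamma> + div_of \<Gamma> f) v = 0"
    "\<And>e t. e \<in> E \<Longrightarrow> 0 < t \<Longrightarrow> t < l e \<Longrightarrow>
      (canonical \<Gamma> + div_of \<Gamma> f) (\<gamma> e t) = (\<Sum>i<k e. if x (e, i) = t then 1 else 0)"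
    using rational_function_glue[OF vc x F] by blast
  define D where "D = canonical \<Gamma> + div_of \<Gamma> f"
  have outside: "D y = 0" if "y \<notin> \<Gamma>" for y using that by (simp add: D_def canonical_def div_of_def)
  have "supp D \<subseteq> (\<lambda>(e, i). \<gamma> e (x (e, i))) ` (SIGMA e:E. {..<k e})"
  proof
    fix y assume y: "y \<in> supp D"
    then have "y \<in> \<Gamma>" using outside by (auto simp: supp_def)
    then show "y \<in> (\<lambda>(e, i). \<gamma> e (x (e, i))) ` (SIGMA e:E. {..<k e})"
    proof (cases rule: point_cases)
      case 1
      then show ?thesis using y f(3)[of y] by (simp add: supp_def D_def)
    next
      case (2 e t)
      then have nz: "(\<Sum>i<k e. if x (e, i) = t then 1 else 0) \<noteq> (0::int)"
        using y f(4)[OF 2(1-3)] by (simp add: supp_def D_def)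
      have "\<exists>i<k e. x (e, i) = t"
      proof (rule ccontr)
        assume "\<not> ?thesis"
        then have "(\<Sum>i<k e. if x (e, i) = t then 1 else 0) = (0::int)" by (intro sum.neutral) auto
        with nz show False by simp
      qed
      then obtain i where "i < k e" "x (e, i) = t" by blast
      then show ?thesis using 2 by (intro image_eqI[of _ _ "(e, i)"]) auto
    qed
  qed
  moreover have "finite (SIGMA e:E. {..<k e})" using finite_E by auto
  ultimately have "finite (supp D)" by (meson finite_imageI finite_subset)
  moreover have "supp D \<subseteq> \<Gamma>" using outside by (auto simp: supp_def)
  moreover have "0 \<le> D y" for y
  proof (cases "y \<in> \<Gamma>")
    case True
    then show ?thesis
      by (cases rule: point_cases) (auto simp: D_def f(3,4) simp del: plus_fun_apply intro: sum_nonneg)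
  qed (simp add: outside)
  moreover have "D - canonical \<Gamma> = div_of \<Gamma> f" by (simp add: D_def)
  ultimately have lin: "D \<in> lin_system \<Gamma> (canonical \<Gamma>)"
    using f(1) unfolding lin_system_def divisor_def effective_def lin_equiv_def by blast
  have pos: "chip_cell_positions k D x"
  proof -
    have "(\<Sum>i<k e. if x (e, i) = t then 1 else 0)
        = (\<Sum>i<k e. if x (e, i) = t then int (replicate (k e) 1 ! i) else 0)" for e t
      by (intro sum.cong) auto
    then show ?thesis
      using x x_mono x0 f(4) unfolding chip_positions_def by (simp add: D_def)
  qed
  have "\<exists>\<delta>>0. \<forall>t\<in>{0..<\<delta>}. f (\<gamma> e t) = f (\<gamma> e 0) + of_int (s e) * t" if e: "e \<in> E" for e
  proof -
    obtain \<delta> where \<delta>: "\<delta> > 0" "\<forall>t. 0 \<le> t \<longrightarrow> t < \<delta> \<longrightarrow> f (ray (e, 0, 1) t) = f (ray (e, 0, 1) 0) + of_int (s e) * t"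
      using f(2)[OF e] unfolding slope_def by blast
    have "f (\<gamma> e t) = f (\<gamma> e 0) + of_int (s e) * t" if "t \<in> {0..<\<delta>}" for t
      using \<delta>(2)[rule_format, of t] that by simp
    then show ?thesis using \<delta>(1) by blast
  qed
  moreover have "\<forall>v\<in>V. D v = int 0" using f(3) unfolding D_def by simp
  ultimately have "D \<in> chip_cell k s"
    using lin f(1) pos D_def unfolding open_cell_def by blast
  then show ?thesis using pos by blast
qed

lemma chip_cell_equation:
  assumes "D \<in> chip_cell k s" and x: "chip_cell_positions k D x"
  obtains F where "\<And>e. e \<in> E \<Longrightarrow> F (\<gamma> e (l e)) - F (\<gamma> e 0) = s e * l e + (\<Sum>i<k e. l e - x (e, i))"
proof -
  obtain f where f: "rational_function \<Gamma> f" "D = canonical \<Gamma> + div_of \<Gamma> f"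
    "\<And>e. e \<in> E \<Longrightarrow> slope f (e, 0, 1) (of_int (s e))"
    using open_cellE[OF assms(1)] by metis
  show thesis
  proof (rule that[of f])
    fix e assume "e \<in> E"
    then show "f (\<gamma> e (l e)) - f (\<gamma> e 0) = s e * l e + (\<Sum>i<k e. l e - x (e, i))"
      using cell_equation(1)[OF f(1) x[unfolded f(2)] _ f(3)] by simp
  qed
qed

text \<open>In position coordinates the cell is given by linear equations and finitely many strict
  inequalities. It is therefore open in a translate of \<open>chip_space k\<close>, and its
  differences span that space.\<close>

lemma cell_dim_chip_cell:
  assumes vc: "\<And>v. v \<in> V \<Longrightarrow> (\<Sum>e\<in>E. of_bool (\<gamma> e 0 = v) * (1 + s e)
      + of_bool (\<gamma> e (l e) = v) * (1 - s e - int (k e))) = 2"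
    and ne: "chip_cell k s \<noteq> {}"
  shows "cell_dim \<Gamma> V l \<gamma> (canonical \<Gamma>) (\<lambda>_. 0) (\<lambda>e. replicate (k e) 1) s
    = fun_space.dim (chip_space k)"
proof -
  define P where "P = {x. \<exists>D\<in>chip_cell k s. chip_cell_positions k D x}"
  define W where "W = {x - y |x y. x \<in> P \<and> y \<in> P}"
  have PE: "\<exists>F. \<forall>e\<in>E. F (\<gamma> e (l e)) - F (\<gamma> e 0) = s e * l e + (\<Sum>i<k e. l e - x (e, i))"
    "\<And>e i. e \<notin> E \<or> k e \<le> i \<Longrightarrow> x (e, i) = 0"
    "\<And>e i. e \<in> E \<Longrightarrow> i < k e \<Longrightarrow> 0 < x (e, i) \<and> x (e, i) < l e"
    "\<And>e i j. e \<in> E \<Longrightarrow> i < j \<Longrightarrow> j < k e \<Longrightarrow> x (e, i) < x (e, j)" if x: "x \<in> P" for x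
  proof -
    obtain D where D: "D \<in> chip_cell k s" "chip_cell_positions k D x" using x by (auto simp: P_def)
    show "\<exists>F. \<forall>e\<in>E. F (\<gamma> e (l e)) - F (\<gamma> e 0) = s e * l e + (\<Sum>i<k e. l e - x (e, i))"
      using chip_cell_equation[OF D] by metis
  qed (use x in \<open>auto simp: P_def chip_positions_def\<close>)
  have sub: "W \<subseteq> chip_space k"
  proof
    fix w assume "w \<in> W"
    then obtain x y where xy: "x \<in> P" "y \<in> P" and w: "w = x - y" by (auto simp: W_def)
    obtain F G where
      F: "\<And>e. e \<in> E \<Longrightarrow> F (\<gamma> e (l e)) - F (\<gamma> e 0) = s e * l e + (\<Sum>i<k e. l e - x (e, i))" and
      G: "\<And>e. e \<in> E \<Longrightarrow> G (\<gamma> e (l e)) - G (\<gamma> e 0) = s e * l e + (\<Sum>i<k e. l e - y (e, i))"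
      using PE(1)[OF xy(1)] PE(1)[OF xy(2)] by metis
    have "(F (\<gamma> e (l e)) - G (\<gamma> e (l e))) - (F (\<gamma> e 0) - G (\<gamma> e 0)) = - (\<Sum>i<k e. w (e, i))"
      if "e \<in> E" for e
      using F[OF that] G[OF that] by (simp add: w sum_subtractf algebra_simps)
    then show "w \<in> chip_space k"
      using PE(2)[OF xy(1)] PE(2)[OF xy(2)] unfolding chip_space_def
      by (auto simp: w intro!: exI[of _ "\<lambda>v. F v - G v"])
  qed
  have "y \<in> fun_space.span W" if y: "y \<in> chip_space k" for y
  proof -
    obtain D x where "D \<in> chip_cell k s" "chip_cell_positions k D x"
      using ne open_cellE by (metis ex_in_conv)
    then have x: "x \<in> P" by (auto simp: P_def)
    obtain F where F: "\<And>e. e \<in> E \<Longrightarrow> F (\<gamma> e (l e)) - F (\<gamma> e 0) = s e * l e + (\<Sum>i<k e. l e - x (e, i))"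
      using PE(1)[OF x] by blast
    obtain G where G: "\<And>e. e \<in> E \<Longrightarrow> G (\<gamma> e (l e)) - G (\<gamma> e 0) = - (\<Sum>i<k e. y (e, i))"
      and y0: "\<And>e i. e \<notin> E \<or> k e \<le> i \<Longrightarrow> y (e, i) = 0"
      using y unfolding chip_space_def by blast
    \<comment> \<open>The strict inequalities at \<open>x\<close> persist for small
      \<open>\<epsilon>\<close>, so a positive multiple of the arbitrary displacement
      \<open>y\<close> is a difference of two positions in the cell.\<close>
    define z where "z \<epsilon> = x + fscale \<epsilon> y" for \<epsilon>
    have z: "z \<epsilon> j = x j + \<epsilon> * y j" for \<epsilon> j by (simp add: z_def fscale_def)
    have lim: "((\<lambda>\<epsilon>. z \<epsilon> j) \<longlongrightarrow> x j) (at_right 0)" for j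
    proof -
      have "((\<lambda>\<epsilon>. z \<epsilon> j) \<longlongrightarrow> x j + 0 * y j) (at_right 0)" unfolding z by (intro tendsto_intros)
      then show ?thesis by simp
    qed
    have "\<forall>\<^sub>F \<epsilon> in at_right 0. \<forall>e\<in>E. \<forall>i\<in>{..<k e}. 0 < z \<epsilon> (e, i) \<and> z \<epsilon> (e, i) < l e"
      using PE(3)[OF x] finite_E
      by (intro eventually_ball_finite ballI eventually_conj order_tendstoD[OF lim]) auto
    moreover have "\<forall>\<^sub>F \<epsilon> in at_right 0. \<forall>e\<in>E. \<forall>j\<in>{..<k e}. \<forall>i\<in>{..<j}. 0 < z \<epsilon> (e, j) - z \<epsilon> (e, i)"
    proof (intro eventually_ball_finite ballI)
      fix e i j assume "e \<in> E" "j \<in> {..<k e}" "i \<in> {..<j}"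
      then have "0 < x (e, j) - x (e, i)" using PE(4)[OF x, of e i j] by auto
      then show "\<forall>\<^sub>F \<epsilon> in at_right 0. 0 < z \<epsilon> (e, j) - z \<epsilon> (e, i)"
        by (rule order_tendstoD(1)[OF tendsto_diff[OF lim lim]])
    qed (use finite_E in auto)
    moreover have "\<forall>\<^sub>F \<epsilon> in at_right (0::real). 0 < \<epsilon>" by (rule eventually_at_right_less)
    ultimately have "\<forall>\<^sub>F \<epsilon> in at_right 0. 0 < \<epsilon> \<and>
      (\<forall>e\<in>E. \<forall>i\<in>{..<k e}. 0 < z \<epsilon> (e, i) \<and> z \<epsilon> (e, i) < l e) \<and>
      (\<forall>e\<in>E. \<forall>j\<in>{..<k e}. \<forall>i\<in>{..<j}. 0 < z \<epsilon> (e, j) - z \<epsilon> (e, i))"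
      by eventually_elim blast
    then obtain \<epsilon> where \<epsilon>: "0 < \<epsilon>" "\<forall>e\<in>E. \<forall>i\<in>{..<k e}. 0 < z \<epsilon> (e, i) \<and> z \<epsilon> (e, i) < l e"
      "\<forall>e\<in>E. \<forall>j\<in>{..<k e}. \<forall>i\<in>{..<j}. 0 < z \<epsilon> (e, j) - z \<epsilon> (e, i)"
      using eventually_happens'[OF trivial_limit_at_right_real] by blast
    have "\<exists>D\<in>chip_cell k s. chip_cell_positions k D (z \<epsilon>)"
    proof (rule chip_cellI[OF vc])
      fix e assume e: "e \<in> E"
      show "(F (\<gamma> e (l e)) + \<epsilon> * G (\<gamma> e (l e))) - (F (\<gamma> e 0) + \<epsilon> * G (\<gamma> e 0))
        = s e * l e + (\<Sum>i<k e. l e - z \<epsilon> (e, i))"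
      proof -
        have "(\<Sum>i<k e. l e - z \<epsilon> (e, i)) = (\<Sum>i<k e. l e - x (e, i)) + \<epsilon> * (- (\<Sum>i<k e. y (e, i)))"
          by (simp add: z sum_subtractf sum.distrib sum_distrib_left)
        then show ?thesis using F[OF e] unfolding G[OF e, symmetric] by (simp add: algebra_simps)
      qed
    next
      show "\<And>e i. e \<notin> E \<or> k e \<le> i \<Longrightarrow> z \<epsilon> (e, i) = 0"
        using PE(2)[OF x] y0 by (simp add: z)
    qed (use \<epsilon>(2,3) in auto)
    then have "z \<epsilon> \<in> P" by (simp add: P_def)
    then have "z \<epsilon> - x \<in> W" using x unfolding W_def by blast
    then have "fscale \<epsilon> y \<in> fun_space.span W" by (simp add: z_def fun_space.span_base)
    then have "fscale (1 / \<epsilon>) (fscale \<epsilon> y) \<in> fun_space.span W" by (rule fun_space.span_scale)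
    then show ?thesis using \<epsilon>(1) by simp
  qed
  then have "fun_space.span W = fun_space.span (chip_space k)"
    using fun_space.span_mono[OF sub] subspace_chip_space fun_space.span_eq_iff by blast
  then show ?thesis
    unfolding cell_dim_def affine_dim_def P_def[symmetric] W_def[symmetric] by (metis fun_space.dim_span)
qed

end

section \<open>Closures of open cells\<close>

lemma chip_sum_exists:
  assumes D: "divisor \<Gamma> D" "effective D"
  shows "\<exists>d p. D = chip_sum d p \<and> (\<forall>i<d. p i \<in> \<Gamma>)"
proof -
  have fin: "finite {x. 0 < nat (D x)}"
    using D(1) by (auto simp: divisor_def supp_def elim: rev_finite_subset)
  obtain xs where xs: "mset xs = Abs_multiset (\<lambda>x. nat (D x))" using ex_mset by blast
  have count: "count (mset xs) x = nat (D x)" for x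
    unfolding xs using fin by (subst count_Abs_multiset) auto
  have "D x = chip_sum (length xs) ((!) xs) x" for x
  proof -
    have "card {i. i < length xs \<and> xs ! i = x} = length (filter (\<lambda>y. y = x) xs)"
      by (simp add: length_filter_conv_card)
    also have "\<dots> = nat (D x)"
      unfolding count[symmetric] count_mset count_list_eq_length_filter
      by (intro arg_cong[where f = length] filter_cong) auto
    finally show ?thesis using D(2) by (simp add: chip_sum_def effective_def)
  qed
  moreover have "xs ! i \<in> \<Gamma>" if "i < length xs" for i
  proof -
    have "0 < count (mset xs) (xs ! i)" using that by simp
    then show ?thesis using D(1) unfolding count by (auto simp: divisor_def supp_def)
  qed
  ultimately show ?thesis by (intro exI[of _ "length xs"] exI[of _ "(!) xs"]) (auto simp: fun_eq_iff)
qed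

lemma open_cell_subset_closure: "open_cell \<Gamma> V l \<gamma> D\<^sub>0 m\<^sub>V m\<^sub>E s \<subseteq> cell_closure \<Gamma> D\<^sub>0 (open_cell \<Gamma> V l \<gamma> D\<^sub>0 m\<^sub>V m\<^sub>E s)"
proof
  fix D assume D: "D \<in> open_cell \<Gamma> V l \<gamma> D\<^sub>0 m\<^sub>V m\<^sub>E s"
  then have lin: "D \<in> lin_system \<Gamma> D\<^sub>0" by (simp add: open_cell_def)
  then have "divisor \<Gamma> D" "effective D" by (auto simp: lin_system_def)
  then obtain d p where p: "D = chip_sum d p" "\<forall>i<d. p i \<in> \<Gamma>" using chip_sum_exists by blast
  have "\<exists>d p' q. D = chip_sum d p' \<and> D = chip_sum d q \<and>
      (\<forall>i<d. p' i \<in> \<Gamma> \<and> q i \<in> \<Gamma> \<and> dist (p' i) (q i) < \<epsilon>)" if "0 < \<epsilon>" for \<epsilon>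
    using p that by (intro exI[of _ d] exI[of _ p]) auto
  then show "D \<in> cell_closure \<Gamma> D\<^sub>0 (open_cell \<Gamma> V l \<gamma> D\<^sub>0 m\<^sub>V m\<^sub>E s)"
    using D lin unfolding cell_closure_def by blast
qed

lemma open_cell_cong:
  assumes "\<And>v. v \<in> V \<Longrightarrow> m\<^sub>V v = m\<^sub>V' v" "\<And>e. e \<in> edges \<Gamma> V \<Longrightarrow> m\<^sub>E e = m\<^sub>E' e"
    "\<And>e. e \<in> edges \<Gamma> V \<Longrightarrow> s e = s' e"
  shows "open_cell \<Gamma> V l \<gamma> D\<^sub>0 m\<^sub>V m\<^sub>E s = open_cell \<Gamma> V l \<gamma> D\<^sub>0 m\<^sub>V' m\<^sub>E' s'"
proof -
  have sup: "e \<notin> edges \<Gamma> V \<or> length (m\<^sub>E e) \<le> i \<longleftrightarrow> e \<notin> edges \<Gamma> V \<or> length (m\<^sub>E' e) \<le> i" for e i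
    by (cases "e \<in> edges \<Gamma> V") (simp_all add: assms(2))
  have "chip_positions \<Gamma> V l \<gamma> m\<^sub>E = chip_positions \<Gamma> V l \<gamma> m\<^sub>E'"
    unfolding chip_positions_def sup by (intro ext arg_cong2[where f = "(\<and>)"] refl ball_cong) (simp_all add: assms(2) cong: if_cong)
  moreover have "(\<forall>v\<in>V. D v = int (m\<^sub>V v)) \<longleftrightarrow> (\<forall>v\<in>V. D v = int (m\<^sub>V' v))" for D :: "'a \<Rightarrow> int"
    using assms(1) by simp
  moreover have "(\<forall>e\<in>edges \<Gamma> V. \<exists>\<delta>>0. \<forall>t\<in>{0..<\<delta>}. f (\<gamma> e t) = f (\<gamma> e 0) + of_int (s e) * t) \<longleftrightarrow>
    (\<forall>e\<in>edges \<Gamma> V. \<exists>\<delta>>0. \<forall>t\<in>{0..<\<delta>}. f (\<gamma> e t) = f (\<gamma> e 0) + of_int (s' e) * t)" for f :: "'a \<Rightarrow> real"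
    by (intro ball_cong refl) (simp add: assms(3))
  ultimately show ?thesis unfolding open_cell_def by (simp only:)
qed

section \<open>Stability of the cell under small moves of the chips\<close>

context metric_model
begin

text \<open>The positions on an edge are the support of \<open>D\<close> there in increasing order,
  and the multiplicities are the values of \<open>D\<close> at them. Positivity of the entries
  excludes chips that \<open>D\<close> would not show.\<close>

lemma chip_positions_unique:
  assumes x: "chip_positions \<Gamma> V l \<gamma> m D x" and y: "chip_positions \<Gamma> V l \<gamma> m' D y"
    and pos: "\<And>e k. e \<in> E \<Longrightarrow> k \<in> set (m e) \<Longrightarrow> 0 < k" "\<And>e k. e \<in> E \<Longrightarrow> k \<in> set (m' e) \<Longrightarrow> 0 < k"
    and e: "e \<in> E"
  shows "m e = m' e"
proof -
  have aux: "sorted_wrt (<) (map (\<lambda>i. x (e, i)) [0..<length (m e)]) \<and>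
      set (map (\<lambda>i. x (e, i)) [0..<length (m e)]) = {t. 0 < t \<and> t < l e \<and> D (\<gamma> e t) \<noteq> 0} \<and>
      (\<forall>i<length (m e). D (\<gamma> e (x (e, i))) = int (m e ! i))"
    if x: "chip_positions \<Gamma> V l \<gamma> m D x" and pos: "\<And>k. k \<in> set (m e) \<Longrightarrow> 0 < k" for m x
  proof -
    note b = chip_positions_bounds[OF x e]
    have inj: "x (e, i) = x (e, j) \<longleftrightarrow> i = j" if "i < length (m e)" "j < length (m e)" for i j
      using b(2)[of i j] b(2)[of j i] that by (cases i j rule: linorder_cases) auto
    have val: "D (\<gamma> e (x (e, i))) = int (m e ! i)" if i: "i < length (m e)" for i
    proof -
      have "D (\<gamma> e (x (e, i))) = (\<Sum>j<length (m e). if x (e, j) = x (e, i) then int (m e ! j) else 0)"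
        using b(1)[OF i] by (intro b(3)) auto
      also have "\<dots> = (\<Sum>j<length (m e). if j = i then int (m e ! j) else 0)"
        using inj i by (intro sum.cong) auto
      finally show ?thesis using i by simp
    qed
    have "t \<in> (\<lambda>i. x (e, i)) ` {0..<length (m e)}" if t: "0 < t" "t < l e" "D (\<gamma> e t) \<noteq> 0" for t
    proof (rule ccontr)
      assume "t \<notin> (\<lambda>i. x (e, i)) ` {0..<length (m e)}"
      then have "(\<Sum>i<length (m e). if x (e, i) = t then int (m e ! i) else 0) = 0"
        by (intro sum.neutral) auto
      then show False using b(3)[OF t(1,2)] t(3) by simp
    qed
    moreover have "D (\<gamma> e (x (e, i))) \<noteq> 0" if "i < length (m e)" for i
      using val[OF that] pos[of "m e ! i"] that by simp
    ultimately have "set (map (\<lambda>i. x (e, i)) [0..<length (m e)]) = {t. 0 < t \<and> t < l e \<and> D (\<gamma> e t) \<noteq> 0}"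
      using b(1) by fastforce
    moreover have "sorted_wrt (<) (map (\<lambda>i. x (e, i)) [0..<length (m e)])"
      using b(2) by (auto simp: sorted_wrt_iff_nth_less)
    ultimately show ?thesis using val by blast
  qed
  let ?X = "map (\<lambda>i. x (e, i)) [0..<length (m e)]" and ?Y = "map (\<lambda>i. y (e, i)) [0..<length (m' e)]"
  have X: "sorted_wrt (<) ?X" "set ?X = {t. 0 < t \<and> t < l e \<and> D (\<gamma> e t) \<noteq> 0}"
      "\<And>i. i < length (m e) \<Longrightarrow> D (\<gamma> e (x (e, i))) = int (m e ! i)"
    and Y: "sorted_wrt (<) ?Y" "set ?Y = {t. 0 < t \<and> t < l e \<and> D (\<gamma> e t) \<noteq> 0}"
      "\<And>i. i < length (m' e) \<Longrightarrow> D (\<gamma> e (y (e, i))) = int (m' e ! i)"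
    using aux[OF x pos(1)[OF e]] aux[OF y pos(2)[OF e]] by blast+
  have XY: "?X = ?Y"
    using X(1,2) Y(1,2) by (intro sorted_distinct_set_unique) (auto simp: strict_sorted_iff simp del: set_map)
  then have len: "length (m e) = length (m' e)" by (metis length_map length_upt minus_nat.diff_0)
  show ?thesis
  proof (rule nth_equalityI[OF len])
    fix i assume i: "i < length (m e)"
    have "?X ! i = ?Y ! i" using XY by simp
    then have "x (e, i) = y (e, i)" using i len by simp
    then show "m e ! i = m' e ! i" using X(3)[OF i] Y(3)[of i] i len by simp
  qed
qed

text \<open>The chart at an inner point has the two rays along the edge as its arms, so within a
  small ball the metric of \<open>\<Gamma>\<close> is the edge coordinate.\<close>

lemma near_inner:
  assumes e: "e \<in> E" "0 < t" "t < l e"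
  obtains \<epsilon> where "0 < \<epsilon>" "\<And>y. y \<in> \<Gamma> \<Longrightarrow> dist (\<gamma> e t) y < \<epsilon> \<Longrightarrow>
    \<exists>t'. 0 < t' \<and> t' < l e \<and> \<bar>t' - t\<bar> = dist (\<gamma> e t) y \<and> y = \<gamma> e t'"
proof -
  obtain n r \<phi> where ch: "star_chart \<Gamma> (\<gamma> e t) n r \<phi>" using chart_exists[OF edge_point(2)[OF e]] by blast
  obtain \<beta> where \<beta>: "bij_betw \<beta> {..<n} (dirs (\<gamma> e t))"
    "\<And>i. i < n \<Longrightarrow> \<exists>\<delta>>0. \<forall>s. 0 \<le> s \<longrightarrow> s < \<delta> \<longrightarrow> \<phi> i s = ray (\<beta> i) s"
    using chart_dirs[OF ch] by blast
  then obtain \<delta> where \<delta>: "\<And>i. i < n \<Longrightarrow> 0 < \<delta> i"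
    "\<And>i s. i < n \<Longrightarrow> 0 \<le> s \<Longrightarrow> s < \<delta> i \<Longrightarrow> \<phi> i s = ray (\<beta> i) s" by metis
  define \<epsilon> where "\<epsilon> = Min (insert (min r (min t (l e - t))) (\<delta> ` {..<n}))"
  have "0 < \<epsilon>" using \<delta>(1) star_chart_pos[OF ch] e by (auto simp: \<epsilon>_def)
  have "\<epsilon> \<le> min r (min t (l e - t))" unfolding \<epsilon>_def by (intro Min_le) auto
  then have \<epsilon>: "\<epsilon> \<le> r" "\<epsilon> \<le> t" "\<epsilon> \<le> l e - t" by auto
  have \<epsilon>\<delta>: "\<epsilon> \<le> \<delta> i" if "i < n" for i unfolding \<epsilon>_def using that by (intro Min_le) auto
  have "\<exists>t'. 0 < t' \<and> t' < l e \<and> \<bar>t' - t\<bar> = dist (\<gamma> e t) y \<and> y = \<gamma> e t'"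
    if y: "y \<in> \<Gamma>" "dist (\<gamma> e t) y < \<epsilon>" for y
  proof (cases "y = \<gamma> e t")
    case True
    then show ?thesis using e by auto
  next
    case False
    define s where "s = dist (\<gamma> e t) y"
    have s: "0 < s" "s < \<epsilon>" using False y by (auto simp: s_def)
    obtain i where i: "i < n" "y = \<phi> i s"
      using star_chart_arm[OF ch y(1) _ False] y(2) \<epsilon>(1) by (auto simp: s_def)
    have "y = ray (\<beta> i) s" using \<delta>(2)[OF i(1), of s] \<epsilon>\<delta>[OF i(1)] s i(2) by simp
    moreover have "\<beta> i \<in> {(e, t, 1), (e, t, -1)}"
      using \<beta>(1) i(1) dirs_inner[OF e] by (auto simp: bij_betw_def)
    ultimately consider "y = \<gamma> e (t + s)" | "y = \<gamma> e (t - s)" by auto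
    then show ?thesis
    proof cases
      case 1
      then show ?thesis using s \<epsilon> e unfolding s_def[symmetric] by (intro exI[of _ "t + s"]) simp
    next
      case 2
      then show ?thesis using s \<epsilon> e unfolding s_def[symmetric] by (intro exI[of _ "t - s"]) simp
    qed
  qed
  then show thesis using that \<open>0 < \<epsilon>\<close> by blast
qed

lemma chip_positions_simple:
  assumes x: "chip_cell_positions k D x" and e: "e \<in> E"
  shows "i < k e \<Longrightarrow> 0 < x (e, i) \<and> x (e, i) < l e"
    and "i < j \<Longrightarrow> j < k e \<Longrightarrow> x (e, i) < x (e, j)"
    and "0 < t \<Longrightarrow> t < l e \<Longrightarrow> D (\<gamma> e t) = int (card {i. i < k e \<and> x (e, i) = t})"
proof -
  assume "0 < t" "t < l e"
  then have "D (\<gamma> e t) = (\<Sum>i<k e. if x (e, i) = t then int (replicate (k e) 1 ! i) else 0)"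
    using chip_positions_bounds(3)[OF x e, of t] by simp
  also have "\<dots> = (\<Sum>i<k e. of_bool (x (e, i) = t))" by (intro sum.cong) auto
  also have "\<dots> = int (card ({..<k e} \<inter> {i. x (e, i) = t}))" by simp
  also have "{..<k e} \<inter> {i. x (e, i) = t} = {i. i < k e \<and> x (e, i) = t}" by auto
  finally show "D (\<gamma> e t) = int (card {i. i < k e \<and> x (e, i) = t})" .
qed (use chip_positions_bounds[OF x e] in auto)

text \<open>A divisor close to \<open>D\<close> has its chips close to those of \<open>D\<close>; as these are simple and lie
  inside edges, the combinatorial type cannot change.\<close>

lemma nearby_chip_positions:
  assumes x: "chip_cell_positions k D x" and D0: "\<And>v. v \<in> V \<Longrightarrow> D v = 0"
    and \<eta>: "\<And>e i y. e \<in> E \<Longrightarrow> i < k e \<Longrightarrow> y \<in> \<Gamma> \<Longrightarrow> dist (\<gamma> e (x (e, i))) y < \<eta> \<Longrightarrow>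
        \<exists>t'. 0 < t' \<and> t' < l e \<and> \<bar>t' - x (e, i)\<bar> < \<eta> \<and> y = \<gamma> e t'"
    and sep: "\<And>e i j. e \<in> E \<Longrightarrow> i < j \<Longrightarrow> j < k e \<Longrightarrow> 2 * \<eta> < x (e, j) - x (e, i)"
    and D: "D = chip_sum d p" and D': "D' = chip_sum d q"
    and pq: "\<And>i. i < d \<Longrightarrow> p i \<in> \<Gamma> \<and> q i \<in> \<Gamma> \<and> dist (p i) (q i) < \<eta>"
  obtains x' where "chip_cell_positions k D' x'" "\<And>v. v \<in> V \<Longrightarrow> D' v = 0"
    "\<And>e i. e \<in> E \<Longrightarrow> i < k e \<Longrightarrow> \<bar>x' (e, i) - x (e, i)\<bar> < \<eta>"
proof -
  note xs = chip_positions_simple[OF x]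
  define I where "I = (SIGMA e:E. {..<k e})"
  define pt where "pt c = \<gamma> (fst c) (x c)" for c
  have x_inj: "x (e, i) = x (e, j) \<longleftrightarrow> i = j" if "e \<in> E" "i < k e" "j < k e" for e i j
    using xs(2)[of e i j] xs(2)[of e j i] that by (cases i j rule: linorder_cases) auto
  have pt_inj: "c = c'" if c: "c \<in> I" "c' \<in> I" "pt c = pt c'" for c c'
  proof -
    obtain e i e' i' where cc: "c = (e, i)" "c' = (e', i')" by (cases c, cases c')
    have ei: "e \<in> E" "i < k e" "e' \<in> E" "i' < k e'" using c by (auto simp: I_def cc)
    have "e = e' \<and> x c = x c'"
      using edge_point_unique[OF ei(1,3), of "x c" "x c'"] xs(1)[OF ei(1,2)] xs(1)[OF ei(3,4)] c(3)
      by (auto simp: pt_def cc)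
    then show ?thesis using x_inj ei by (auto simp: cc)
  qed
  have mult1: "card {j. j < d \<and> p j = pt c} = 1" if c: "c \<in> I" for c
  proof -
    obtain e i where cc: "c = (e, i)" by (cases c)
    have ei: "e \<in> E" "i < k e" using c by (auto simp: I_def cc)
    have "{j. j < k e \<and> x (e, j) = x (e, i)} = {i}" using x_inj ei by auto
    then have "D (pt c) = 1" using xs(3)[OF ei(1), of "x c"] xs(1)[OF ei] by (simp add: pt_def cc)
    then show ?thesis by (simp add: D chip_sum_def)
  qed
  have "\<exists>c\<in>I. p j = pt c" if j: "j < d" for j
  proof -
    have "j \<in> {i. i < d \<and> p i = p j}" using j by simp
    then have "card {i. i < d \<and> p i = p j} \<noteq> 0" by (subst card_0_eq) auto
    then have nz: "D (p j) \<noteq> 0" by (simp add: D chip_sum_def)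
    have "p j \<in> \<Gamma>" using pq[OF j] by simp
    then show ?thesis
    proof (cases rule: point_cases)
      case 1
      then show ?thesis using D0 nz by blast
    next
      case (2 e t)
      then have "card {i. i < k e \<and> x (e, i) = t} \<noteq> 0" using xs(3)[OF 2(1-3)] nz by simp
      then have "{i. i < k e \<and> x (e, i) = t} \<noteq> {}" by (metis card.empty)
      then obtain i where "i < k e" "x (e, i) = t" by blast
      then show ?thesis using 2 by (intro bexI[of _ "(e, i)"]) (auto simp: pt_def I_def)
    qed
  qed
  then obtain a where a: "\<And>j. j < d \<Longrightarrow> a j \<in> I \<and> p j = pt (a j)" by metis
  \<comment> \<open>As the chips of \<open>D\<close> are simple and distinct, the list
    \<open>p\<close> enumerates them without repetition. The matching with \<open>q\<close>
    therefore assigns to each chip of \<open>D\<close> exactly one chip of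
    \<open>D'\<close>.\<close>
  have bij: "bij_betw a {..<d} I"
  proof (rule bij_betw_imageI)
    show "inj_on a {..<d}"
    proof (rule inj_onI)
      fix i j assume ij: "i \<in> {..<d}" "j \<in> {..<d}" "a i = a j"
      then have "card {j. j < d \<and> p j = pt (a i)} = 1" using mult1 a by simp
      then obtain m where m: "{j. j < d \<and> p j = pt (a i)} = {m}" by (rule card_1_singletonE)
      have "i \<in> {m}" "j \<in> {m}" unfolding m[symmetric] using ij a[of i] a[of j] by simp_all
      then show "i = j" by simp
    qed
    have "c \<in> a ` {..<d}" if c: "c \<in> I" for c
    proof -
      obtain j where j: "{j. j < d \<and> p j = pt c} = {j}" using mult1[OF c] by (rule card_1_singletonE)
      have "j \<in> {j. j < d \<and> p j = pt c}" unfolding j by simp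
      then have "j < d" "p j = pt c" by simp_all
      then show ?thesis using pt_inj[of "a j" c] a[of j] c by auto
    qed
    then show "a ` {..<d} = I" using a by auto
  qed
  define b where "b = inv_into {..<d} a"
  have b: "b c < d" "a (b c) = c" if "c \<in> I" for c
  proof -
    have "c \<in> a ` {..<d}" using that bij by (simp add: bij_betw_def)
    then show "b c < d" "a (b c) = c"
      unfolding b_def using inv_into_into[of c a "{..<d}"] f_inv_into_f[of c a "{..<d}"] by auto
  qed
  have bij_b: "bij_betw b I {..<d}" unfolding b_def by (rule bij_betw_inv_into[OF bij])
  have "\<exists>t'. 0 < t' \<and> t' < l (fst c) \<and> \<bar>t' - x c\<bar> < \<eta> \<and> q (b c) = \<gamma> (fst c) t'" if c: "c \<in> I" for c
  proof -
    obtain e i where cc: "c = (e, i)" by (cases c)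
    have ei: "e \<in> E" "i < k e" using c by (auto simp: I_def cc)
    have "p (b c) = pt c" using a[OF b(1)[OF c]] b(2)[OF c] by simp
    then have "dist (\<gamma> e (x (e, i))) (q (b c)) < \<eta>" using pq[OF b(1)[OF c]] by (simp add: pt_def cc)
    then show ?thesis using \<eta>[OF ei] pq[OF b(1)[OF c]] by (auto simp: cc)
  qed
  then obtain x0 where x0: "\<And>c. c \<in> I \<Longrightarrow> 0 < x0 c \<and> x0 c < l (fst c) \<and> \<bar>x0 c - x c\<bar> < \<eta> \<and> q (b c) = \<gamma> (fst c) (x0 c)"
    by metis
  \<comment> \<open>\<open>chip_positions\<close> demands the value 0 on all coordinates that belong
    to no chip.\<close>
  define x' where "x' c = (if c \<in> I then x0 c else 0)" for c
  have x': "0 < x' (e, i)" "x' (e, i) < l e" "\<bar>x' (e, i) - x (e, i)\<bar> < \<eta>" "q (b (e, i)) = \<gamma> e (x' (e, i))"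
    if "e \<in> E" "i < k e" for e i
    using x0[of "(e, i)"] that by (auto simp: x'_def I_def)
  have count: "D' y = int (card {c \<in> I. q (b c) = y})" for y
  proof -
    have im: "b ` {c \<in> I. q (b c) = y} = {j. j < d \<and> q j = y}"
    proof (intro equalityI subsetI)
      fix j assume j: "j \<in> {j. j < d \<and> q j = y}"
      then have "j \<in> b ` I" using bij_b by (simp add: bij_betw_def)
      then show "j \<in> b ` {c \<in> I. q (b c) = y}" using j by auto
    qed (use b in auto)
    have "inj_on b {c \<in> I. q (b c) = y}"
      using bij_b by (auto simp: bij_betw_def elim: inj_on_subset)
    then have "card {j. j < d \<and> q j = y} = card {c \<in> I. q (b c) = y}"
      unfolding im[symmetric] by (rule card_image)
    then show ?thesis by (simp add: D' chip_sum_def)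
  qed
  have "D' v = 0" if "v \<in> V" for v
  proof -
    have "q (b c) \<noteq> v" if "c \<in> I" for c
      using x0[OF that] that edge_point(3)[of "fst c" "x0 c"] \<open>v \<in> V\<close> by (auto simp: I_def)
    then have "{c \<in> I. q (b c) = v} = {}" by auto
    then show ?thesis unfolding count by (simp only: card.empty of_nat_0)
  qed
  moreover have "chip_cell_positions k D' x'"
    unfolding chip_positions_def length_replicate
  proof (intro conjI allI ballI impI)
    fix e i assume "e \<notin> E \<or> k e \<le> i"
    then show "x' (e, i) = 0" by (auto simp: x'_def I_def)
  next
    fix e i j assume e: "e \<in> E" and ij: "i < j" "j < k e"
    show "x' (e, i) < x' (e, j)"
      using x'(3)[OF e, of i] x'(3)[OF e ij(2)] sep[OF e ij] ij by linarith
  next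
    fix e t assume e: "e \<in> E" and t: "t \<in> {0<..<l e}"
    have "{c \<in> I. q (b c) = \<gamma> e t} = Pair e ` {i. i < k e \<and> x' (e, i) = t}"
    proof (intro equalityI subsetI)
      fix c assume c: "c \<in> {c \<in> I. q (b c) = \<gamma> e t}"
      obtain e' i where cc: "c = (e', i)" by (cases c)
      have ei: "e' \<in> E" "i < k e'" using c by (auto simp: I_def cc)
      have "\<gamma> e' (x' (e', i)) = \<gamma> e t" using c x'(4)[OF ei] by (simp add: cc)
      then have "e' = e \<and> x' (e', i) = t"
        using edge_point_unique[OF ei(1) e, of "x' (e', i)" t] x'(1,2)[OF ei] t by auto
      then show "c \<in> Pair e ` {i. i < k e \<and> x' (e, i) = t}" using ei by (auto simp: cc)
    qed (use x'(4) e in \<open>auto simp: I_def\<close>)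
    then have "D' (\<gamma> e t) = int (card ({..<k e} \<inter> {i. x' (e, i) = t}))"
      unfolding count by (simp add: card_image inj_on_def Int_def)
    also have "\<dots> = (\<Sum>i<k e. of_bool (x' (e, i) = t))" by simp
    also have "\<dots> = (\<Sum>i<k e. if x' (e, i) = t then int (replicate (k e) 1 ! i) else 0)"
      by (intro sum.cong) auto
    finally show "D' (\<gamma> e t) = (\<Sum>i<k e. if x' (e, i) = t then int (replicate (k e) 1 ! i) else 0)" .
  qed (use x' in auto)
  ultimately show thesis using that x'(3) by blast
qed

text \<open>The difference of the initial slopes of two functions with nearby divisors is an integral
  circulation \<open>z\<close>, and \<open>\<Sum>z\<^sup>2 l\<close> is as small as the displacement of the chips; so \<open>z = 0\<close>.\<close>

lemma slopes_eq:
  assumes f: "rational_function \<Gamma> f" "\<And>e. e \<in> E \<Longrightarrow> slope f (e, 0, 1) (of_int (s e))"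
      "chip_cell_positions k (canonical \<Gamma> + div_of \<Gamma> f) x"
      "\<And>v. v \<in> V \<Longrightarrow> (canonical \<Gamma> + div_of \<Gamma> f) v = 0"
    and f': "rational_function \<Gamma> f'" "\<And>e. e \<in> E \<Longrightarrow> slope f' (e, 0, 1) (of_int (s' e))"
      "chip_cell_positions k (canonical \<Gamma> + div_of \<Gamma> f') x'"
      "\<And>v. v \<in> V \<Longrightarrow> (canonical \<Gamma> + div_of \<Gamma> f') v = 0"
    and near: "\<And>e i. e \<in> E \<Longrightarrow> i < k e \<Longrightarrow> \<bar>x' (e, i) - x (e, i)\<bar> < \<eta>"
    and \<eta>: "\<And>e. e \<in> E \<Longrightarrow> real (k e) * \<eta> < l e"
    and e: "e \<in> E"
  shows "s' e = s e"
proof -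
  define z where "z e = s' e - s e" for e
  define h where "h v = f' v - f v" for v
  define \<theta> where "\<theta> e = (\<Sum>i<k e. x (e, i) - x' (e, i))" for e
  have end_slope: "slope g (e, l e, -1) (of_int (- r e - int (k e)))"
    if "rational_function \<Gamma> g" "\<And>e. e \<in> E \<Longrightarrow> slope g (e, 0, 1) (of_int (r e))"
      "chip_cell_positions k (canonical \<Gamma> + div_of \<Gamma> g) y" "e \<in> E" for g r y e
    using cell_equation(2)[OF that(1,3,4) that(2)[OF that(4)]] by simp
  have diff: "h (\<gamma> e (l e)) - h (\<gamma> e 0) = z e * l e + \<theta> e" if e: "e \<in> E" for e
    using cell_equation(1)[OF f(1,3) e f(2)[OF e]] cell_equation(1)[OF f'(1,3) e f'(2)[OF e]]
    by (simp add: h_def z_def \<theta>_def sum_subtractf algebra_simps)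
  have "boundary (\<lambda>e. real_of_int (z e)) v = 0" if v: "v \<in> V" for v
  proof -
    have "(\<Sum>e\<in>E. of_bool (\<gamma> e 0 = v) * (1 + s e) + of_bool (\<gamma> e (l e) = v) * (1 + (- s e - int (k e)))) = 2"
      using div_at_vertex[OF v f(2) end_slope[OF f(1-3)]] f(4)[OF v] by simp
    moreover have "(\<Sum>e\<in>E. of_bool (\<gamma> e 0 = v) * (1 + s' e) + of_bool (\<gamma> e (l e) = v) * (1 + (- s' e - int (k e)))) = 2"
      using div_at_vertex[OF v f'(2) end_slope[OF f'(1-3)]] f'(4)[OF v] by simp
    ultimately have "0 = (\<Sum>e\<in>E. (of_bool (\<gamma> e 0 = v) * (1 + s e) + of_bool (\<gamma> e (l e) = v) * (1 + (- s e - int (k e))))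
        - (of_bool (\<gamma> e 0 = v) * (1 + s' e) + of_bool (\<gamma> e (l e) = v) * (1 + (- s' e - int (k e)))))"
      by (simp add: sum_subtractf)
    also have "\<dots> = (\<Sum>e\<in>E. z e * (of_bool (\<gamma> e (l e) = v) - of_bool (\<gamma> e 0 = v)))"
      by (intro sum.cong) (auto simp: z_def algebra_simps)
    finally have "real_of_int 0 = real_of_int (\<Sum>e\<in>E. z e * (of_bool (\<gamma> e (l e) = v) - of_bool (\<gamma> e 0 = v)))"
      by (rule arg_cong)
    then show ?thesis by (simp add: boundary_def)
  qed
  \<comment> \<open>The circulation \<open>z\<close> is orthogonal to the differences of
    \<open>h\<close>.\<close>
  then have "(\<Sum>e\<in>E. real_of_int (z e) * (h (\<gamma> e (l e)) - h (\<gamma> e 0))) = 0"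
    by (subst sum_boundary[symmetric]) simp
  then have sum0: "(\<Sum>e\<in>E. real_of_int (z e) * (z e * l e + \<theta> e)) = 0"
    using diff by simp
  have \<theta>: "\<bar>\<theta> e\<bar> < l e" if e: "e \<in> E" for e
  proof -
    have "\<bar>\<theta> e\<bar> \<le> (\<Sum>i<k e. \<bar>x (e, i) - x' (e, i)\<bar>)" unfolding \<theta>_def by (rule sum_abs)
    also have "\<dots> \<le> (\<Sum>i<k e. \<eta>)"
      using near[OF e] by (intro sum_mono) (force simp: abs_minus_commute)
    also have "\<dots> < l e" using \<eta>[OF e] by simp
    finally show ?thesis .
  qed
  \<comment> \<open>A nonzero integer \<open>z e\<close> satisfies
    \<open>\<bar>z e\<bar> * l e \<ge> l e > \<bar>\<theta> e\<bar>\<close>, so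
    \<open>z e * l e + \<theta> e\<close> has the sign of \<open>z e\<close>.\<close>
  have pos: "0 < real_of_int (z e) * (z e * l e + \<theta> e)" if e: "e \<in> E" "z e \<noteq> 0" for e
  proof -
    have "1 \<le> \<bar>real_of_int (z e)\<bar>" using e(2) by linarith
    then have "l e \<le> \<bar>real_of_int (z e)\<bar> * l e" using edge_length[OF e(1)] by simp
    then have "\<bar>\<theta> e\<bar> < \<bar>real_of_int (z e)\<bar> * \<bar>l e\<bar>"
      using \<theta>[OF e(1)] edge_length[OF e(1)] by linarith
    then have "\<bar>\<theta> e\<bar> < \<bar>z e * l e\<bar>" by (simp only: abs_mult)
    then show ?thesis
      using e(2) edge_length[OF e(1)] by (cases "0 < z e") (auto simp: zero_less_mult_iff abs_mult)
  qed
  have "\<forall>e\<in>E. real_of_int (z e) * (z e * l e + \<theta> e) = 0"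
    using sum0 pos finite_E by (subst (asm) sum_nonneg_eq_0_iff) (force intro: less_imp_le)+
  then have "z e = 0" using pos[OF e] e by force
  then show ?thesis by (simp add: z_def)
qed

text \<open>The other open cell contains some \<open>D'\<close> close to \<open>D\<close>. It has
  the same chips per edge and none at the vertices, and the slopes agree as well, so both open cells
  are given by the same data on the model. Maximality follows, since one common point already forces
  equality.\<close>

lemma chip_cell_in_closure:
  assumes D: "D \<in> chip_cell k s" and cl: "D \<in> cell_closure \<Gamma> (canonical \<Gamma>) (open_cell \<Gamma> V l \<gamma> (canonical \<Gamma>) m\<^sub>V m\<^sub>E s')"
    and data: "cell_data \<Gamma> V m\<^sub>E"
  shows "open_cell \<Gamma> V l \<gamma> (canonical \<Gamma>) m\<^sub>V m\<^sub>E s' = chip_cell k s"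
proof -
  obtain f x where f: "rational_function \<Gamma> f" "D = canonical \<Gamma> + div_of \<Gamma> f"
    "\<And>v. v \<in> V \<Longrightarrow> D v = int 0" "chip_cell_positions k D x"
    "\<And>e. e \<in> E \<Longrightarrow> slope f (e, 0, 1) (of_int (s e))"
    using open_cellE[OF D] by metis
  note xs = chip_positions_simple[OF f(4)]
  have ev: "\<forall>\<^sub>F \<eta> in at_right 0. \<eta> < c" if "0 < c" for c :: real
    using that unfolding eventually_at_right_field by blast
  define ok where "ok e i \<eta> \<longleftrightarrow> (\<forall>y\<in>\<Gamma>. dist (\<gamma> e (x (e, i))) y < \<eta> \<longrightarrow>
      (\<exists>t'. 0 < t' \<and> t' < l e \<and> \<bar>t' - x (e, i)\<bar> < \<eta> \<and> y = \<gamma> e t'))" for e i \<eta>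
  have "\<forall>\<^sub>F \<eta> in at_right 0. ok e i \<eta>" if ei: "e \<in> E" "i < k e" for e i
  proof -
    obtain \<epsilon> where \<epsilon>: "0 < \<epsilon>" "\<And>y. y \<in> \<Gamma> \<Longrightarrow> dist (\<gamma> e (x (e, i))) y < \<epsilon> \<Longrightarrow>
      \<exists>t'. 0 < t' \<and> t' < l e \<and> \<bar>t' - x (e, i)\<bar> = dist (\<gamma> e (x (e, i))) y \<and> y = \<gamma> e t'"
      using near_inner[OF ei(1)] xs(1)[OF ei] by metis
    have "ok e i \<eta>" if "\<eta> < \<epsilon>" for \<eta>
      unfolding ok_def using \<epsilon>(2) that by (metis order_less_trans)
    then show ?thesis using ev[OF \<epsilon>(1)] by (rule eventually_mono[rotated])
  qed
  then have "\<forall>\<^sub>F \<eta> in at_right 0. \<forall>e\<in>E. \<forall>i\<in>{..<k e}. ok e i \<eta>"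
    using finite_E by (intro eventually_ball_finite ballI) auto
  moreover have "\<forall>\<^sub>F \<eta> in at_right 0. \<forall>e\<in>E. \<forall>j\<in>{..<k e}. \<forall>i\<in>{..<j}. \<eta> < (x (e, j) - x (e, i)) / 2"
    using finite_E xs(2) by (intro eventually_ball_finite ballI ev) auto
  \<comment> \<open>This keeps the total displacement of the chips on an edge below its length, as
    the comparison of slopes requires; the added 1 covers edges without chips.\<close>
  moreover have "\<forall>\<^sub>F \<eta> in at_right 0. \<forall>e\<in>E. \<eta> < l e / (real (k e) + 1)"
    using finite_E edge_length by (intro eventually_ball_finite ballI ev) (auto intro: divide_pos_pos)
  moreover have "\<forall>\<^sub>F \<eta> in at_right (0::real). 0 < \<eta>" by (rule eventually_at_right_less)
  ultimately have "\<forall>\<^sub>F \<eta> in at_right 0. 0 < \<eta> \<and> (\<forall>e\<in>E. \<forall>i\<in>{..<k e}. ok e i \<eta>) \<and>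
      (\<forall>e\<in>E. \<forall>j\<in>{..<k e}. \<forall>i\<in>{..<j}. \<eta> < (x (e, j) - x (e, i)) / 2) \<and>
      (\<forall>e\<in>E. \<eta> < l e / (real (k e) + 1))"
    by eventually_elim blast
  then obtain \<eta> where \<eta>: "0 < \<eta>" "\<forall>e\<in>E. \<forall>i\<in>{..<k e}. ok e i \<eta>"
      "\<forall>e\<in>E. \<forall>j\<in>{..<k e}. \<forall>i\<in>{..<j}. \<eta> < (x (e, j) - x (e, i)) / 2"
      "\<forall>e\<in>E. \<eta> < l e / (real (k e) + 1)"
    using eventually_happens'[OF trivial_limit_at_right_real] by blast
  obtain D' d p q where D': "D' \<in> open_cell \<Gamma> V l \<gamma> (canonical \<Gamma>) m\<^sub>V m\<^sub>E s'"
    "D = chip_sum d p" "D' = chip_sum d q" "\<And>i. i < d \<Longrightarrow> p i \<in> \<Gamma> \<and> q i \<in> \<Gamma> \<and> dist (p i) (q i) < \<eta>"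
    using cl \<eta>(1) unfolding cell_closure_def by blast
  have near: "\<exists>t'. 0 < t' \<and> t' < l e \<and> \<bar>t' - x (e, i)\<bar> < \<eta> \<and> y = \<gamma> e t'"
    if "e \<in> E" "i < k e" "y \<in> \<Gamma>" "dist (\<gamma> e (x (e, i))) y < \<eta>" for e i y
    using \<eta>(2) that unfolding ok_def by blast
  have sep: "2 * \<eta> < x (e, j) - x (e, i)" if "e \<in> E" "i < j" "j < k e" for e i j
    using \<eta>(3) that by (metis lessThan_iff less_divide_eq_numeral1(1) mult.commute)
  have D0: "D v = 0" if "v \<in> V" for v using f(3)[OF that] by simp
  obtain x' where x': "chip_cell_positions k D' x'" "\<And>v. v \<in> V \<Longrightarrow> D' v = 0"
    "\<And>e i. e \<in> E \<Longrightarrow> i < k e \<Longrightarrow> \<bar>x' (e, i) - x (e, i)\<bar> < \<eta>"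
    using nearby_chip_positions[OF f(4) D0 near sep D'(2-4)] by blast
  obtain f' x'' where f': "rational_function \<Gamma> f'" "D' = canonical \<Gamma> + div_of \<Gamma> f'"
    "\<And>v. v \<in> V \<Longrightarrow> D' v = int (m\<^sub>V v)" "chip_positions \<Gamma> V l \<gamma> m\<^sub>E D' x''"
    "\<And>e. e \<in> E \<Longrightarrow> slope f' (e, 0, 1) (of_int (s' e))"
    using open_cellE[OF D'(1)] by metis
  have mV: "m\<^sub>V v = 0" if "v \<in> V" for v using f'(3)[OF that] x'(2)[OF that] by simp
  have mE: "m\<^sub>E e = replicate (k e) 1" if "e \<in> E" for e
    using data by (intro chip_positions_unique[OF f'(4) x'(1) _ _ that]) (auto simp: cell_data_def)
  have \<eta>l: "real (k e) * \<eta> < l e" if "e \<in> E" for e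
  proof -
    have "\<eta> * (real (k e) + 1) < l e" using \<eta>(4) that by (simp add: pos_less_divide_eq)
    then show ?thesis using \<eta>(1) by (simp add: algebra_simps)
  qed
  have "s' e = s e" if "e \<in> E" for e
    by (rule slopes_eq[OF f(1,5) f(4)[unfolded f(2)] D0[unfolded f(2)]
          f'(1,5) x'(1)[unfolded f'(2)] x'(2)[unfolded f'(2)] x'(3) \<eta>l that])
  then show ?thesis by (intro open_cell_cong mV mE)
qed

end

theorem proposition2p85:
  fixes \<Gamma> V :: "'a::metric_space set"
    and l :: "'a set \<Rightarrow> real" and \<gamma> :: "'a set \<Rightarrow> real \<Rightarrow> 'a"
  assumes "metric_graph \<Gamma>"
    and "model \<Gamma> V l \<gamma>"
    and "loopless \<Gamma> V l \<gamma>"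
    and "genus \<Gamma> V l \<gamma> \<ge> 1"
  shows "\<exists>\<sigma> m\<^sub>V m\<^sub>E s.
      cell_data \<Gamma> V m\<^sub>E \<and>
      open_cell \<Gamma> V l \<gamma> (canonical \<Gamma>) m\<^sub>V m\<^sub>E s \<noteq> {} \<and>
      \<sigma> = cell_closure \<Gamma> (canonical \<Gamma>) (open_cell \<Gamma> V l \<gamma> (canonical \<Gamma>) m\<^sub>V m\<^sub>E s) \<and>
      maximal_cell \<Gamma> V l \<gamma> (canonical \<Gamma>) \<sigma> \<and>
      int (cell_dim \<Gamma> V l \<gamma> (canonical \<Gamma>) m\<^sub>V m\<^sub>E s) = int (genus \<Gamma> V l \<gamma>) - 1 \<and>
      (\<forall>D\<in>open_cell \<Gamma> V l \<gamma> (canonical \<Gamma>) m\<^sub>V m\<^sub>E s. supp D \<inter> V = {})"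
proof -
  interpret metric_model \<Gamma> V l \<gamma> by unfold_locales (rule assms)+
  \<comment> \<open>Here positive genus enters: without a nonzero cycle there is nothing from which
    to start the layout.\<close>
  have "\<exists>c. c \<in> cycles \<and> c \<noteq> 0"
  proof (rule ccontr)
    assume "\<not> ?thesis"
    then have "cycles \<subseteq> fun_space.span {}" by auto
    then have "fun_space.dim cycles \<le> card ({} :: ('a set \<Rightarrow> real) set)"
      by (rule fun_space.dim_le_card) simp
    then show False using assms(4) genus_eq by simp
  qed
  then obtain c where c: "c \<in> cycles" "c \<noteq> 0" by blast
  obtain k s x F where
    vc: "\<And>v. v \<in> V \<Longrightarrow> (\<Sum>e\<in>E. of_bool (\<gamma> e 0 = v) * (1 + s e)
      + of_bool (\<gamma> e (l e) = v) * (1 - s e - int (k e))) = 2"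
    and x: "\<And>e i. e \<in> E \<Longrightarrow> i < k e \<Longrightarrow> 0 < x (e, i) \<and> x (e, i) < l e"
      "\<And>e i j. e \<in> E \<Longrightarrow> i < j \<Longrightarrow> j < k e \<Longrightarrow> x (e, i) < x (e, j)"
      "\<And>e i. e \<notin> E \<or> k e \<le> i \<Longrightarrow> x (e, i) = 0"
    and F: "\<And>e. e \<in> E \<Longrightarrow> F (\<gamma> e (l e)) - F (\<gamma> e 0) = s e * l e + (\<Sum>i<k e. l e - x (e, i))"
    and dim: "fun_space.dim (chip_space k) + 1 = fun_space.dim cycles"
    by (rule chip_pattern_exists[OF _ c]; (rule edge_across that; assumption))
  define \<sigma> where "\<sigma> = cell_closure \<Gamma> (canonical \<Gamma>) (chip_cell k s)"
  obtain D where D: "D \<in> chip_cell k s" using chip_cellI[OF vc x F] by blast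
  have data: "cell_data \<Gamma> V (\<lambda>e. replicate (k e) 1)" by (simp add: cell_data_def)
  have "maximal_cell \<Gamma> V l \<gamma> (canonical \<Gamma>) \<sigma>"
    unfolding maximal_cell_def
  proof (intro conjI ballI impI)
    show "\<sigma> \<in> cells \<Gamma> V l \<gamma> (canonical \<Gamma>)" unfolding cells_def \<sigma>_def using data D by blast
  next
    fix \<tau> assume "\<tau> \<in> cells \<Gamma> V l \<gamma> (canonical \<Gamma>)" and sub: "\<sigma> \<subseteq> \<tau>"
    then obtain m\<^sub>V m\<^sub>E s' where
      \<tau>: "\<tau> = cell_closure \<Gamma> (canonical \<Gamma>) (open_cell \<Gamma> V l \<gamma> (canonical \<Gamma>) m\<^sub>V m\<^sub>E s')"
      and m\<^sub>E: "cell_data \<Gamma> V m\<^sub>E" unfolding cells_def by blast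
    \<comment> \<open>Of the inclusion of cells, only the membership of this one point of the open
      cell is needed.\<close>
    have "D \<in> \<tau>" using D sub open_cell_subset_closure unfolding \<sigma>_def by blast
    then show "\<tau> = \<sigma>" using chip_cell_in_closure[OF D _ m\<^sub>E, of m\<^sub>V s'] unfolding \<sigma>_def \<tau> by simp
  qed
  moreover have "int (cell_dim \<Gamma> V l \<gamma> (canonical \<Gamma>) (\<lambda>_. 0) (\<lambda>e. replicate (k e) 1) s)
      = int (genus \<Gamma> V l \<gamma>) - 1"
    using cell_dim_chip_cell[OF vc] D dim genus_eq by force
  moreover have "\<forall>D\<in>chip_cell k s. supp D \<inter> V = {}"
    by (auto simp: open_cell_def supp_def)
  ultimately show ?thesis using data D \<sigma>_def by blast
qed

end
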